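(* There is an algorithm based on breadth-first search that, given a graph $G$, decides in time $O(|V_G|+|E_G|)$ whether $G$ is independent module-composed, and in the case of a positive answer constructs an independent module-sequence for $G$.
   Context: All graphs are finite, simple and undirected. For a graph $G=(V_G,E_G)$ and $v\in V_G$, $N(v)=\{w\in V_G : \{v,w\}\in E_G\}$. A set $M\subseteq V_G$ is a module of $G$ if for all $v_1,v_2\in M$ we have $N(v_1)\setminus M=N(v_2)\setminus M$ (in particular the empty set, singletons and $V_G$ are modules). For $U\subseteq V_G$, $G[U]$ is the induced subgraph on $U$. An independent module-sequence of $G$ is a bijection $\varphi:V_G\to\{1,\ldots,|V_G|\}$ such that for every $2\le i\le |V_G|$ the neighbourhood of $\varphi^{-1}(i)$ in the graph $G[\{\varphi^{-1}(1),\ldots,\varphi^{-1}(i-1)\}]$ is a module of that graph which is an independent set; $G$ is independent module-composed if it has an independent module-sequence. *)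

theory Defs
  imports Main
begin

record 'a graph =
  verts :: "'a set"
  edges :: "'a set set"

definition simple_graph :: "'a graph \<Rightarrow> bool" where
  "simple_graph G \<longleftrightarrow> finite (verts G) \<and> (\<forall>e\<in>edges G. e \<subseteq> verts G \<and> card e = 2)"

definition nbhd :: "'a graph \<Rightarrow> 'a \<Rightarrow> 'a set" where
  "nbhd G v = {w \<in> verts G. {v, w} \<in> edges G}"

definition is_module :: "'a graph \<Rightarrow> 'a set \<Rightarrow> bool" where
  "is_module G M \<longleftrightarrow>
    M \<subseteq> verts G \<and> (\<forall>v1\<in>M. \<forall>v2\<in>M. nbhd G v1 - M = nbhd G v2 - M)"

definition indep_set :: "'a graph \<Rightarrow> 'a set \<Rightarrow> bool" where
  "indep_set G S \<longleftrightarrow> S \<subseteq> verts G \<and> (\<forall>u\<in>S. \<forall>v\<in>S. {u, v} \<notin> edges G)"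

definition induced :: "'a graph \<Rightarrow> 'a set \<Rightarrow> 'a graph" where
  "induced G U = \<lparr>verts = U, edges = {e \<in> edges G. e \<subseteq> U}\<rparr>"

(* The i-th vertex is not itself a vertex of the graph induced by the earlier ones;
   its neighbourhood there is the set N of those earlier vertices adjacent to it in G. *)
definition indep_module_seq :: "'a graph \<Rightarrow> ('a \<Rightarrow> nat) \<Rightarrow> bool" where
  "indep_module_seq G \<phi> \<longleftrightarrow>
    bij_betw \<phi> (verts G) {1..card (verts G)} \<and>
    (\<forall>i\<in>{2..card (verts G)}.
      let \<psi> = the_inv_into (verts G) \<phi>;
          U = \<psi> ` {1..i - 1};
          N = nbhd G (\<psi> i) \<inter> U
      in is_module (induced G U) N \<and> indep_set (induced G U) N)"

definition indep_module_composed :: "'a graph \<Rightarrow> bool" where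
  "indep_module_composed G \<longleftrightarrow> (\<exists>\<phi>. indep_module_seq G \<phi>)"

(* Breadth-first search: bfs_run G ds q says that a search can reach the situation where the
   vertices ds have been processed, in this order, and q is the queue of discovered vertices
   still to be processed. A new root is chosen only when the queue is empty, and the
   undiscovered neighbours of a processed vertex may be enqueued in any order. *)
inductive bfs_run :: "'a graph \<Rightarrow> 'a list \<Rightarrow> 'a list \<Rightarrow> bool" for G where
  start: "bfs_run G [] []"
| root: "bfs_run G ds [] \<Longrightarrow> v \<in> verts G - set ds \<Longrightarrow> bfs_run G ds [v]"
| visit: "bfs_run G ds (u # q) \<Longrightarrow> distinct ws \<Longrightarrow>
    set ws = nbhd G u - (set ds \<union> set (u # q)) \<Longrightarrow> bfs_run G (ds @ [u]) (q @ ws)"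

definition bfs_order :: "'a graph \<Rightarrow> 'a list \<Rightarrow> bool" where
  "bfs_order G xs \<longleftrightarrow> bfs_run G xs [] \<and> set xs = verts G"

(* Structured programs for a random access machine with numbered registers and numbered
   unbounded arrays, all holding natural numbers. The only arithmetic is addition and
   (truncated) subtraction. *)
datatype test = Eq nat nat | Neq nat nat | Less nat nat | Le nat nat

datatype prog =
    Skip
  | Const nat nat
  | Copy nat nat
  | Add nat nat nat
  | Sub nat nat nat
  | Load nat nat nat     (* Load x a i: register x gets the entry of array a at the index in register i *)
  | Store nat nat nat    (* Store a i x: that entry gets the value of register x *)
  | Seq prog prog
  | If test prog prog
  | While test prog

type_synonym state = "(nat \<Rightarrow> nat) \<times> (nat \<Rightarrow> nat \<Rightarrow> nat)"

fun holds :: "test \<Rightarrow> state \<Rightarrow> bool" where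
  "holds (Eq x y) (R, A) \<longleftrightarrow> R x = R y"
| "holds (Neq x y) (R, A) \<longleftrightarrow> R x \<noteq> R y"
| "holds (Less x y) (R, A) \<longleftrightarrow> R x < R y"
| "holds (Le x y) (R, A) \<longleftrightarrow> R x \<le> R y"

(* exec W p s t s': started in state s, program p terminates in state s' after exactly t
   unit-cost steps, and never computes a number exceeding the word bound W (there is no rule
   for such a step). The bound rules out packing data into huge numbers at unit cost. *)
inductive exec :: "nat \<Rightarrow> prog \<Rightarrow> state \<Rightarrow> nat \<Rightarrow> state \<Rightarrow> bool" for W where
  Skip: "exec W Skip s 1 s"
| Const: "k \<le> W \<Longrightarrow> exec W (Const x k) (R, A) 1 (R(x := k), A)"
| Copy: "R y \<le> W \<Longrightarrow> exec W (Copy x y) (R, A) 1 (R(x := R y), A)"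
| Add: "R y + R z \<le> W \<Longrightarrow> exec W (Add x y z) (R, A) 1 (R(x := R y + R z), A)"
| Sub: "R y - R z \<le> W \<Longrightarrow> exec W (Sub x y z) (R, A) 1 (R(x := R y - R z), A)"
| Load: "A a (R i) \<le> W \<Longrightarrow> exec W (Load x a i) (R, A) 1 (R(x := A a (R i)), A)"
| Store: "R x \<le> W \<Longrightarrow> exec W (Store a i x) (R, A) 1 (R, A(a := (A a)(R i := R x)))"
| Seq: "exec W p s t s' \<Longrightarrow> exec W q s' t' s'' \<Longrightarrow> exec W (Seq p q) s (t + t') s''"
| IfTrue: "holds b s \<Longrightarrow> exec W p s t s' \<Longrightarrow> exec W (If b p q) s (Suc t) s'"
| IfFalse: "\<not> holds b s \<Longrightarrow> exec W q s t s' \<Longrightarrow> exec W (If b p q) s (Suc t) s'"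
| WhileFalse: "\<not> holds b s \<Longrightarrow> exec W (While b p) s 1 s"
| WhileTrue: "holds b s \<Longrightarrow> exec W p s t s' \<Longrightarrow> exec W (While b p) s' t' s'' \<Longrightarrow>
    exec W (While b p) s (Suc (t + t')) s''"

inductive_cases exec_elims:
  "exec W Skip s t s'"
  "exec W (Const x k) s t s'"
  "exec W (Copy x y) s t s'"
  "exec W (Add x y z) s t s'"
  "exec W (Sub x y z) s t s'"
  "exec W (Load x a i) s t s'"
  "exec W (Store a i x) s t s'"
  "exec W (Seq p q) s t s'"
  "exec W (If b p q) s t s'"

inductive_cases exec_WhileE: "exec W (While b p) s t s'"

lemma exec_deterministic:
  "exec W p s t s' \<Longrightarrow> exec W p s u s'' \<Longrightarrow> u = t \<and> s'' = s'"
proof (induction arbitrary: u s'' rule: exec.induct)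
  case (Seq p s t s' q t' s3)
  from Seq.prems show ?case by (rule exec_elims) (use Seq.IH in blast)
next
  case (IfTrue b s p t s' q)
  from IfTrue.prems show ?case by (rule exec_elims) (use IfTrue in blast)+
next
  case (IfFalse b s q t s' p)
  from IfFalse.prems show ?case by (rule exec_elims) (use IfFalse in blast)+
next
  case (WhileFalse b s p)
  from WhileFalse.prems show ?case by (rule exec_WhileE) (use WhileFalse in simp_all)
next
  case (WhileTrue b s p t s' t' s3)
  from WhileTrue.prems show ?case by (rule exec_WhileE) (use WhileTrue in blast)+
qed (erule exec_elims; simp)+

(* Adjacency lists, each in arbitrary order, for a graph with vertices 0, ..., n - 1. *)
definition adj_lists :: "nat graph \<Rightarrow> nat list list \<Rightarrow> bool" where
  "adj_lists G adj \<longleftrightarrow> verts G = {..<length adj} \<and>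
    (\<forall>v<length adj. distinct (adj ! v) \<and> set (adj ! v) = nbhd G v)"

(* Register 0 holds the number of vertices, array 1 holds the concatenated adjacency lists, and
   the list of vertex v occupies the positions from (array 0)[v] up to, excluding,
   (array 0)[v + 1]. All other memory is zero. *)
definition input_state :: "nat list list \<Rightarrow> state" where
  "input_state adj =
    ((\<lambda>x. if x = 0 then length adj else 0),
     (\<lambda>a i. if a = 0 \<and> i \<le> length adj then length (concat (take i adj))
            else if a = 1 \<and> i < length (concat adj) then concat adj ! i
            else 0))"

(* The answer (1 or 0) is returned in register 1 and, if it is 1, the sequence in array 3. *)
definition correct_output :: "nat graph \<Rightarrow> state \<Rightarrow> bool" where
  "correct_output G s \<longleftrightarrow>
    fst s 1 = (if indep_module_composed G then 1 else 0) \<and>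
    (indep_module_composed G \<longrightarrow> indep_module_seq G (snd s 3))"

end

theory Submission
  imports Defs
begin

text \<open>
  Adding a vertex whose neighbourhood is an independent module means attaching it to pairwise twins of
  the current graph. Hence an independent module-composed graph is bipartite, contains no induced
  domino, and two vertices with a common neighbour \<open>v\<close> that both have a neighbour in a connected set
  avoiding \<open>v\<close> and its neighbours have the same neighbours in that set. Applied to the levels of a
  breadth-first search, this gives: all neighbours of \<open>v\<close> in the previous level have the same
  neighbours in the level before, and the sets of neighbours in the previous level of two vertices of
  one level are disjoint or nested. So listing the vertices by level and, within a level, by decreasing
  number of neighbours in the previous level yields an independent module-sequence whenever there is
  one. Two bucket sorts compute this order.

  Whether an order is an independent module-sequence is checked in linear time by maintaining names
  for the twin classes: a vertex is named by its set of earlier neighbours together with the set of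
  earlier neighbours of the last vertex attached to it. The check is sound for every order, and
  complete for the order above.
\<close>

section \<open>Graphs built by attaching vertices to twins\<close>

text \<open>A construction order of the graph is only known to exist, so the structural facts are
  proved by asking which of the vertices involved was added last; its earlier neighbours are twins,
  and this either contradicts the configuration or reduces it. The implication in
  \<open>composed\<close> covers both demands on a neighbourhood: taking \<open>c = b\<close>,
  irreflexivity yields independence. In the check, the last attachment is enough to name a twin
  class: if two vertices have the same last attached set, both lie in it, passed the twin test when
  it was last attached, and nothing has been attached to either since. Where nothing has been
  attached yet, the earlier neighbourhood is the whole neighbourhood. A set that is attached again
  has to get its old name back. In constant time this can be recognised only for the set attached
  last: its name stands on every member of the new set, so the new set is contained in it and
  comparing sizes decides equality. This is why sizes must decrease within a level: equal sets are
  then attached without a smaller one in between on the same vertices.\<close>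

inductive composed :: "('a \<Rightarrow> 'a \<Rightarrow> bool) \<Rightarrow> 'a set \<Rightarrow> bool" for E where
  empty: "composed E {}"
| insert: "composed E S \<Longrightarrow> x \<notin> S \<Longrightarrow>
    (\<And>a b c. a \<in> S \<Longrightarrow> b \<in> S \<Longrightarrow> c \<in> S \<Longrightarrow> E x a \<Longrightarrow> E x b \<Longrightarrow> E a c \<Longrightarrow> E b c) \<Longrightarrow>
    composed E (insert x S)"

locale sgraph =
  fixes E :: "'a \<Rightarrow> 'a \<Rightarrow> bool"
  assumes sym: "E a b \<Longrightarrow> E b a" and irrefl: "\<not> E a a"
begin

lemma commute: "E a b \<longleftrightarrow> E b a"
  using sym by blast

text \<open>If some neighbour of \<open>x\<close> has a neighbour \<open>z\<close>, all neighbours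
  of \<open>x\<close> are adjacent to \<open>z\<close> by twinness, so \<open>x\<close> can take the
  colour of \<open>z\<close>. Otherwise the neighbours of \<open>x\<close> are isolated so far and
  can be recoloured freely.\<close>

lemma composed_two_colouring:
  "composed E S \<Longrightarrow> \<exists>f :: 'a \<Rightarrow> bool. \<forall>a\<in>S. \<forall>b\<in>S. E a b \<longrightarrow> f a \<noteq> f b"
proof (induction rule: composed.induct)
  case (insert S x)
  from insert.IH obtain f :: "'a \<Rightarrow> bool" where f: "\<And>a b. a \<in> S \<Longrightarrow> b \<in> S \<Longrightarrow> E a b \<Longrightarrow> f a \<noteq> f b"
    by blast
  note tw = insert.hyps(3)
  show ?case
  proof (cases "\<exists>a\<in>S. E x a \<and> (\<exists>z\<in>S. E a z)")
    case True
    then obtain a z where a: "a \<in> S" "E x a" "z \<in> S" "E a z" by blast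
    have *: "f b \<noteq> f z" if "b \<in> S" "E x b" for b
      by (rule f[OF that(1) a(3) tw[OF a(1) that(1) a(3,2) that(2) a(4)]])
    have "(f(x := f z)) b \<noteq> (f(x := f z)) c"
      if "b \<in> insert x S" "c \<in> insert x S" "E b c" for b c
      using that *[of b] *[of c] f[of b c] sym[of b c] irrefl[of x]
      by (cases "b = x"; cases "c = x") auto
    then show ?thesis by blast
  next
    case False
    let ?g = "\<lambda>y. if y = x then True else if E x y then False else f y"
    have "?g b \<noteq> ?g c" if "b \<in> insert x S" "c \<in> insert x S" "E b c" for b c
      using that False f[of b c] sym[of b c] irrefl[of x]
      by (cases "b = x"; cases "c = x") auto
    then show ?thesis by (intro exI[of _ ?g] ballI impI)
  qed
qed simp

text \<open>Connectedness by cuts instead of paths: deleting a vertex then only means looking at a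
  cut without an edge. The empty set counts as connected.\<close>

definition conn :: "'a set \<Rightarrow> bool" where
  "conn C \<longleftrightarrow> (\<forall>A B. A \<union> B = C \<longrightarrow> A \<inter> B = {} \<longrightarrow> A \<noteq> {} \<longrightarrow> B \<noteq> {} \<longrightarrow> (\<exists>a\<in>A. \<exists>b\<in>B. E a b))"

lemma connD:
  assumes "conn C" "A \<union> B = C" "A \<inter> B = {}" "A \<noteq> {}" "B \<noteq> {}"
  obtains a b where "a \<in> A" "b \<in> B" "E a b"
  using assms unfolding conn_def by blast

lemma conn_has_neighbour:
  assumes "conn C" "x \<in> C" "C \<noteq> {x}"
  obtains y where "y \<in> C" "y \<noteq> x" "E x y"
proof -
  obtain a b where "a \<in> {x}" "b \<in> C - {x}" "E a b"
    using assms by (elim connD[of C "{x}" "C - {x}"]) auto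
  then show ?thesis using that by blast
qed

text \<open>If deleting \<open>x\<close> disconnects \<open>C\<close>, two neighbours of \<open>x\<close> from different parts are twins
  outside \<open>x\<close>, so they have no other neighbour in \<open>C\<close>.\<close>

lemma conn_remove_twins:
  assumes C: "conn C" and x: "x \<in> C"
    and tw: "\<And>a b c. a \<in> C - {x} \<Longrightarrow> b \<in> C - {x} \<Longrightarrow> c \<in> C - {x} \<Longrightarrow> E x a \<Longrightarrow> E x b \<Longrightarrow> E a c \<Longrightarrow> E b c"
  shows "conn (C - {x}) \<or> (\<forall>y\<in>C - {x}. E x y)"
proof (rule ccontr)
  assume "\<not> ?thesis"
  then obtain A B y where AB: "A \<union> B = C - {x}" "A \<inter> B = {}" "A \<noteq> {}" "B \<noteq> {}"
    and no: "\<And>a b. a \<in> A \<Longrightarrow> b \<in> B \<Longrightarrow> \<not> E a b"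
    and y: "y \<in> C" "y \<noteq> x" "\<not> E x y"
    unfolding conn_def by blast
  obtain b where b: "b \<in> B" "E x b"
  proof -
    obtain a b where "a \<in> insert x A" "b \<in> B" "E a b"
      by (rule connD[OF C, of "insert x A" B]) (use AB x in auto)
    then show ?thesis using that no by blast
  qed
  obtain a where a: "a \<in> A" "E x a"
  proof -
    obtain a b where "a \<in> A" "b \<in> insert x B" "E a b"
      by (rule connD[OF C, of A "insert x B"]) (use AB x in auto)
    then show ?thesis using that no sym by blast
  qed
  have lonely: "\<not> E c z" if "c \<in> C - {x}" "E x c" "z \<in> C - {x}" for c z
  proof
    assume "E c z"
    then have "E a z" "E b z" using tw[of c a z] tw[of c b z] that a b AB by blast+
    then show False using no a b that AB sym by (metis UnE)
  qed
  obtain c z where "c \<in> insert x {c \<in> C. E x c}" "z \<in> C - insert x {c \<in> C. E x c}" "E c z"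
    by (rule connD[OF C, of "insert x {c \<in> C. E x c}" "C - insert x {c \<in> C. E x c}"])
      (use x y in auto)
  then show False using lonely[of c z] x by auto
qed

text \<open>Induction on the last vertex \<open>x\<close>. If \<open>x = v\<close>, then
  \<open>u\<close> and \<open>u'\<close> are twins by construction. If \<open>x\<close> is
  \<open>u\<close> or \<open>u'\<close>, the set \<open>C\<close> shrinks to one vertex. If
  \<open>x\<close> lies in \<open>C\<close>, neither \<open>u\<close> nor \<open>u'\<close> is
  adjacent to it, so \<open>C - {x}\<close> can replace \<open>C\<close> as long as it is connected.
  Stating the lemma for arbitrary connected \<open>C\<close> is what lets this induction
  run.\<close>

lemma composed_same_upper_neighbours:
  assumes "composed E S" "conn C" "C \<subseteq> S" "u \<in> S - C" "u' \<in> S - C" "v \<in> S - C"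
    "E u v" "E u' v" "\<And>c. c \<in> C \<Longrightarrow> \<not> E v c"
    "\<exists>c\<in>C. E u c" "\<exists>c\<in>C. E u' c" "c \<in> C" "E u c"
  shows "E u' c"
  using assms
proof (induction arbitrary: C u u' v c rule: composed.induct)
  case (insert S x)
  note tw = insert.hyps(3) and C = insert.prems(1,2) and uv = insert.prems(3-7)
    and vC = insert.prems(8) and c = insert.prems(11,12)
  have IH: "E u' c" if "conn D" "D \<subseteq> S" "D \<subseteq> C" "\<exists>c\<in>D. E u c" "\<exists>c\<in>D. E u' c" "c \<in> D"
      "u \<noteq> x" "u' \<noteq> x" "v \<noteq> x" for D
    by (rule insert.IH[OF that(1), of u u' v]) (use that insert.prems in auto)
  \<comment> \<open>A vertex \<open>x\<close> in the role of \<open>u\<close> or \<open>u'\<close> makes \<open>v\<close> a twin of its neighbours in \<open>C\<close>, which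
    therefore are isolated in \<open>C\<close>.\<close>
  have single: "C = {b} \<and> E p' b"
    if "p = x" "b \<in> C" "E p b" "E p' v" "E p v" "p' \<in> S" "p \<notin> C" "v \<noteq> x" for p p' b
  proof -
    have bS: "b \<in> S" "v \<in> S" "C \<subseteq> S" using that C uv by auto
    have "E p' b" using tw[of v b p'] bS that sym by blast
    moreover have "C = {b}"
    proof (rule ccontr)
      assume "C \<noteq> {b}"
      then obtain y where "y \<in> C" "E b y" using conn_has_neighbour[OF C(1) \<open>b \<in> C\<close>] by blast
      then have "E v y" using tw[of b v y] bS that by blast
      with vC \<open>y \<in> C\<close> show False by blast
    qed
    ultimately show ?thesis by blast
  qed
  consider "u = u'" | "v = x" "u \<noteq> u'" | "u = x" "u' \<noteq> x" "v \<noteq> x" | "u' = x" "u \<noteq> x" "v \<noteq> x"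
    | "u \<noteq> x" "u' \<noteq> x" "v \<noteq> x" "x \<notin> C" | "u \<noteq> x" "u' \<noteq> x" "v \<noteq> x" "x \<in> C"
    by blast
  then show ?case
  proof cases
    case 1 then show ?thesis using c by simp
  next
    case 2
    then have "u \<in> S" "u' \<in> S" "c \<in> S" using uv C c irrefl by auto
    then show ?thesis using tw[of u u' c] 2 uv c sym by blast
  next
    case 3
    then show ?thesis using single[of u c u'] c uv by auto
  next
    case 4
    obtain b where b: "b \<in> C" "E u' b" using insert.prems(10) by blast
    then have "C = {b}" using single[of u' b u] 4 uv by auto
    then show ?thesis using b c by blast
  next
    case 5
    then show ?thesis using IH[of C] insert.prems by auto
  next
    case 6
    have S: "u \<in> S" "u' \<in> S" "v \<in> S" "C - {x} \<subseteq> S" using 6 uv C by auto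
    show ?thesis
    proof (cases "C = {x}")
      case True then show ?thesis using insert.prems(10) c by blast
    next
      case False
      obtain y where y: "y \<in> C" "y \<noteq> x" "E x y"
        using conn_has_neighbour[OF C(1) \<open>x \<in> C\<close> False] by blast
      \<comment> \<open>If \<open>x\<close> were adjacent to \<open>p\<close>, then \<open>p\<close>
        and \<open>y\<close> would be twins, and \<open>v\<close>, a neighbour of \<open>p\<close>,
        would be adjacent to \<open>y\<close> in \<open>C\<close>.\<close>
      have no: "\<not> E x p" if "p \<in> S" "E p v" for p
        using tw[of p y v] that y S vC sym by blast
      have nox: "\<not> E u x" "\<not> E u' x" using no S uv sym by blast+
      have "conn (C - {x}) \<or> (\<forall>y\<in>C - {x}. E x y)"
        by (rule conn_remove_twins[OF C(1) 6(4)]) (use tw S in blast)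
      then show ?thesis
      proof
        assume "conn (C - {x})"
        then show ?thesis using IH[of "C - {x}"] S insert.prems(9,10) c nox 6 by blast
      next
        \<comment> \<open>Now \<open>b\<close> and \<open>c\<close> are both neighbours of
          \<open>x\<close>, hence twins, so the neighbour \<open>u'\<close> of \<open>b\<close> is
          also one of \<open>c\<close>.\<close>
        assume star: "\<forall>y\<in>C - {x}. E x y"
        obtain b where b: "b \<in> C" "E u' b" using insert.prems(10) by blast
        then have "b \<noteq> x" "c \<noteq> x" using nox c by blast+
        then show ?thesis using tw[of b c u'] star b c S sym by blast
      qed
    qed
  qed
qed simp

text \<open>The 4-cycles \<open>z a v b\<close> and \<open>z b w e\<close> share the edge
  \<open>z b\<close>. Each of the six vertices has two neighbours among the others that are told
  apart by a third one, so none of them can have been added last.\<close>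

lemma composed_no_domino:
  assumes "composed E S" "{z, a, b, e, v, w} \<subseteq> S"
    "E z a" "E z b" "E z e" "E v a" "E v b" "E w b" "E w e" "\<not> E v e" "\<not> E w a"
  shows False
  using assms
proof (induction rule: composed.induct)
  case (insert S x)
  note tw = insert.hyps(3) and p = insert.prems
  have ne: "z \<noteq> v" "z \<noteq> w" "v \<noteq> w" "a \<noteq> e" "a \<noteq> b" "b \<noteq> e" using p by auto
  have ne2: "z \<noteq> a" "z \<noteq> b" "z \<noteq> e" "v \<noteq> a" "v \<noteq> b" "w \<noteq> b" "w \<noteq> e" using p irrefl by auto
  consider "x = z" | "x = a" | "x = b" | "x = e" | "x = v" | "x = w" | "{z, a, b, e, v, w} \<subseteq> S"
    using p(1) by blast
  then show ?case
  proof cases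
    case 1 then show ?thesis using tw[of b a w] p ne ne2 by (auto simp: commute)
  next
    case 2 then show ?thesis using tw[of z v e] p ne ne2 by (auto simp: commute)
  next
    case 3 then show ?thesis using tw[of z v e] p ne ne2 by (auto simp: commute)
  next
    case 4 then show ?thesis using tw[of z w a] p ne ne2 by (auto simp: commute)
  next
    case 5 then show ?thesis using tw[of b a w] p ne ne2 by (auto simp: commute)
  next
    case 6 then show ?thesis using tw[of b e v] p ne ne2 by (auto simp: commute)
  next
    case 7 then show ?thesis using insert.IH p by blast
  qed
qed simp

end

text \<open>The most recently added vertex is the head of the list.\<close>

primrec built :: "('a \<Rightarrow> 'a \<Rightarrow> bool) \<Rightarrow> 'a list \<Rightarrow> bool" where
  "built E [] \<longleftrightarrow> True"
| "built E (x # xs) \<longleftrightarrow> built E xs \<and>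
    (\<forall>a\<in>set xs. \<forall>b\<in>set xs. E x a \<longrightarrow> E x b \<longrightarrow> (\<forall>c\<in>set xs. E a c \<longrightarrow> E b c))"

lemma built_imp_composed: "distinct xs \<Longrightarrow> built E xs \<Longrightarrow> composed E (set xs)"
proof (induction xs)
  case (Cons x xs)
  have "composed E (insert x (set xs))"
    by (rule composed.insert) (use Cons in \<open>simp, simp, unfold built.simps, blast\<close>)
  then show ?case by simp
qed (simp add: composed.empty)

text \<open>A breadth-first levelling: \<open>L\<close> is one plus the distance from the root \<open>rt v\<close> of the component.\<close>

locale levelled = sgraph E for E :: "'a \<Rightarrow> 'a \<Rightarrow> bool" +
  fixes V :: "'a set" and L :: "'a \<Rightarrow> nat" and rt :: "'a \<Rightarrow> 'a"
  assumes fin: "finite V"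
    and comp: "composed E V"
    and edge: "\<lbrakk>u \<in> V; w \<in> V; E u w\<rbrakk> \<Longrightarrow> rt u = rt w \<and> L w \<le> Suc (L u)"
    and parent: "v \<in> V \<Longrightarrow> (L v = 1 \<and> rt v = v) \<or> (\<exists>p\<in>V. E v p \<and> L v = Suc (L p))"
    and L_pos: "v \<in> V \<Longrightarrow> 1 \<le> L v"
begin

definition lower :: "'a \<Rightarrow> 'a set" where
  "lower v = {w \<in> V. E v w \<and> L w < L v}"

lemma finite_lower: "finite (lower v)"
  using fin by (simp add: lower_def)

text \<open>Colours alternate along parents, so within a component the parity of \<open>L\<close>
  determines the colour, and an edge inside a level would join equal colours. Using
  \<open>edge\<close> in both directions then leaves a difference of exactly one.\<close>

lemma L_adjacent:
  assumes "u \<in> V" "w \<in> V" "E u w"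
  shows "L u = Suc (L w) \<or> L w = Suc (L u)"
proof -
  obtain f :: "'a \<Rightarrow> bool" where f: "\<forall>a\<in>V. \<forall>b\<in>V. E a b \<longrightarrow> f a \<noteq> f b"
    using composed_two_colouring[OF comp] by blast
  have par: "f v = (f (rt v) \<longleftrightarrow> odd (L v))" if "v \<in> V" for v
    using that
  proof (induction "L v" arbitrary: v rule: less_induct)
    case less
    from parent[OF less.prems] show ?case
    proof
      assume "\<exists>p\<in>V. E v p \<and> L v = Suc (L p)"
      then obtain p where p: "p \<in> V" "E v p" "L v = Suc (L p)" by blast
      then have "rt v = rt p" using edge less.prems by blast
      moreover have "f v \<noteq> f p" using f p less.prems by blast
      ultimately show ?thesis using less.hyps[of p] p by auto
    qed simp
  qed
  have "L u \<noteq> L w"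
  proof
    assume "L u = L w"
    moreover have "rt u = rt w" using edge assms by blast
    ultimately have "f u = f w" using par assms by simp
    then show False using f assms by blast
  qed
  moreover have "L w \<le> Suc (L u)" "L u \<le> Suc (L w)"
    using edge[OF assms] edge[OF assms(2,1) sym[OF assms(3)]] by auto
  ultimately show ?thesis by linarith
qed

text \<open>In the side of the cut that avoids the root, a vertex of least level has its parent on
  the other side.\<close>

lemma conn_upper: "conn {y \<in> V. rt y = r \<and> L y \<le> k}"
  unfolding conn_def
proof (intro allI impI)
  fix A B
  assume AB: "A \<union> B = {y \<in> V. rt y = r \<and> L y \<le> k}" "A \<inter> B = {}" "A \<noteq> {}" "B \<noteq> {}"
  have step: "\<exists>a\<in>P. \<exists>b\<in>Q. E a b"
    if PQ: "P \<union> Q = {y \<in> V. rt y = r \<and> L y \<le> k}" "P \<inter> Q = {}" "r \<notin> P" "P \<noteq> {}" for P Q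
  proof -
    obtain x where x: "x \<in> P" "\<And>y. y \<in> P \<Longrightarrow> L x \<le> L y"
      using \<open>P \<noteq> {}\<close> ex_has_least_nat[of "\<lambda>y. y \<in> P" _ L] by blast
    have xV: "x \<in> V" "rt x = r" "L x \<le> k" using x PQ by auto
    from parent[OF xV(1)] obtain p where p: "p \<in> V" "E x p" "L x = Suc (L p)"
      using xV x PQ by auto
    have "rt p = r" using edge[OF xV(1) p(1,2)] xV by simp
    then have "p \<in> P \<union> Q" using PQ(1) p xV by simp
    moreover have "p \<notin> P" using x(2)[of p] p by auto
    ultimately show ?thesis using x p by blast
  qed
  show "\<exists>a\<in>A. \<exists>b\<in>B. E a b"
  proof (cases "r \<in> A")
    case False then show ?thesis using step[of A B] AB by blast
  next
    case True
    then have "r \<notin> B" using AB(2) by blast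
    moreover have "B \<union> A = {y \<in> V. rt y = r \<and> L y \<le> k}" "B \<inter> A = {}" using AB by blast+
    ultimately obtain b a where "b \<in> B" "a \<in> A" "E b a" using step[of B A] AB by blast
    then show ?thesis using sym by blast
  qed
qed

text \<open>Instance of \<open>composed_same_upper_neighbours\<close> where \<open>C\<close>
  consists of the vertices of the component at least two levels above \<open>v\<close>: no neighbour
  of \<open>v\<close> lies there, while \<open>a\<close> sees \<open>c\<close> and \<open>b\<close>
  sees its parent in it.\<close>

lemma lower_of_lower:
  assumes "v \<in> V" "a \<in> lower v" "b \<in> lower v"
  shows "lower a \<subseteq> lower b"
proof
  fix c assume c: "c \<in> lower a"
  have ab: "a \<in> V" "b \<in> V" "E v a" "E v b" "L v = Suc (L a)" "L v = Suc (L b)"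
    using assms L_adjacent[of v a] L_adjacent[of v b] by (auto simp: lower_def)
  have cc: "c \<in> V" "E a c" "L a = Suc (L c)"
    using c L_adjacent[of a c] ab by (auto simp: lower_def)
  define C where "C = {y \<in> V. rt y = rt v \<and> L y \<le> L c}"
  have rts: "rt a = rt v" "rt b = rt v" "rt c = rt v"
    using edge[OF assms(1) ab(1,3)] edge[OF assms(1) ab(2,4)] edge[OF ab(1) cc(1,2)] by auto
  have "\<exists>d\<in>C. E b d"
  proof -
    have "L b \<noteq> 1" using L_pos[OF cc(1)] cc ab by simp
    then obtain p where "p \<in> V" "E b p" "L b = Suc (L p)" using parent[OF ab(2)] by blast
    then show ?thesis using edge[OF ab(2), of p] rts ab cc by (auto simp: C_def)
  qed
  moreover have "\<not> E v d" if "d \<in> C" for d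
    using that L_adjacent[OF assms(1), of d] ab cc by (auto simp: C_def)
  ultimately have "E b c"
    using composed_same_upper_neighbours[OF comp conn_upper[of "rt v" "L c", folded C_def],
        of a b v c] ab cc rts assms(1) sym by (auto simp: C_def)
  then show "c \<in> lower b" using cc ab by (simp add: lower_def)
qed

text \<open>If the sets overlap without being nested as claimed, the cardinalities give
  \<open>b\<close> and \<open>e\<close> private to \<open>v\<close> and \<open>w\<close>. A parent
  \<open>z\<close> of the common vertex \<open>a\<close> is adjacent to \<open>b\<close> and
  \<open>e\<close> too by \<open>lower_of_lower\<close>, which completes a domino. If
  \<open>a\<close> has no parent it is the root, the only vertex of its level and component, so
  \<open>a = b\<close>.\<close>

lemma lower_laminar:
  assumes "v \<in> V" "w \<in> V" "L v = L w" "a \<in> lower v" "a \<in> lower w" "card (lower v) \<le> card (lower w)"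
  shows "lower v \<subseteq> lower w"
proof
  fix b assume b: "b \<in> lower v"
  show "b \<in> lower w"
  proof (rule ccontr)
    assume nb: "b \<notin> lower w"
    have "\<not> lower w \<subseteq> lower v"
      using nb b assms(6) finite_lower by (metis card_seteq)
    then obtain e where e: "e \<in> lower w" "e \<notin> lower v" by blast
    have V: "a \<in> V" "b \<in> V" "e \<in> V" and adj: "E v a" "E v b" "E w a" "E w e"
      and lev: "L b < L v" "L e < L w"
      using assms b e by (auto simp: lower_def)
    have nadj: "\<not> E v e" "\<not> E w b" using e nb V lev assms(3) by (auto simp: lower_def)
    have La: "L v = Suc (L a)" "L v = Suc (L b)"
      using L_adjacent[OF assms(1) V(1) adj(1)] L_adjacent[OF assms(1) V(2) adj(2)] lev assms(4)
      by (auto simp: lower_def)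
    have rts: "rt a = rt b"
      using edge[OF assms(1) V(1) adj(1)] edge[OF assms(1) V(2) adj(2)] by simp
    from parent[OF V(1)] show False
    proof
      assume r: "L a = 1 \<and> rt a = a"
      then have "L b = 1" using La by simp
      then have "rt b = b" using parent[OF V(2)] L_pos by force
      then show False using rts r nb assms(5) by simp
    next
      assume "\<exists>p\<in>V. E a p \<and> L a = Suc (L p)"
      then obtain z where z: "z \<in> V" "E a z" "L a = Suc (L z)" by blast
      then have "z \<in> lower a" by (simp add: lower_def)
      then have "z \<in> lower b" "z \<in> lower e"
        using lower_of_lower[OF assms(1) assms(4) b] lower_of_lower[OF assms(2) assms(5) e(1)] by auto
      then have "E z b" "E z e" "E z a" using z sym by (auto simp: lower_def)
      then show False
        using composed_no_domino[OF comp, of z b a e v w] V adj nadj z assms(1,2) by auto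
    qed
  qed
qed

text \<open>Lists have the latest vertex at the head, so levels decrease and cardinalities increase
  along a list sorted by this relation.\<close>

definition newer :: "'a \<Rightarrow> 'a \<Rightarrow> bool" where
  "newer a b \<longleftrightarrow> L b < L a \<or> (L a = L b \<and> card (lower a) \<le> card (lower b))"

text \<open>An earlier vertex is never on a deeper level, and edges inside a level do not
  exist.\<close>

lemma back_eq_lower:
  assumes "set zs = V" "zs = ys @ v # xs" "sorted_wrt newer zs"
  shows "{w \<in> set xs. E v w} = lower v"
proof (intro set_eqI iffI)
  fix w assume w: "w \<in> {w \<in> set xs. E v w}"
  then have "newer v w" "w \<in> V" "v \<in> V" using assms by (auto simp: sorted_wrt_append)
  then show "w \<in> lower v" using w L_adjacent[of v w] by (auto simp: newer_def lower_def)
next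
  fix w assume w: "w \<in> lower v"
  then have "w \<noteq> v" by (auto simp: lower_def)
  moreover have "w \<notin> set ys"
  proof
    assume "w \<in> set ys"
    then have "newer w v" using assms by (auto simp: sorted_wrt_append)
    then show False using w by (auto simp: newer_def lower_def)
  qed
  ultimately show "w \<in> {w \<in> set xs. E v w}" using w assms by (auto simp: lower_def)
qed

lemma lower_in_suffix:
  assumes "set zs = V" "zs = ys @ xs" "sorted_wrt newer zs" "u \<in> set xs"
  shows "lower u \<subseteq> set xs"
proof
  fix w assume w: "w \<in> lower u"
  have "w \<notin> set ys"
  proof
    assume "w \<in> set ys"
    then have "newer w u" using assms by (auto simp: sorted_wrt_append)
    then show False using w by (auto simp: newer_def lower_def)
  qed
  then show "w \<in> set xs" using w assms by (auto simp: lower_def)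
qed

text \<open>A neighbour \<open>c\<close> of \<open>a\<close> lies either above \<open>a\<close>,
  where \<open>lower_of_lower\<close> applies, or on the level of \<open>v\<close>. In the second
  case \<open>c\<close> was placed before \<open>v\<close>, so its \<open>lower\<close> set is at
  least as large, shares \<open>a\<close> with that of \<open>v\<close>, and contains it by
  \<open>lower_laminar\<close>.\<close>

lemma sorted_imp_built:
  assumes "set zs = V" "zs = ys @ xs" "sorted_wrt newer zs"
  shows "built E xs"
  using assms(2)
proof (induction xs arbitrary: ys)
  case (Cons v xs)
  have "E b c" if in_xs: "a \<in> set xs" "b \<in> set xs" "c \<in> set xs" and adj: "E v a" "E v b" "E a c" for a b c
  proof -
    note bl = back_eq_lower[OF assms(1) Cons.prems assms(3)]
    have V: "v \<in> V" "set xs \<subseteq> V" using Cons.prems assms(1) by auto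
    have ab: "a \<in> lower v" "b \<in> lower v" using bl that by blast+
    have c: "newer v c" using Cons.prems assms(3) in_xs by (auto simp: sorted_wrt_append)
    have La: "L v = Suc (L a)"
      using L_adjacent[of v a] ab(1) V by (auto simp: lower_def)
    have Lc: "L a = Suc (L c) \<or> L c = Suc (L a)" using L_adjacent[of a c] in_xs V adj by blast
    show ?thesis
    proof (cases "L c < L a")
      case True
      then have "c \<in> lower a" using in_xs V adj by (auto simp: lower_def)
      then show ?thesis using lower_of_lower[OF V(1) ab] by (auto simp: lower_def)
    next
      case False
      then have Lcv: "L c = L v" using Lc La by simp
      then have "card (lower v) \<le> card (lower c)" using c by (simp add: newer_def)
      moreover have "a \<in> lower c" using in_xs V adj sym La Lcv by (auto simp: lower_def)
      ultimately have "lower v \<subseteq> lower c"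
        using lower_laminar[OF V(1), of c a] in_xs V Lcv ab by auto
      then show ?thesis using ab sym by (auto simp: lower_def)
    qed
  qed
  moreover have "built E xs" using Cons.IH[of "ys @ [v]"] Cons.prems by simp
  ultimately show ?case unfolding built.simps by blast
qed simp

end

section \<open>Independent module-sequences as lists\<close>

definition adjacent :: "'a graph \<Rightarrow> 'a \<Rightarrow> 'a \<Rightarrow> bool" where
  "adjacent G u w \<longleftrightarrow> {u, w} \<in> edges G"

lemma sgraph_adjacent: "simple_graph G \<Longrightarrow> sgraph (adjacent G)"
  by standard (auto simp: adjacent_def insert_commute simple_graph_def)

lemma nbhd_adjacent: "nbhd G v = {w \<in> verts G. adjacent G v w}"
  by (simp add: nbhd_def adjacent_def)

lemma built_rev_iff:
  "built E (rev xs) \<longleftrightarrow> (\<forall>i<length xs. \<forall>a\<in>set (take i xs). \<forall>b\<in>set (take i xs).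
     E (xs ! i) a \<longrightarrow> E (xs ! i) b \<longrightarrow> (\<forall>c\<in>set (take i xs). E a c \<longrightarrow> E b c))"
proof (induction xs rule: rev_induct)
  case (snoc x xs)
  have *: "(\<forall>i<length (xs @ [x]). P i) \<longleftrightarrow> (\<forall>i<length xs. P i) \<and> P (length xs)" for P
    by (simp add: less_Suc_eq) blast
  show ?case unfolding * using snoc by (simp add: nth_append)
qed simp

text \<open>With \<open>c = b\<close> the twin condition excludes edges inside the neighbourhood.
  For an independent set, subtracting the set itself in the module condition changes nothing, so
  both sides compare whole neighbourhoods.\<close>

lemma indep_module_iff_twins:
  assumes "simple_graph G" "U \<subseteq> verts G"
  shows "is_module (induced G U) (nbhd G v \<inter> U) \<and> indep_set (induced G U) (nbhd G v \<inter> U) \<longleftrightarrow>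
    (\<forall>a\<in>U. \<forall>b\<in>U. adjacent G v a \<longrightarrow> adjacent G v b \<longrightarrow> (\<forall>c\<in>U. adjacent G a c \<longrightarrow> adjacent G b c))"
    (is "?M \<and> ?I \<longleftrightarrow> ?T")
proof -
  interpret sgraph "adjacent G" using assms(1) by (rule sgraph_adjacent)
  let ?N = "{a \<in> U. adjacent G v a}"
  have N: "nbhd G v \<inter> U = ?N" using assms(2) by (auto simp: nbhd_adjacent)
  have vi: "verts (induced G U) = U" by (simp add: induced_def)
  have nb: "nbhd (induced G U) a = {c \<in> U. adjacent G a c}" if "a \<in> U" for a
    using that by (auto simp: nbhd_def induced_def adjacent_def)
  have M: "?M \<longleftrightarrow> (\<forall>a\<in>?N. \<forall>b\<in>?N. {c \<in> U. adjacent G a c} - ?N = {c \<in> U. adjacent G b c} - ?N)"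
    unfolding N is_module_def vi by (simp add: nb Collect_restrict cong: ball_cong)
  have I: "?I \<longleftrightarrow> (\<forall>a\<in>?N. \<forall>b\<in>?N. \<not> adjacent G a b)"
    unfolding N indep_set_def vi by (auto simp: induced_def adjacent_def)
  show ?thesis unfolding M I
  proof
    assume l: "(\<forall>a\<in>?N. \<forall>b\<in>?N. {c \<in> U. adjacent G a c} - ?N = {c \<in> U. adjacent G b c} - ?N) \<and>
      (\<forall>a\<in>?N. \<forall>b\<in>?N. \<not> adjacent G a b)"
    show ?T
    proof (intro ballI impI)
      fix a b c assume h: "a \<in> U" "b \<in> U" "adjacent G v a" "adjacent G v b" "c \<in> U" "adjacent G a c"
      then have "c \<in> {c \<in> U. adjacent G a c} - ?N" using l by blast
      also have "\<dots> = {c \<in> U. adjacent G b c} - ?N" using l h by blast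
      finally show "adjacent G b c" by blast
    qed
  next
    assume r: ?T
    have "\<not> adjacent G a b" if "a \<in> ?N" "b \<in> ?N" for a b
      using r that irrefl by blast
    moreover have "{c \<in> U. adjacent G a c} = {c \<in> U. adjacent G b c}" if "a \<in> ?N" "b \<in> ?N" for a b
      using r that by blast
    ultimately show "(\<forall>a\<in>?N. \<forall>b\<in>?N. {c \<in> U. adjacent G a c} - ?N = {c \<in> U. adjacent G b c} - ?N) \<and>
      (\<forall>a\<in>?N. \<forall>b\<in>?N. \<not> adjacent G a b)" by blast
  qed
qed

lemma indep_module_seq_iff_built:
  assumes G: "simple_graph G" and xs: "distinct xs" "set xs = verts G"
    and \<phi>: "\<And>i. i < length xs \<Longrightarrow> \<phi> (xs ! i) = Suc i"
  shows "indep_module_seq G \<phi> \<longleftrightarrow> built (adjacent G) (rev xs)"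
proof -
  interpret sgraph "adjacent G" using G by (rule sgraph_adjacent)
  let ?\<psi> = "the_inv_into (verts G) \<phi>" and ?n = "length xs"
  have n: "card (verts G) = ?n" using xs distinct_card by metis
  have inj: "inj_on \<phi> (verts G)"
    unfolding xs(2)[symmetric] by (rule inj_onI) (metis \<phi> in_set_conv_nth old.nat.inject)
  have img: "\<phi> ` verts G = {1..?n}"
  proof -
    have "\<phi> ` verts G = (\<lambda>i. \<phi> (xs ! i)) ` {..<?n}"
      unfolding xs(2)[symmetric] set_conv_nth by auto
    also have "\<dots> = Suc ` {..<?n}" using \<phi> by (intro image_cong) auto
    also have "\<dots> = {1..?n}" by (simp add: lessThan_atLeast0 image_Suc_atLeastLessThan atLeastLessThanSuc_atLeastAtMost)
    finally show ?thesis .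
  qed
  have \<psi>: "?\<psi> (Suc i) = xs ! i" if "i < ?n" for i
    by (rule the_inv_into_f_eq[OF inj \<phi>[OF that] nth_mem[OF that, unfolded xs(2)]])
  have U: "?\<psi> ` {1..i} = set (take i xs)" if "i \<le> ?n" for i
  proof -
    have "{1..i} = Suc ` {..<i}"
      by (simp add: lessThan_atLeast0 image_Suc_atLeastLessThan atLeastLessThanSuc_atLeastAtMost)
    then have "?\<psi> ` {1..i} = (\<lambda>k. ?\<psi> (Suc k)) ` {..<i}" by (simp only: image_image)
    also have "\<dots> = (!) xs ` {..<i}" using \<psi> that by (intro image_cong) auto
    also have "\<dots> = set (take i xs)" using nth_image[OF that] by (simp add: lessThan_atLeast0)
    finally show ?thesis .
  qed
  let ?T = "\<lambda>i. \<forall>a\<in>set (take i xs). \<forall>b\<in>set (take i xs).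
     adjacent G (xs ! i) a \<longrightarrow> adjacent G (xs ! i) b \<longrightarrow> (\<forall>c\<in>set (take i xs). adjacent G a c \<longrightarrow> adjacent G b c)"
  have step: "(let \<psi> = ?\<psi>; U = \<psi> ` {1..i - 1}; N = nbhd G (\<psi> i) \<inter> U
      in is_module (induced G U) N \<and> indep_set (induced G U) N) \<longleftrightarrow> ?T (i - 1)"
    if i: "i \<in> {2..?n}" for i
  proof -
    have k: "i = Suc (i - 1)" "i - 1 < ?n" using i by auto
    have "?\<psi> i = xs ! (i - 1)" using \<psi>[OF k(2)] k(1) by simp
    moreover have "?\<psi> ` {1..i - 1} = set (take (i - 1) xs)" using U[of "i - 1"] k(2) by linarith
    moreover have "set (take (i - 1) xs) \<subseteq> verts G" using xs(2) set_take_subset by fastforce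
    ultimately show ?thesis unfolding Let_def by (simp only: indep_module_iff_twins[OF G])
  qed
  have "indep_module_seq G \<phi> \<longleftrightarrow> (\<forall>i\<in>{2..?n}. ?T (i - 1))"
    unfolding indep_module_seq_def n
    by (simp only: bij_betw_def inj img simp_thms step cong: ball_cong)
  \<comment> \<open>The module condition starts at 2, that is, at list index 1; at index 0 there are
    no earlier vertices and \<open>?T\<close> is vacuous.\<close>
  also have "\<dots> \<longleftrightarrow> (\<forall>i<?n. ?T i)"
  proof (rule iffI; rule allI ballI; (rule impI)?)
    fix i assume h: "\<forall>i\<in>{2..?n}. ?T (i - 1)" "i < ?n"
    show "?T i"
    proof (cases i)
      case (Suc j)
      then have "Suc i \<in> {2..?n}" using h by simp
      then have "?T (Suc i - 1)" using h(1) by blast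
      then show ?thesis by (simp only: diff_Suc_1)
    qed simp
  next
    fix i assume h: "\<forall>i<?n. ?T i" "i \<in> {2..?n}"
    then have "i - 1 < ?n" by auto
    then show "?T (i - 1)" using h(1) by blast
  qed
  also have "\<dots> \<longleftrightarrow> built (adjacent G) (rev xs)" by (rule built_rev_iff[symmetric])
  finally show ?thesis .
qed

lemma indep_module_composed_imp_composed:
  assumes G: "simple_graph G" and "indep_module_composed G"
  shows "composed (adjacent G) (verts G)"
proof -
  interpret sgraph "adjacent G" using G by (rule sgraph_adjacent)
  obtain \<phi> where \<phi>: "indep_module_seq G \<phi>" using assms by (auto simp: indep_module_composed_def)
  then have bij: "bij_betw \<phi> (verts G) {1..card (verts G)}" by (simp add: indep_module_seq_def)
  define xs where "xs = map (the_inv_into (verts G) \<phi>) [1..<Suc (card (verts G))]"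
  have bij': "bij_betw (the_inv_into (verts G) \<phi>) {1..card (verts G)} (verts G)"
    using bij by (rule bij_betw_the_inv_into)
  have xs: "distinct xs" "set xs = verts G"
    using bij' unfolding xs_def bij_betw_def
    by (simp_all add: distinct_map atLeastLessThanSuc_atLeastAtMost del: upt_Suc)
  have "\<phi> (xs ! i) = Suc i" if "i < length xs" for i
    using that f_the_inv_into_f_bij_betw[OF bij, of "Suc i"] by (simp add: xs_def del: upt_Suc)
  then have "built (adjacent G) (rev xs)" using indep_module_seq_iff_built[OF G xs] \<phi> by blast
  then show ?thesis using built_imp_composed[of "rev xs"] xs by simp
qed

section \<open>A linear-time check of an order\<close>

text \<open>Names of vertex sets are numbers: 0 names the empty set, and \<open>Suc v\<close> is the
  name created when \<open>v\<close> is attached. \<open>rep\<close> gives the name of a vertex's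
  own earlier neighbourhood, \<open>tag\<close> the name of the set most recently attached to that
  contains the vertex (0 if there is none), and \<open>siz\<close> maps a name to the size of its
  set.\<close>

record marks =
  tag :: "nat \<Rightarrow> nat"
  rep :: "nat \<Rightarrow> nat"
  siz :: "nat \<Rightarrow> nat"
  good :: bool

text \<open>For empty \<open>ms\<close> the defaults \<open>g = 0\<close> and
  \<open>siz m 0 = 0\<close> make \<open>r\<close> the name 0, so the empty set needs no separate
  treatment.\<close>

definition mark :: "(nat \<Rightarrow> nat list) \<Rightarrow> nat set \<Rightarrow> nat \<Rightarrow> marks \<Rightarrow> marks" where
  "mark adj S v m =
    (let ms = filter (\<lambda>w. w \<in> S) (adj v);
         g = (if ms = [] then 0 else tag m (hd ms));
         h = (if ms = [] then 0 else rep m (hd ms));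
         r = (if siz m g = length ms then g else Suc v)
     in \<lparr>tag = (\<lambda>w. if w \<in> set ms then r else tag m w), rep = (rep m)(v := r),
         siz = (siz m)(Suc v := length ms),
         good = (good m \<and> (\<forall>w\<in>set ms. tag m w = g \<and> rep m w = h))\<rparr>)"

primrec marking :: "(nat \<Rightarrow> nat list) \<Rightarrow> nat list \<Rightarrow> marks" where
  "marking adj [] = \<lparr>tag = (\<lambda>_. 0), rep = (\<lambda>_. 0), siz = (\<lambda>_. 0), good = True\<rparr>"
| "marking adj (v # xs) = mark adj (set xs) v (marking adj xs)"

text \<open>Forgets the order of the adjacency lists: \<open>g\<close> and \<open>h\<close> are the
  marks of some member of \<open>M\<close>, no matter which. Both soundness and completeness are
  argued from this alone.\<close>

definition in_step :: "(nat \<Rightarrow> nat \<Rightarrow> bool) \<Rightarrow> nat set \<Rightarrow> nat \<Rightarrow> marks \<Rightarrow> nat \<Rightarrow> nat \<Rightarrow> nat \<Rightarrow> marks \<Rightarrow> bool" where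
  "in_step E S v m g h r m' \<longleftrightarrow>
    (let M = {w \<in> S. E v w} in
      (M = {} \<longrightarrow> g = 0) \<and> (M \<noteq> {} \<longrightarrow> (\<exists>w\<in>M. g = tag m w \<and> h = rep m w)) \<and>
      r = (if siz m g = card M then g else Suc v) \<and>
      tag m' = (\<lambda>w. if w \<in> M then r else tag m w) \<and> rep m' = (rep m)(v := r) \<and>
      siz m' = (siz m)(Suc v := card M) \<and>
      (good m' \<longleftrightarrow> good m \<and> (\<forall>w\<in>M. tag m w = g \<and> rep m w = h)))"

lemma mark_in_step:
  assumes "distinct (adj v)" "set (adj v) = {w \<in> V. E v w}" "S \<subseteq> V"
  obtains g h r where "in_step E S v m g h r (mark adj S v m)"
proof -
  define ms where "ms = filter (\<lambda>w. w \<in> S) (adj v)"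
  have ms: "set ms = {w \<in> S. E v w}" "length ms = card {w \<in> S. E v w}"
  proof -
    show "set ms = {w \<in> S. E v w}" using assms by (auto simp: ms_def)
    moreover have "distinct ms" using assms by (simp add: ms_def)
    ultimately show "length ms = card {w \<in> S. E v w}" using distinct_card by metis
  qed
  have hd: "ms \<noteq> [] \<Longrightarrow> hd ms \<in> set ms" by simp
  have "in_step E S v m (if ms = [] then 0 else tag m (hd ms)) (if ms = [] then 0 else rep m (hd ms))
      (if siz m (if ms = [] then 0 else tag m (hd ms)) = length ms
       then (if ms = [] then 0 else tag m (hd ms)) else Suc v) (mark adj S v m)"
    unfolding in_step_def mark_def Let_def ms_def[symmetric] ms(1)[symmetric]
    using hd ms(2)[folded ms(1)] by auto
  then show ?thesis using that by blast
qed

primrec earlier :: "(nat \<Rightarrow> nat \<Rightarrow> bool) \<Rightarrow> nat list \<Rightarrow> nat \<Rightarrow> nat set" where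
  "earlier E [] u = {}"
| "earlier E (v # xs) u = (if u = v then {w \<in> set xs. E v w} else earlier E xs u)"

lemma back_subset: "earlier E xs u \<subseteq> {w \<in> set xs. E u w}"
  by (induction xs) auto

lemma finite_back: "finite (earlier E xs u)"
  by (rule finite_subset[OF back_subset]) simp

text \<open>Values of \<open>rep\<close> name earlier neighbourhoods: \<open>rep m u = rep m u'\<close> means equal ones, and \<open>0\<close>
  names the empty one. A nonzero \<open>tag m u\<close> names the earlier neighbourhood of the last vertex
  attached to \<open>u\<close>.\<close>

definition sound_marks :: "(nat \<Rightarrow> nat \<Rightarrow> bool) \<Rightarrow> nat list \<Rightarrow> marks \<Rightarrow> bool" where
  "sound_marks E xs m \<longleftrightarrow> siz m 0 = 0 \<and>
    (\<forall>u\<in>set xs. siz m (rep m u) = card (earlier E xs u) \<and> rep m u \<in> insert 0 (Suc ` set xs)) \<and>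
    (\<forall>u\<in>set xs. \<forall>u'\<in>set xs. rep m u = rep m u' \<longrightarrow> earlier E xs u = earlier E xs u') \<and>
    (\<forall>u. tag m u \<noteq> 0 \<longrightarrow> (\<exists>y\<in>set xs. u \<in> earlier E xs y \<and> rep m y = tag m u)) \<and>
    (\<forall>u\<in>set xs. tag m u = 0 \<longrightarrow> {w \<in> set xs. E u w} \<subseteq> earlier E xs u) \<and>
    (\<forall>u\<in>set xs. \<forall>u'\<in>set xs. rep m u = rep m u' \<longrightarrow> tag m u = tag m u' \<longrightarrow>
      {w \<in> set xs. E u w} = {w \<in> set xs. E u' w})"

text \<open>The test finds equal \<open>tag\<close> and \<open>rep\<close> on \<open>M\<close>, and
  the last clause of \<open>sound_marks\<close> turns this into equal neighbourhoods. Preserving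
  that clause rests on \<open>r\<close> being a name of exactly \<open>M\<close>.\<close>

lemma sound_step:
  assumes E: "sgraph E" and "v \<notin> set xs" and inv: "sound_marks E xs m"
    and st: "in_step E (set xs) v m g h r m'" and good: "good m'"
  shows "sound_marks E (v # xs) m' \<and>
    (\<forall>a\<in>set xs. \<forall>b\<in>set xs. E v a \<longrightarrow> E v b \<longrightarrow> (\<forall>c\<in>set xs. E a c \<longrightarrow> E b c))"
proof -
  interpret sgraph E by (rule E)
  define S where "S = set xs"
  define M where "M = {w \<in> S. E v w}"
  define B where "B = earlier E xs"
  define N where "N u = {w \<in> S. E u w}" for u
  have s0: "siz m 0 = 0"
    and s1: "\<And>u. u \<in> S \<Longrightarrow> siz m (rep m u) = card (B u)"
    and s2: "\<And>u. u \<in> S \<Longrightarrow> rep m u = 0 \<or> rep m u \<in> Suc ` S"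
    and s3: "\<And>u u'. u \<in> S \<Longrightarrow> u' \<in> S \<Longrightarrow> rep m u = rep m u' \<Longrightarrow> B u = B u'"
    and s4: "\<And>u. tag m u \<noteq> 0 \<Longrightarrow> \<exists>y\<in>S. u \<in> B y \<and> rep m y = tag m u"
    and s6: "\<And>u. u \<in> S \<Longrightarrow> tag m u = 0 \<Longrightarrow> N u \<subseteq> B u"
    and s7: "\<And>u u'. u \<in> S \<Longrightarrow> u' \<in> S \<Longrightarrow> rep m u = rep m u' \<Longrightarrow> tag m u = tag m u' \<Longrightarrow> N u = N u'"
    using inv unfolding sound_marks_def S_def[symmetric] B_def[symmetric] N_def by blast+
  have BN: "B u \<subseteq> N u" for u using back_subset[of E xs u] by (simp add: B_def N_def S_def)
  have fB: "finite (B u)" for u by (simp add: B_def finite_back)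
  have fM: "finite M" by (simp add: M_def S_def)
  have vS: "v \<notin> S" and MS: "M \<subseteq> S" using assms(2) by (auto simp: S_def M_def)
  have Mg: "M = {} \<Longrightarrow> g = 0"
    and r: "r = (if siz m g = card M then g else Suc v)"
    and tag': "tag m' = (\<lambda>w. if w \<in> M then r else tag m w)"
    and rep': "rep m' = (rep m)(v := r)"
    and siz': "siz m' = (siz m)(Suc v := card M)"
    and same: "\<And>w. w \<in> M \<Longrightarrow> tag m w = g \<and> rep m w = h"
    using st good unfolding in_step_def Let_def S_def[symmetric] M_def[symmetric] by auto
  \<comment> \<open>\<open>r\<close> is the name of the empty set, a reused name, or fresh. In the
    reuse case every member of \<open>M\<close> carries the tag \<open>g\<close> and so lies in the
    set named \<open>g\<close>; equal sizes turn this inclusion into equality.\<close>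
  have r_cases: "(M = {} \<and> r = 0) \<or> (M \<noteq> {} \<and> r \<noteq> 0 \<and> (\<exists>y\<in>S. rep m y = r \<and> B y = M))
      \<or> (M \<noteq> {} \<and> r = Suc v)"
  proof (cases "M = {}")
    case True then show ?thesis using Mg r s0 by simp
  next
    case False
    show ?thesis
    proof (cases "siz m g = card M")
      case eq: True
      have "g \<noteq> 0" using s0 eq False fM by auto
      obtain w where w: "w \<in> M" using False by blast
      obtain y where y: "y \<in> S" "w \<in> B y" "rep m y = g"
        using s4[of w] same[OF w] \<open>g \<noteq> 0\<close> by auto
      have "M \<subseteq> B y"
      proof
        fix w' assume w': "w' \<in> M"
        obtain y' where "y' \<in> S" "w' \<in> B y'" "rep m y' = g"
          using s4[of w'] same[OF w'] \<open>g \<noteq> 0\<close> by auto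
        then show "w' \<in> B y" using s3[of y y'] y by simp
      qed
      moreover have "card (B y) = card M" using s1[OF y(1)] y(3) eq by simp
      ultimately have "M = B y" by (intro card_subset_eq fB) auto
      then show ?thesis using y False \<open>g \<noteq> 0\<close> r eq by auto
    next
      case False then show ?thesis using \<open>M \<noteq> {}\<close> r by simp
    qed
  qed
  have fresh: "rep m u \<noteq> Suc v" if "u \<in> S" for u
    using s2[OF that] vS by auto
  have rM: "r = 0 \<longleftrightarrow> M = {}" using r_cases by auto
  have repM: "B u = M" if "u \<in> S" "rep m u = r" for u
  proof -
    consider "M = {}" "r = 0" | y where "y \<in> S" "rep m y = r" "B y = M" | "r = Suc v"
      using r_cases by blast
    then show ?thesis
    proof cases
      case 1
      then have "card (B u) = 0" using s1[OF that(1)] that(2) s0 by simp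
      then show ?thesis using fB 1 by simp
    next
      case 2
      then show ?thesis using s3[of u y] that by simp
    next
      case 3
      then show ?thesis using fresh that by simp
    qed
  qed
  \<comment> \<open>A vertex that already carries the name \<open>r\<close> belongs to the set it
    names, which is \<open>M\<close>. Hence retagging \<open>M\<close> with \<open>r\<close> merges
    no class inside \<open>M\<close> with one outside.\<close>
  have tagM: "u \<in> M" if "u \<in> S" "tag m u = r" "r \<noteq> 0" for u
    using s4[of u] that repM by auto
  have tagv: "tag m v = 0" "v \<notin> M"
    using s4[of v] BN vS MS by (auto simp: N_def)
  define B2 where "B2 = earlier E (v # xs)"
  define N2 where "N2 u = {w \<in> insert v S. E u w}" for u
  have B': "B2 u = (if u = v then M else B u)" for u
    by (simp add: B2_def M_def S_def B_def)
  have N': "N2 u = (if u = v then M else if u \<in> M then insert v (N u) else N u)"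
    if "u \<in> insert v S" for u
    using that irrefl vS by (auto simp: N2_def M_def N_def commute)
  have S': "set (v # xs) = insert v S" by (simp add: S_def)
  have sizr: "siz m' r = card M"
    using r siz' by auto
  have n1: "siz m' (rep m' u) = card (B2 u)" if "u \<in> insert v S" for u
  proof (cases "u = v")
    case True then show ?thesis using B' sizr rep' by simp
  next
    case False
    then have "u \<in> S" using that by simp
    then show ?thesis using False B' s1 siz' rep' fresh by simp
  qed
  have n2: "rep m' u \<in> insert 0 (Suc ` insert v S)" if "u \<in> insert v S" for u
  proof (cases "u = v")
    case True
    consider "r = 0" | y where "y \<in> S" "rep m y = r" | "r = Suc v" using r_cases by blast
    then have "r \<in> insert 0 (Suc ` insert v S)"
    proof cases
      case (2 y)
      then show ?thesis using s2[of y] by auto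
    qed simp_all
    then show ?thesis using True rep' by simp
  next
    case False
    then have "u \<in> S" "rep m' u = rep m u" using that rep' by simp_all
    then show ?thesis using s2[of u] by auto
  qed
  have n3: "B2 u = B2 u'"
    if "u \<in> insert v S" "u' \<in> insert v S" "rep m' u = rep m' u'" for u u'
    using that B' rep' repM[of u] repM[of u'] s3[of u u'] by (cases "u = v"; cases "u' = v") simp_all
  have n4: "\<exists>y\<in>insert v S. u \<in> B2 y \<and> rep m' y = tag m' u" if nz: "tag m' u \<noteq> 0" for u
  proof (cases "u \<in> M")
    case True then show ?thesis using B' rep' tag' by auto
  next
    case False
    then have t: "tag m' u = tag m u" using tag' by simp
    then obtain y where y: "y \<in> S" "u \<in> B y" "rep m y = tag m u" using s4[of u] nz by auto
    then have "y \<noteq> v" using vS by blast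
    then show ?thesis using y B' rep' t by (intro bexI[of _ y]) simp_all
  qed
  have n6: "N2 u \<subseteq> B2 u" if "u \<in> insert v S" "tag m' u = 0" for u
    using that N'[OF that(1)] B' tag' rM s6[of u] by (auto split: if_splits)
  \<comment> \<open>Nothing has been attached to a vertex with tag 0, so its neighbourhood is still
    its earlier one. This compares the new vertex \<open>v\<close> with the older vertices that
    share its \<open>rep\<close>.\<close>
  have mixed: "N u = M" "u \<notin> M" if "u \<in> S" "rep m u = r" "tag m' u = 0" for u
  proof -
    show u: "u \<notin> M" using that(3) tag' rM by auto
    have "B u = M" using repM that by simp
    then show "N u = M" using that u tag' s6[of u] BN[of u] by auto
  qed
  have n7: "N2 u = N2 u'"
    if U: "u \<in> insert v S" "u' \<in> insert v S" and eq: "rep m' u = rep m' u'" "tag m' u = tag m' u'" for u u'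
  proof -
    have tv: "tag m' v = 0" using tag' tagv by simp
    consider "u = v" "u' = v" | "u = v" "u' \<noteq> v" | "u \<noteq> v" "u' = v" | "u \<noteq> v" "u' \<noteq> v" by blast
    then show ?thesis
    proof cases
      case 2
      then show ?thesis
        using N'[OF U(1)] N'[OF U(2)] mixed[of u'] U eq tv rep' by simp
    next
      case 3
      then show ?thesis
        using N'[OF U(1)] N'[OF U(2)] mixed[of u] U eq tv rep' by simp
    next
      case 4
      then have uS: "u \<in> S" "u' \<in> S" and re: "rep m u = rep m u'" using U eq rep' by auto
      have iff: "u \<in> M \<longleftrightarrow> u' \<in> M"
        using tagM[of u] tagM[of u'] eq(2) tag' uS rM by (auto split: if_splits)
      have "tag m u = tag m u'"
        using iff same[of u] same[of u'] eq(2) tag' by (cases "u \<in> M") auto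
      then have "N u = N u'" using s7 uS re by blast
      then show ?thesis using N'[OF U(1)] N'[OF U(2)] 4 iff by simp
    qed simp
  qed
  have "sound_marks E (v # xs) m'"
    unfolding sound_marks_def S' B2_def[symmetric] N2_def[symmetric]
  proof (intro conjI ballI allI impI)
    show "siz m' 0 = 0" using siz' s0 by simp
  qed ((rule n1 n2 n3 n4 n6 n7; assumption)+)
  moreover have "E b c" if "a \<in> S" "b \<in> S" "E v a" "E v b" "c \<in> S" "E a c" for a b c
  proof -
    have "a \<in> M" "b \<in> M" using that by (auto simp: M_def)
    then have "N a = N b" using s7[OF that(1,2)] same by simp
    then show ?thesis using that by (auto simp: N_def)
  qed
  ultimately show ?thesis unfolding S_def by blast
qed

lemma good_marking_imp_built:
  assumes "sgraph F" "distinct xs" "set xs \<subseteq> V"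
    and "\<And>v. v \<in> V \<Longrightarrow> distinct (adj v) \<and> set (adj v) = {w \<in> V. F v w}"
    and "good (marking adj xs)"
  shows "built F xs \<and> sound_marks F xs (marking adj xs)"
  using assms(2,3,5)
proof (induction xs)
  case Nil
  show ?case by (simp add: sound_marks_def)
next
  case (Cons v xs)
  obtain g h r where st: "in_step F (set xs) v (marking adj xs) g h r (mark adj (set xs) v (marking adj xs))"
    by (rule mark_in_step[of adj v V F "set xs"]) (use assms(4)[of v] Cons.prems in auto)
  have "good (marking adj xs)" using st Cons.prems(3) by (simp add: in_step_def Let_def)
  then have IH: "built F xs" "sound_marks F xs (marking adj xs)" using Cons by auto
  show ?case
    using sound_step[OF assms(1) _ IH(2) st Cons.prems(3)[unfolded marking.simps]] Cons.prems(1) IH(1)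
    unfolding built.simps marking.simps distinct.simps by blast
qed


section \<open>Completeness of the check on orders sorted by level\<close>

context levelled
begin

text \<open>Among the vertices of one level the earlier neighbourhoods are added in decreasing order, so the
  vertices that were last attached to a given one all have the smallest neighbourhood so far.\<close>

definition last_layer :: "'a set \<Rightarrow> 'a \<Rightarrow> bool" where
  "last_layer S u \<longleftrightarrow> (\<forall>y\<in>S. L y \<le> L u \<and> (L y = L u \<longrightarrow> card (lower u) \<le> card (lower y)))"

end

text \<open>Converse in spirit to \<open>sound_marks\<close>: equal sets force equal marks, with
  \<open>lower\<close> as the earlier neighbourhood. Comparing tags within one level is enough,
  since the earlier neighbours of a vertex share a level. The \<open>last_layer\<close> clause makes
  name reuse succeed, and the range clauses keep \<open>Suc v\<close> fresh.\<close>

definition complete_marks ::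
    "(nat \<Rightarrow> nat \<Rightarrow> bool) \<Rightarrow> nat set \<Rightarrow> (nat \<Rightarrow> nat) \<Rightarrow> nat set \<Rightarrow> marks \<Rightarrow> bool" where
  "complete_marks E V L S m \<longleftrightarrow> good m \<and> siz m 0 = 0 \<and>
    (\<forall>u\<in>S. \<forall>u'\<in>S. levelled.lower E V L u = levelled.lower E V L u' \<longrightarrow> rep m u = rep m u') \<and>
    (\<forall>u\<in>S. \<forall>u'\<in>S. L u = L u' \<longrightarrow> {w \<in> S. E u w} = {w \<in> S. E u' w} \<longrightarrow> tag m u = tag m u') \<and>
    (\<forall>u. tag m u \<noteq> 0 \<longrightarrow> (\<exists>x\<in>S. E u x \<and> L u < L x)) \<and>
    (\<forall>u\<in>S. levelled.last_layer E V L S u \<longrightarrow> (\<forall>w\<in>levelled.lower E V L u. tag m w = rep m u)) \<and>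
    (\<forall>u\<in>S. siz m (rep m u) = card (levelled.lower E V L u)) \<and>
    (\<forall>u\<in>S. rep m u \<in> insert 0 (Suc ` S)) \<and>
    (\<forall>u. tag m u \<in> insert 0 (Suc ` S)) \<and>
    (\<forall>u\<in>S. levelled.lower E V L u = {} \<longrightarrow> rep m u = 0)"

text \<open>The members of \<open>M\<close> lie on one level and have equal \<open>lower\<close>
  sets and equal neighbourhoods so far, so their marks agree and the test passes. The work is to
  show that equal \<open>lower\<close> sets still receive equal names.\<close>

lemma complete_step:
  assumes lev: "levelled E V L rt"
    and zs: "set zs = V" "zs = ys @ v # xs" "sorted_wrt (levelled.newer E V L) zs" "distinct zs"
    and inv: "complete_marks E V L (set xs) m"
    and st: "in_step E (set xs) v m g h r m'"
  shows "complete_marks E V L (set (v # xs)) m'"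
proof -
  interpret levelled E V L rt by (rule lev)
  define S where "S = set xs"
  define M where "M = {w \<in> S. E v w}"
  define N where "N u = {w \<in> S. E u w}" for u
  have c0: "good m" "siz m 0 = 0"
    and c1: "\<And>u u'. u \<in> S \<Longrightarrow> u' \<in> S \<Longrightarrow> lower u = lower u' \<Longrightarrow> rep m u = rep m u'"
    and c2: "\<And>u u'. u \<in> S \<Longrightarrow> u' \<in> S \<Longrightarrow> L u = L u' \<Longrightarrow> N u = N u' \<Longrightarrow> tag m u = tag m u'"
    and c3: "\<And>u. tag m u \<noteq> 0 \<Longrightarrow> \<exists>x\<in>S. E u x \<and> L u < L x"
    and c4: "\<And>u w. u \<in> S \<Longrightarrow> last_layer S u \<Longrightarrow> w \<in> lower u \<Longrightarrow> tag m w = rep m u"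
    and c5: "\<And>u. u \<in> S \<Longrightarrow> siz m (rep m u) = card (lower u)"
    and c6: "\<And>u. u \<in> S \<Longrightarrow> rep m u = 0 \<or> rep m u \<in> Suc ` S"
    and c8: "\<And>u. tag m u = 0 \<or> tag m u \<in> Suc ` S"
    and c7: "\<And>u. u \<in> S \<Longrightarrow> lower u = {} \<Longrightarrow> rep m u = 0"
    using inv unfolding complete_marks_def S_def[symmetric] N_def by blast+
  have vV: "v \<in> V" and SV: "S \<subseteq> V" and vS: "v \<notin> S" and fM: "finite M"
    using zs by (auto simp: S_def M_def)
  have newer: "newer v u" if "u \<in> S" for u using zs that by (auto simp: S_def sorted_wrt_append)
  then have Lle: "L u \<le> L v" if "u \<in> S" for u using that by (force simp: newer_def)
  have Ml: "M = lower v" using back_eq_lower[OF zs(1-3)] by (simp add: M_def S_def)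
  have LM: "L v = Suc (L a)" if "a \<in> M" for a
    using L_adjacent[OF vV, of a] that Ml by (auto simp: lower_def)
  have tw: "E b c" if "a \<in> M" "b \<in> M" "c \<in> S" "E a c" for a b c
    using sorted_imp_built[OF zs(1-3)] that unfolding built.simps M_def S_def by blast
  have NM: "N a = N b" if "a \<in> M" "b \<in> M" for a b
    using tw[OF that] tw[OF that(2,1)] by (auto simp: N_def)
  have lM: "lower a = lower b" if "a \<in> M" "b \<in> M" for a b
    using lower_of_lower[OF vV] that Ml by blast
  have Mg: "M = {} \<Longrightarrow> g = 0" and Mw: "M \<noteq> {} \<Longrightarrow> \<exists>w\<in>M. g = tag m w \<and> h = rep m w"
    and r: "r = (if siz m g = card M then g else Suc v)"
    and tag': "tag m' = (\<lambda>w. if w \<in> M then r else tag m w)"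
    and rep': "rep m' = (rep m)(v := r)"
    and siz': "siz m' = (siz m)(Suc v := card M)"
    and good': "good m' \<longleftrightarrow> good m \<and> (\<forall>w\<in>M. tag m w = g \<and> rep m w = h)"
    using st unfolding in_step_def Let_def S_def[symmetric] M_def[symmetric] by auto
  have same: "tag m w = g \<and> rep m w = h" if w: "w \<in> M" for w
  proof -
    obtain w0 where w0: "w0 \<in> M" "g = tag m w0" "h = rep m w0" using Mw w by blast
    have "w \<in> S" "w0 \<in> S" "L w = L w0" using w w0 LM[OF w] LM[OF w0(1)] by (auto simp: M_def)
    then show ?thesis using c1[of w w0] c2[of w w0] NM[OF w w0(1)] lM[OF w w0(1)] w0 by simp
  qed
  have tagv: "tag m v = 0" "v \<notin> M"
  proof -
    show "tag m v = 0" using c3[of v] Lle by force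
    show "v \<notin> M" using vS by (simp add: M_def)
  qed
  have fresh: "rep m u \<noteq> Suc v" if "u \<in> S" for u
    using c6[OF that] vS by auto
  have r0: "r = 0" if "M = {}" using that Mg r c0 by simp
  \<comment> \<open>Here the order by size enters: \<open>u\<close> has the smallest
    \<open>lower\<close> set of the deepest level so far, hence lies in the last layer, and its name
    is the tag found on \<open>M\<close>.\<close>
  have key: "r = rep m u" if u: "u \<in> S" "lower u = M" for u
  proof (cases "M = {}")
    case True then show ?thesis using r0 c7 u by simp
  next
    case False
    then obtain w where w: "w \<in> M" by blast
    then have "L u = L v"
      using LM[OF w] L_adjacent[of u w] u SV by (auto simp: lower_def)
    moreover have "card (lower u) \<le> card (lower y)" if "y \<in> S" "L y = L v" for y
      using newer[OF that(1)] that(2) u(2) Ml by (simp add: newer_def)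
    ultimately have "last_layer S u" using Lle by (simp add: last_layer_def)
    then have "g = rep m u" using c4[OF u(1) _, of w] same[OF w] w u(2) by simp
    then show ?thesis using r c5[OF u(1)] u(2) by simp
  qed
  define N2 where "N2 u = {w \<in> insert v S. E u w}" for u
  have N2: "N2 u = (if u \<in> M then insert v (N u) else N u)" if "u \<in> S" for u
    using that commute by (auto simp: N2_def M_def N_def)
  have S': "set (v # xs) = insert v S" by (simp add: S_def)
  have n1: "rep m' u = rep m' u'" if "u \<in> insert v S" "u' \<in> insert v S" "lower u = lower u'" for u u'
    using that rep' key[of u] key[of u'] c1[of u u'] Ml by (cases "u = v"; cases "u' = v") simp_all
  have low0: "tag m' u = 0" if "u \<in> insert v S" "L u = L v" for u
  proof -
    have "u \<notin> M" using LM[of u] that by auto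
    moreover have "tag m u = 0" using c3[of u] Lle that by force
    ultimately show ?thesis using tag' by simp
  qed
  have n2: "tag m' u = tag m' u'"
    if U: "u \<in> insert v S" "u' \<in> insert v S" "L u = L u'" "N2 u = N2 u'" for u u'
  proof (cases "u = v \<or> u' = v")
    case True
    then show ?thesis using low0[of u] low0[of u'] U by auto
  next
    case False
    then have uS: "u \<in> S" "u' \<in> S" using U by auto
    have vN: "v \<notin> N u" "v \<notin> N u'" using vS by (auto simp: N_def)
    have "u \<in> M \<longleftrightarrow> u' \<in> M" "N u = N u'"
      using U(4) N2[OF uS(1)] N2[OF uS(2)] vN by (auto split: if_splits)
    then show ?thesis using c2[OF uS U(3)] tag' by simp
  qed
  have n3: "\<exists>x\<in>insert v S. E u x \<and> L u < L x" if "tag m' u \<noteq> 0" for u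
  proof (cases "u \<in> M")
    case True
    then have "E u v \<and> L u < L v" using LM[of u] sym by (auto simp: M_def)
    then show ?thesis by blast
  next
    case False
    then show ?thesis using c3[of u] that tag' by auto
  qed
  have n4: "tag m' w = rep m' u"
    if U: "u \<in> insert v S" "last_layer (insert v S) u" "w \<in> lower u" for u w
  proof (cases "u = v")
    case True
    then show ?thesis using U(3) tag' rep' Ml by simp
  next
    case False
    then have uS: "u \<in> S" using U by simp
    have "last_layer S u" using U(2) by (simp add: last_layer_def)
    then have old: "tag m w = rep m u" using c4 uS U(3) by blast
    show ?thesis
    proof (cases "w \<in> M")
      case True
      have Lu: "L u = L v" "card (lower u) \<le> card M"
        using U(2) Lle[OF uS] Ml by (auto simp: last_layer_def)
      \<comment> \<open>\<open>w\<close> is adjacent to \<open>u\<close> and the members of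
        \<open>M\<close> are twins, so all of \<open>M\<close> is adjacent to \<open>u\<close>. As
        \<open>lower u\<close> is no larger than \<open>M\<close>, the sets coincide and
        \<open>v\<close> reused the name of \<open>u\<close>.\<close>
      have "M \<subseteq> lower u"
      proof
        fix b assume b: "b \<in> M"
        have "E w u" using U(3) sym by (simp add: lower_def)
        then have "E u b" using tw[OF True b uS] sym by blast
        then show "b \<in> lower u" using b LM[OF b] Lu SV by (auto simp: lower_def M_def)
      qed
      then have "M = lower u" using Lu(2) finite_lower by (simp add: card_seteq)
      then show ?thesis using key[OF uS] True False tag' rep' by simp
    next
      case nM: False
      then show ?thesis using old tag' rep' False by simp
    qed
  qed
  have n5: "siz m' (rep m' u) = card (lower u)" if "u \<in> insert v S" for u
  proof (cases "u = v")
    case True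
    then show ?thesis using siz' rep' r Ml by auto
  next
    case False
    then show ?thesis using that siz' rep' c5 fresh by simp
  qed
  have gS: "g = 0 \<or> g \<in> Suc ` S"
  proof (cases "M = {}")
    case False
    then obtain w where "g = tag m w" using Mw by blast
    then show ?thesis using c8[of w] by simp
  qed (use Mg in simp)
  have n6: "rep m' u \<in> insert 0 (Suc ` insert v S)" if "u \<in> insert v S" for u
  proof (cases "u = v")
    case True
    then show ?thesis using gS r rep' by auto
  next
    case False
    then have "u \<in> S" "rep m' u = rep m u" using that rep' by simp_all
    then show ?thesis using c6[of u] by auto
  qed
  have n8: "tag m' u \<in> insert 0 (Suc ` insert v S)" for u
    using gS r tag' c8[of u] by auto
  have n7: "rep m' u = 0" if "u \<in> insert v S" "lower u = {}" for u
    using that c7 r0 rep' Ml by (cases "u = v") simp_all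
  have n0: "good m'" using good' c0 same by blast
  have n00: "siz m' 0 = 0" using siz' c0 by simp
  show ?thesis
    unfolding complete_marks_def S' N2_def[symmetric]
    by (intro conjI ballI allI impI; (rule n0 n00 n1 n2 n3 n4 n5 n6 n7 n8; assumption?))
qed

lemma sorted_imp_good_marking:
  assumes lev: "levelled E V L rt"
    and zs: "set zs = V" "sorted_wrt (levelled.newer E V L) zs" "distinct zs"
    and adj: "\<And>v. v \<in> V \<Longrightarrow> distinct (adj v) \<and> set (adj v) = {w \<in> V. E v w}"
  shows "good (marking adj zs)"
proof -
  have "complete_marks E V L (set xs) (marking adj xs)" if "zs = ys @ xs" for ys xs
    using that
  proof (induction xs arbitrary: ys)
    case Nil
    show ?case by (simp add: complete_marks_def)
  next
    case (Cons v xs)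
    have IH: "complete_marks E V L (set xs) (marking adj xs)" using Cons.IH[of "ys @ [v]"] Cons.prems by simp
    obtain g h r where "in_step E (set xs) v (marking adj xs) g h r (mark adj (set xs) v (marking adj xs))"
      by (rule mark_in_step[of adj v V E "set xs"]) (use adj[of v] Cons.prems zs(1) in auto)
    then show ?case using complete_step[OF lev zs(1) Cons.prems zs(2,3) IH] by simp
  qed
  from this[of "[]" zs] show ?thesis by (simp add: complete_marks_def)
qed

section \<open>Breadth-first search and bucket sort on lists\<close>

text \<open>Level 0 means undiscovered. The queue is sorted, stays within one component and spans at
  most two consecutive levels. Processed vertices are compared with the queue only under equal
  roots, because a finished component may be deeper. Bounding levels by the number of discovered
  vertices later makes them fit into a word.\<close>

definition bfs_state :: "'a graph \<Rightarrow> 'a list \<Rightarrow> 'a list \<Rightarrow> ('a \<Rightarrow> nat) \<Rightarrow> ('a \<Rightarrow> 'a) \<Rightarrow> bool" where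
  "bfs_state G ds q L rt \<longleftrightarrow> bfs_run G ds q \<and> distinct (ds @ q) \<and> set (ds @ q) \<subseteq> verts G \<and>
    (\<forall>v. L v = 0 \<longleftrightarrow> v \<notin> set (ds @ q)) \<and> (\<forall>v. L v \<le> length (ds @ q)) \<and>
    (\<forall>v\<in>set (ds @ q). rt v \<in> set (ds @ q)) \<and>
    (\<forall>u\<in>set ds. \<forall>w\<in>nbhd G u. w \<in> set (ds @ q) \<and> rt u = rt w \<and> L w \<le> Suc (L u)) \<and>
    (\<forall>v\<in>set (ds @ q). (L v = 1 \<and> rt v = v) \<or> (\<exists>p\<in>nbhd G v. L v = Suc (L p) \<and> p \<in> set ds)) \<and>
    (\<forall>u\<in>set ds. \<forall>w\<in>set q. rt u = rt w \<longrightarrow> L u \<le> L w) \<and>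
    sorted (map L q) \<and> (\<forall>a\<in>set q. \<forall>b\<in>set q. L b \<le> Suc (L a) \<and> rt a = rt b)"

lemma bfs_state_start: "bfs_state G [] [] (\<lambda>_. 0) rt"
  by (simp add: bfs_state_def bfs_run.start)

lemma bfs_state_root:
  assumes "bfs_state G ds [] L rt" "v \<in> verts G - set ds"
  shows "bfs_state G ds [v] (L(v := 1)) (rt(v := v))"
proof -
  note s = assms(1)[unfolded bfs_state_def append_Nil2]
  have v: "v \<in> verts G" "v \<notin> set ds" using assms(2) by auto
  have "bfs_run G ds [v]" using s assms(2) by (intro bfs_run.root) auto
  moreover have "(L(v := 1)) w \<le> length (ds @ [v])" for w
    using s by (auto intro: le_SucI)
  moreover have "(rt(v := v)) w \<in> set (ds @ [v])" if "w \<in> set (ds @ [v])" for w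
    using s that by auto
  moreover have "w \<in> set (ds @ [v]) \<and> (rt(v := v)) u = (rt(v := v)) w \<and> (L(v := 1)) w \<le> Suc ((L(v := 1)) u)"
    if "u \<in> set ds" "w \<in> nbhd G u" for u w
  proof -
    have "w \<in> set ds \<and> rt u = rt w \<and> L w \<le> Suc (L u)" using s that by blast
    moreover have "u \<noteq> v" "w \<noteq> v" using v that calculation by blast+
    ultimately show ?thesis by simp
  qed
  moreover have "((L(v := 1)) w = 1 \<and> (rt(v := v)) w = w) \<or>
      (\<exists>p\<in>nbhd G w. (L(v := 1)) w = Suc ((L(v := 1)) p) \<and> p \<in> set ds)"
    if "w \<in> set (ds @ [v])" for w
  proof (cases "w = v")
    case False
    then have "w \<in> set ds" using that by simp
    then consider "L w = 1 \<and> rt w = w" | p where "p \<in> nbhd G w" "L w = Suc (L p)" "p \<in> set ds"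
      using s by blast
    then show ?thesis
    proof cases
      case (2 p)
      then have "p \<noteq> v" using v by blast
      then show ?thesis using 2 False by (intro disjI2 bexI[of _ p]) simp_all
    qed (use False in simp)
  qed simp
  moreover have "(rt(v := v)) u = (rt(v := v)) w \<longrightarrow> (L(v := 1)) u \<le> (L(v := 1)) w"
    if "u \<in> set ds" "w \<in> set [v]" for u w
  proof -
    have "rt u \<in> set ds" using s that by blast
    then show ?thesis using v that by auto
  qed
  ultimately show ?thesis unfolding bfs_state_def using s v by simp
qed

lemma bfs_state_visit:
  assumes G: "simple_graph G" and st: "bfs_state G ds (u # q) L rt"
    and ws: "distinct ws" "set ws = nbhd G u - (set ds \<union> set (u # q))"
  shows "bfs_state G (ds @ [u]) (q @ ws) (\<lambda>w. if w \<in> set ws then Suc (L u) else L w)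
    (\<lambda>w. if w \<in> set ws then rt u else rt w)"
proof -
  define D where "D = set (ds @ u # q)"
  define L' where "L' w = (if w \<in> set ws then Suc (L u) else L w)" for w
  define rt' where "rt' w = (if w \<in> set ws then rt u else rt w)" for w
  note s = st[unfolded bfs_state_def, folded D_def]
  have D: "set ds \<subseteq> D" "u \<in> D" "set q \<subseteq> D" by (auto simp: D_def)
  have disj: "w \<notin> set ws" if "w \<in> D" for w using ws(2) that by (auto simp: D_def)
  have old: "L' w = L w" "rt' w = rt w" if "w \<in> D" for w
    using disj[OF that] by (simp_all add: L'_def rt'_def)
  have new: "L' w = Suc (L u)" "rt' w = rt u" if "w \<in> set ws" for w
    using that by (simp_all add: L'_def rt'_def)
  have D': "set ((ds @ [u]) @ (q @ ws)) = D \<union> set ws" by (auto simp: D_def)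
  have wsG: "set ws \<subseteq> verts G" using ws(2) by (auto simp: nbhd_def)
  have run0: "bfs_run G ds (u # q)" and dist0: "distinct (ds @ u # q)" and DG: "D \<subseteq> verts G"
    and zero0: "\<forall>v. L v = 0 \<longleftrightarrow> v \<notin> D" and len0: "\<forall>v. L v \<le> length (ds @ u # q)"
    and rt0: "\<forall>v\<in>D. rt v \<in> D"
    and closed0: "\<forall>u\<in>set ds. \<forall>w\<in>nbhd G u. w \<in> D \<and> rt u = rt w \<and> L w \<le> Suc (L u)"
    and par0: "\<forall>v\<in>D. (L v = 1 \<and> rt v = v) \<or> (\<exists>p\<in>nbhd G v. L v = Suc (L p) \<and> p \<in> set ds)"
    and cross0: "\<forall>d\<in>set ds. \<forall>w\<in>set (u # q). rt d = rt w \<longrightarrow> L d \<le> L w"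
    and srt0: "sorted (map L (u # q))"
    and pair0: "\<forall>a\<in>set (u # q). \<forall>b\<in>set (u # q). L b \<le> Suc (L a) \<and> rt a = rt b"
    using s by - (elim conjE, assumption)+
  have Lq: "L u \<le> L w" "L w \<le> Suc (L u)" "rt w = rt u" if "w \<in> set (u # q)" for w
  proof -
    show "L u \<le> L w" using srt0 that by auto
    have "u \<in> set (u # q)" by simp
    then show "L w \<le> Suc (L u)" "rt w = rt u" using pair0 that by metis+
  qed
  have cross: "L d \<le> L w" if "d \<in> set ds" "w \<in> set (u # q)" "rt d = rt w" for d w
    using cross0 that by blast
  have closed: "w \<in> D" "rt d = rt w" "L w \<le> Suc (L d)" if "d \<in> set ds" "w \<in> nbhd G d" for d w
    using closed0 that by blast+
  have run: "bfs_run G (ds @ [u]) (q @ ws)"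
    by (rule bfs_run.visit[OF run0 ws])
  have dist: "distinct ((ds @ [u]) @ (q @ ws))"
    using dist0 ws disj by (auto simp: D_def)
  have sub: "D \<union> set ws \<subseteq> verts G" using DG wsG by blast
  have zero: "L' w = 0 \<longleftrightarrow> w \<notin> D \<union> set ws" for w
    using zero0 by (simp add: L'_def)
  \<comment> \<open>The additional level is paid for by the new vertex itself, which makes
    \<open>ws\<close> nonempty.\<close>
  have len: "L' w \<le> length ((ds @ [u]) @ (q @ ws))" for w
  proof (cases "w \<in> set ws")
    case True
    then have "length ws \<noteq> 0" by auto
    moreover have "L u \<le> length (ds @ u # q)" using len0 by blast
    moreover have "length ((ds @ [u]) @ (q @ ws)) = length (ds @ u # q) + length ws" by simp
    ultimately show ?thesis using new(1)[OF True] by linarith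
  next
    case False
    have "L w \<le> length (ds @ u # q)" using len0 by blast
    then show ?thesis using False by (simp add: L'_def)
  qed
  have rtD: "rt' w \<in> D \<union> set ws" if "w \<in> D \<union> set ws" for w
    using rt0 D that by (auto simp: rt'_def)
  have closed': "w \<in> D \<union> set ws \<and> rt' d = rt' w \<and> L' w \<le> Suc (L' d)"
    if d: "d \<in> set (ds @ [u])" "w \<in> nbhd G d" for d w
  proof (cases "d = u")
    case False
    then have "d \<in> set ds" using d by simp
    then show ?thesis using closed[OF _ d(2)] old[of d] old[of w] D by auto
  next
    case True
    consider "w \<in> set ws" | "w \<in> set (u # q)" | "w \<in> set ds" using d(2) True ws(2) by blast
    then show ?thesis
    proof cases
      case 1 then show ?thesis using True new[OF 1] old[OF D(2)] by simp
    next
      case 2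
      then have "w \<in> D" by (auto simp: D_def)
      then show ?thesis using 2 True Lq[OF 2] old[of w] old[OF D(2)] by simp
    next
      case 3
      have "w \<in> D" using D 3 by blast
      \<comment> \<open>The neighbour \<open>w\<close> of \<open>u\<close> is already processed.
        Reading the edge from \<open>w\<close> shows that both have the same root, and then
        \<open>w\<close> is no deeper than the queued vertex \<open>u\<close>.\<close>
      have uw: "u \<in> nbhd G w"
        using d(2) True DG D(2) by (auto simp: nbhd_def insert_commute)
      have "rt w = rt u" using closed[OF 3 uw] by simp
      then have "L w \<le> L u" using cross[OF 3, of u] by simp
      then show ?thesis using True \<open>rt w = rt u\<close> old[OF \<open>w \<in> D\<close>] old[OF D(2)] \<open>w \<in> D\<close> by simp
    qed
  qed
  have par: "(L' w = 1 \<and> rt' w = w) \<or> (\<exists>p\<in>nbhd G w. L' w = Suc (L' p) \<and> p \<in> set (ds @ [u]))"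
    if "w \<in> D \<union> set ws" for w
  proof (cases "w \<in> set ws")
    case True
    then have "u \<in> nbhd G w" using ws(2) sub D by (auto simp: nbhd_def insert_commute)
    then show ?thesis using new[OF True] old[OF D(2)] by (intro disjI2 bexI[of _ u]) simp_all
  next
    case False
    then have "w \<in> D" using that by blast
    then consider "L w = 1 \<and> rt w = w" | p where "p \<in> nbhd G w" "L w = Suc (L p)" "p \<in> set ds"
      using par0 by blast
    then show ?thesis
    proof cases
      case 1 then show ?thesis using old[OF \<open>w \<in> D\<close>] by simp
    next
      case (2 p)
      then have "p \<in> D" using D by blast
      then show ?thesis using 2 old[OF \<open>w \<in> D\<close>] old[of p] by (intro disjI2 bexI[of _ p]) simp_all
    qed
  qed
  have qws: "L u \<le> L' w" "L' w \<le> Suc (L u)" "rt' w = rt u" if "w \<in> set (q @ ws)" for w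
  proof -
    have "(L u \<le> L' w) \<and> (L' w \<le> Suc (L u)) \<and> rt' w = rt u"
    proof (cases "w \<in> set ws")
      case True then show ?thesis using new by simp
    next
      case False
      then have "w \<in> set (u # q)" "w \<in> D" using that D by auto
      then show ?thesis using Lq old by metis
    qed
    then show "L u \<le> L' w" "L' w \<le> Suc (L u)" "rt' w = rt u" by blast+
  qed
  have cross': "rt' d = rt' w \<longrightarrow> L' d \<le> L' w" if "d \<in> set (ds @ [u])" "w \<in> set (q @ ws)" for d w
  proof (intro impI)
    assume eq: "rt' d = rt' w"
    have dD: "d \<in> D" using that(1) D by auto
    show "L' d \<le> L' w"
    proof (cases "d = u")
      case True then show ?thesis using qws(1)[OF that(2)] old[OF dD] by simp
    next
      case False
      then have "d \<in> set ds" using that by simp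
      moreover have "rt d = rt u" using eq qws(3)[OF that(2)] old[OF dD] by simp
      ultimately have "L d \<le> L u" using cross[of d u] by simp
      then show ?thesis using qws(1)[OF that(2)] old[OF dD] by simp
    qed
  qed
  have srt: "sorted (map L' (q @ ws))"
  proof -
    have "map L' q = map L q" using old D by (intro map_cong) auto
    moreover have "map L' ws = replicate (length ws) (Suc (L u))"
      using new by (intro nth_equalityI) auto
    ultimately have eq: "map L' (q @ ws) = map L q @ replicate (length ws) (Suc (L u))" by (simp only: map_append)
    show ?thesis unfolding eq using srt0 Lq by (auto simp: sorted_append)
  qed
  have pair: "L' b \<le> Suc (L' a) \<and> rt' a = rt' b" if "a \<in> set (q @ ws)" "b \<in> set (q @ ws)" for a b
    using qws[OF that(1)] qws[OF that(2)] by simp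
  have "bfs_state G (ds @ [u]) (q @ ws) L' rt'"
    unfolding bfs_state_def D'
    by (intro conjI ballI allI; (rule run dist sub zero len rtD cross' srt closed' [THEN conjunct1]
          closed'[THEN conjunct2, THEN conjunct1] closed'[THEN conjunct2, THEN conjunct2] par
          pair[THEN conjunct1] pair[THEN conjunct2]; assumption?))
  then show ?thesis unfolding L'_def[abs_def] rt'_def[abs_def] .
qed

lemma bfs_state_levelled:
  assumes G: "simple_graph G" and comp: "composed (adjacent G) (verts G)"
    and st: "bfs_state G ds [] L rt" "set ds = verts G"
  shows "levelled (adjacent G) (verts G) L rt"
proof -
  interpret sgraph "adjacent G" using G by (rule sgraph_adjacent)
  note s = st(1)[unfolded bfs_state_def append_Nil2 st(2)]
  show ?thesis
  proof
    show "finite (verts G)" using G by (simp add: simple_graph_def)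
    show "composed (adjacent G) (verts G)" by (rule comp)
    show "rt u = rt w \<and> L w \<le> Suc (L u)" if "u \<in> verts G" "w \<in> verts G" "adjacent G u w" for u w
      using s that by (auto simp: nbhd_adjacent)
    show "(L v = 1 \<and> rt v = v) \<or> (\<exists>p\<in>verts G. adjacent G v p \<and> L v = Suc (L p))" if "v \<in> verts G" for v
    proof -
      have "(L v = 1 \<and> rt v = v) \<or> (\<exists>p\<in>nbhd G v. L v = Suc (L p) \<and> p \<in> verts G)" using s that by blast
      then show ?thesis unfolding nbhd_adjacent by blast
    qed
    show "1 \<le> L v" if "v \<in> verts G" for v
    proof -
      have "L v \<noteq> 0" using s that by blast
      then show ?thesis by simp
    qed
  qed
qed

text \<open>The program fills linked lists at the head, hence \<open>rev\<close>: ties leave the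
  sort in reversed order. Sorting by increasing count and then by level thus produces decreasing
  counts within a level.\<close>

definition bucket :: "('a \<Rightarrow> nat) \<Rightarrow> 'a list \<Rightarrow> nat \<Rightarrow> 'a list" where
  "bucket key xs k = rev (filter (\<lambda>v. key v = k) xs)"

definition bucket_sort :: "nat \<Rightarrow> ('a \<Rightarrow> nat) \<Rightarrow> 'a list \<Rightarrow> 'a list" where
  "bucket_sort n key xs = concat (map (bucket key xs) [0..<Suc n])"

lemma set_bucket: "set (bucket key xs k) = {v \<in> set xs. key v = k}"
  by (simp add: bucket_def)

lemma set_bucket_sort: "(\<And>v. v \<in> set xs \<Longrightarrow> key v \<le> n) \<Longrightarrow> set (bucket_sort n key xs) = set xs"
  by (auto simp: bucket_sort_def set_bucket less_Suc_eq_le simp del: upt_Suc)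

lemma distinct_bucket_sort: "distinct xs \<Longrightarrow> distinct (bucket_sort n key xs)"
proof (induction n)
  case (Suc n)
  then show ?case by (auto simp: bucket_sort_def set_bucket) (simp_all add: bucket_def)
qed (simp add: bucket_sort_def bucket_def)

lemma sorted_wrt_bucket_sort:
  assumes "sorted_wrt R xs"
  shows "sorted_wrt (\<lambda>a b. key a < key b \<or> key a = key b \<and> R b a) (bucket_sort n key xs)"
proof -
  let ?S = "\<lambda>a b. key a < key b \<or> key a = key b \<and> R b a"
  have bk: "sorted_wrt ?S (bucket key xs k)" for k
  proof -
    have "sorted_wrt (\<lambda>a b. R b a) (bucket key xs k)"
      unfolding bucket_def sorted_wrt_rev using assms by (simp add: sorted_wrt_filter)
    then show ?thesis
      by (rule sorted_wrt_mono_rel[rotated]) (simp add: set_bucket)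
  qed
  have "sorted_wrt ?S (concat (map (bucket key xs) [0..<m]))" for m
  proof (induction m)
    case (Suc m)
    then show ?case using bk[of m] by (auto simp: sorted_wrt_append set_bucket)
  qed simp
  then show ?thesis unfolding bucket_sort_def .
qed

section \<open>Timed weakest preconditions\<close>

text \<open>\<open>wp W p Q R A T\<close>: with \<open>T\<close> time units available, \<open>p\<close> terminates in a state satisfying \<open>Q\<close>, the
  last argument of \<open>Q\<close> being the number of unused units.\<close>

definition wp :: "nat \<Rightarrow> prog \<Rightarrow> ((nat \<Rightarrow> nat) \<Rightarrow> (nat \<Rightarrow> nat \<Rightarrow> nat) \<Rightarrow> nat \<Rightarrow> bool) \<Rightarrow>
    (nat \<Rightarrow> nat) \<Rightarrow> (nat \<Rightarrow> nat \<Rightarrow> nat) \<Rightarrow> nat \<Rightarrow> bool" where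
  "wp W p Q R A T \<longleftrightarrow> (\<exists>t R' A'. exec W p (R, A) t (R', A') \<and> t \<le> T \<and> Q R' A' (T - t))"

lemma wpI: "exec W p (R, A) t (R', A') \<Longrightarrow> t \<le> T \<Longrightarrow> Q R' A' (T - t) \<Longrightarrow> wp W p Q R A T"
  unfolding wp_def by blast

lemma wpE:
  assumes "wp W p Q R A T"
  obtains t R' A' where "exec W p (R, A) t (R', A')" "t \<le> T" "Q R' A' (T - t)"
  using assms unfolding wp_def by blast

lemma wp_mono:
  "wp W p P R A T \<Longrightarrow> (\<And>R' A' T'. P R' A' T' \<Longrightarrow> Q R' A' T') \<Longrightarrow> wp W p Q R A T"
  unfolding wp_def by blast

lemma wp_Skip: "wp W Skip Q R A T \<longleftrightarrow> 1 \<le> T \<and> Q R A (T - 1)"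
  by (auto elim!: wpE exec_elims intro!: wpI exec.intros)

lemma wp_Const: "wp W (Const x k) Q R A T \<longleftrightarrow> k \<le> W \<and> 1 \<le> T \<and> Q (R(x := k)) A (T - 1)"
  by (auto elim!: wpE exec_elims intro!: wpI exec.intros)

lemma wp_Copy: "wp W (Copy x y) Q R A T \<longleftrightarrow> R y \<le> W \<and> 1 \<le> T \<and> Q (R(x := R y)) A (T - 1)"
  by (auto elim!: wpE exec_elims intro!: wpI exec.intros)

lemma wp_Add: "wp W (Add x y z) Q R A T \<longleftrightarrow> R y + R z \<le> W \<and> 1 \<le> T \<and> Q (R(x := R y + R z)) A (T - 1)"
  by (auto elim!: wpE exec_elims intro!: wpI exec.intros)

lemma wp_Sub: "wp W (Sub x y z) Q R A T \<longleftrightarrow> R y - R z \<le> W \<and> 1 \<le> T \<and> Q (R(x := R y - R z)) A (T - 1)"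
  by (auto elim!: wpE exec_elims intro!: wpI exec.intros)

lemma wp_Load: "wp W (Load x a i) Q R A T \<longleftrightarrow> A a (R i) \<le> W \<and> 1 \<le> T \<and> Q (R(x := A a (R i))) A (T - 1)"
  by (auto elim!: wpE exec_elims intro!: wpI exec.intros)

lemma wp_Store:
  "wp W (Store a i x) Q R A T \<longleftrightarrow> R x \<le> W \<and> 1 \<le> T \<and> Q R (A(a := (A a)(R i := R x))) (T - 1)"
  by (auto elim!: wpE exec_elims intro!: wpI exec.intros)

lemma wp_Seq: "wp W (Seq p q) Q R A T \<longleftrightarrow> wp W p (wp W q Q) R A T"
proof
  assume "wp W (Seq p q) Q R A T"
  then obtain u R2 A2 where e: "exec W (Seq p q) (R, A) u (R2, A2)" "u \<le> T" "Q R2 A2 (T - u)"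
    by (rule wpE)
  from e(1) obtain t t' s' where s: "u = t + t'" "exec W p (R, A) t s'" "exec W q s' t' (R2, A2)"
    by (auto elim: exec_elims)
  obtain R1 A1 where "s' = (R1, A1)" by (cases s')
  then show "wp W p (wp W q Q) R A T"
    using s e by (auto intro!: wpI[of W p R A t R1 A1] wpI[of W q R1 A1 t' R2 A2])
next
  assume "wp W p (wp W q Q) R A T"
  then obtain t R1 A1 where e: "exec W p (R, A) t (R1, A1)" "t \<le> T" "wp W q Q R1 A1 (T - t)"
    by (rule wpE)
  from e(3) obtain t' R2 A2 where "exec W q (R1, A1) t' (R2, A2)" "t' \<le> T - t" "Q R2 A2 (T - t - t')"
    by (rule wpE)
  then show "wp W (Seq p q) Q R A T"
    using e by (auto intro!: wpI[of W _ R A "t + t'" R2 A2] exec.Seq)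
qed

lemma wp_If:
  "wp W (If b p q) Q R A T \<longleftrightarrow>
    1 \<le> T \<and> (if holds b (R, A) then wp W p Q R A (T - 1) else wp W q Q R A (T - 1))"
proof
  assume "wp W (If b p q) Q R A T"
  then show "1 \<le> T \<and> (if holds b (R, A) then wp W p Q R A (T - 1) else wp W q Q R A (T - 1))"
    by (auto elim!: wpE exec_elims intro: wpI)
next
  assume "1 \<le> T \<and> (if holds b (R, A) then wp W p Q R A (T - 1) else wp W q Q R A (T - 1))"
  then show "wp W (If b p q) Q R A T"
    by (auto split: if_splits elim!: wpE intro!: wpI exec.IfTrue exec.IfFalse)
qed

lemmas wp_simps = wp_Skip wp_Const wp_Copy wp_Add wp_Sub wp_Load wp_Store wp_Seq wp_If

text \<open>Every iteration uses at least one time unit, so the remaining time is a termination measure.\<close>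

lemma wp_While:
  assumes "I R A T"
    and "\<And>R A T. I R A T \<Longrightarrow> 1 \<le> T"
    and "\<And>R A T. I R A T \<Longrightarrow> holds b (R, A) \<Longrightarrow> wp W p I R A (T - 1)"
    and "\<And>R A T. I R A T \<Longrightarrow> \<not> holds b (R, A) \<Longrightarrow> Q R A (T - 1)"
  shows "wp W (While b p) Q R A T"
  using assms(1)
proof (induction T arbitrary: R A rule: less_induct)
  case (less T)
  have T: "1 \<le> T" using assms(2) less.prems by blast
  show ?case
  proof (cases "holds b (R, A)")
    case False
    then show ?thesis using assms(4)[OF less.prems] T by (auto intro!: wpI exec.WhileFalse)
  next
    case True
    obtain t R1 A1 where e: "exec W p (R, A) t (R1, A1)" "t \<le> T - 1" "I R1 A1 (T - 1 - t)"
      using assms(3)[OF less.prems True] by (rule wpE)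
    have dec: "T - 1 - t < T" using T by simp
    obtain t' R2 A2 where e': "exec W (While b p) (R1, A1) t' (R2, A2)" "t' \<le> T - 1 - t"
        "Q R2 A2 (T - 1 - t - t')"
      by (rule wpE[OF less.IH[OF dec e(3)]])
    show ?thesis
      by (rule wpI[OF exec.WhileTrue[OF True e(1) e'(1)]]) (use e e' T in simp_all)
  qed
qed

definition inc :: "nat \<Rightarrow> prog" where
  "inc x = Seq (Const 23 1) (Add x x 23)"

lemma wp_inc:
  "x \<noteq> 23 \<Longrightarrow> wp W (inc x) Q R A T \<longleftrightarrow>
    1 \<le> W \<and> Suc (R x) \<le> W \<and> 2 \<le> T \<and> Q (R(23 := 1, x := Suc (R x))) A (T - 2)"
  by (auto simp: inc_def wp_simps numeral_2_eq_2)

definition for_edges :: "nat \<Rightarrow> prog \<Rightarrow> prog" where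
  "for_edges x body = Seq (Load 20 0 x) (Seq (Const 23 1) (Seq (Add 21 x 23) (Seq (Load 21 0 21)
    (While (Less 20 21) (Seq (Load 22 1 20) (Seq body (inc 20)))))))"

text \<open>The word bound has room for every position in the concatenated lists; levels, names,
  pointers and counters stay at most one above the number of vertices.\<close>

locale ram_graph =
  fixes adj :: "nat list list" and W :: nat
  assumes adj_less: "\<And>v w. v < length adj \<Longrightarrow> w \<in> set (adj ! v) \<Longrightarrow> w < length adj"
    and W_ge: "length adj + length (concat adj) + 2 \<le> W"
begin

abbreviation "n \<equiv> length adj"

definition memory :: "(nat \<Rightarrow> nat \<Rightarrow> nat) \<Rightarrow> bool" where
  "memory A \<longleftrightarrow> (\<forall>i\<le>n. A 0 i = length (concat (take i adj))) \<and>
    (\<forall>j<length (concat adj). A 1 j = concat adj ! j)"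

lemma memory_cong: "A' 0 = A 0 \<Longrightarrow> A' 1 = A 1 \<Longrightarrow> memory A' \<longleftrightarrow> memory A"
  by (simp add: memory_def)

lemma memory_input_state: "memory (snd (input_state adj))"
  by (simp add: memory_def input_state_def)

lemma offset_le: "length (concat (take i adj)) \<le> length (concat adj)"
  by (metis append_take_drop_id concat_append length_append le_add1)

lemma memory_offset:
  assumes "memory A" "v < n"
  shows "A 0 (Suc v) = A 0 v + length (adj ! v)" "A 0 v + length (adj ! v) \<le> length (concat adj)"
proof -
  have "length (concat (take (Suc v) adj)) = length (concat (take v adj)) + length (adj ! v)"
    using assms(2) by (simp add: take_Suc_conv_app_nth)
  then show "A 0 (Suc v) = A 0 v + length (adj ! v)" "A 0 v + length (adj ! v) \<le> length (concat adj)"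
    using assms offset_le[of "Suc v"] by (simp_all add: memory_def)
qed

lemma memory_edge:
  assumes "memory A" "v < n" "adj ! v = ys @ w # zs"
  shows "A 1 (A 0 v + length ys) = w"
proof -
  have "adj = take v adj @ adj ! v # drop (Suc v) adj" using assms(2) by (simp add: id_take_nth_drop)
  then have "concat adj = concat (take v adj) @ adj ! v @ concat (drop (Suc v) adj)"
    by (metis concat.simps(2) concat_append)
  then have "concat adj ! (length (concat (take v adj)) + length ys) = w"
    using assms(3) by (simp add: nth_append)
  moreover have "A 0 v + length ys < length (concat adj)"
    using memory_offset[OF assms(1,2)] assms(3) by simp
  ultimately show ?thesis using assms(1,2) by (simp add: memory_def)
qed

text \<open>The invariant \<open>I\<close> speaks about the processed prefix of the adjacency list
  and must survive changes of the scratch registers. Each entry costs 4 units besides the body: loop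
  test, load and increment (2). The 5 are the four instructions before the loop and the last
  test.\<close>

lemma wp_for_edges:
  assumes v: "R x = v" "v < n" and mem: "memory A" and x: "x \<notin> {20, 21, 22, 23}"
    and init: "I [] R A"
    and scratch: "\<And>ys R A k y. k \<in> {20, 21, 22, 23} \<Longrightarrow> I ys R A \<Longrightarrow> I ys (R(k := y)) A"
    and body: "\<And>ys w zs R A T. adj ! v = ys @ w # zs \<Longrightarrow> w < n \<Longrightarrow> I ys R A \<Longrightarrow> memory A \<Longrightarrow> R 22 = w \<Longrightarrow>
      c \<le> T \<Longrightarrow> wp W body (\<lambda>R' A' T'. I (ys @ [w]) R' A' \<and> memory A' \<and>
        R' 20 = R 20 \<and> R' 21 = R 21 \<and> T \<le> T' + c) R A T"
    and T: "5 + (c + 4) * length (adj ! v) \<le> T"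
    and post: "\<And>R' A' T'. I (adj ! v) R' A' \<Longrightarrow> memory A' \<Longrightarrow>
      T \<le> T' + (5 + (c + 4) * length (adj ! v)) \<Longrightarrow> Q R' A' T'"
  shows "wp W (for_edges x body) Q R A T"
proof -
  define off where "off = A 0 v"
  let ?d = "length (adj ! v)"
  let ?J = "\<lambda>R A T'. \<exists>ys zs. adj ! v = ys @ zs \<and> I ys R A \<and> memory A \<and> R 20 = off + length ys \<and>
    R 21 = off + ?d \<and> T \<le> T' + 4 + (c + 4) * length ys \<and> 1 + (c + 4) * length zs \<le> T'"
  have off: "off + ?d \<le> length (concat adj)" using memory_offset[OF mem v(2)] by (simp add: off_def)
  have off': "A 0 v = off" if "memory A" for A
    using mem that v(2) unfolding off_def memory_def by simp
  have loop: "wp W (While (Less 20 21) (Seq (Load 22 1 20) (Seq body (inc 20)))) Q R1 A (T - 4)"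
    if "I [] R1 A" "R1 20 = off" "R1 21 = off + ?d" for R1
  proof (rule wp_While[where I = ?J])
    show "?J R1 A (T - 4)"
      using that mem T by (intro exI[of _ "[]"] exI[of _ "adj ! v"]) auto
  next
    fix R A T' assume "?J R A T'"
    then show "1 \<le> T'" by auto
  next
    fix R A T' assume "?J R A T'" and less: "holds (Less 20 21) (R, A)"
    then obtain ys zs where J: "adj ! v = ys @ zs" "I ys R A" "memory A" "R 20 = off + length ys"
      "R 21 = off + ?d" "T \<le> T' + 4 + (c + 4) * length ys" "1 + (c + 4) * length zs \<le> T'" by blast
    obtain w zs' where zs: "zs = w # zs'" using less J by (cases zs) auto
    have w: "A 1 (R 20) = w" "w < n"
      using memory_edge[OF J(3) v(2), of ys w zs'] off'[OF J(3)] J zs adj_less[OF v(2), of w] by auto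
    have Wb: "w \<le> W" "off + ?d + 2 \<le> W" using W_ge off w by auto
    have t: "c + 3 + (1 + (c + 4) * length zs') \<le> T' - 1" using J(7) zs by simp
    have "wp W body (\<lambda>R' A' T''. I (ys @ [w]) R' A' \<and> memory A' \<and> R' 20 = (R(22 := w)) 20 \<and>
        R' 21 = (R(22 := w)) 21 \<and> T' - 1 - 1 \<le> T'' + c) (R(22 := w)) A (T' - 1 - 1)"
    proof (rule body[of ys w zs'])
      show "I ys (R(22 := w)) A" using scratch[OF _ J(2), of 22] by simp
    qed (use J zs w t in simp_all)
    then have "wp W body (wp W (inc 20) ?J) (R(22 := w)) A (T' - 1 - 1)"
    proof (rule wp_mono)
      fix R' A' T''
      assume h: "I (ys @ [w]) R' A' \<and> memory A' \<and> R' 20 = (R(22 := w)) 20 \<and>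
        R' 21 = (R(22 := w)) 21 \<and> T' - 1 - 1 \<le> T'' + c"
      have "I (ys @ [w]) (R'(23 := 1, 20 := Suc (R' 20))) A'"
        using scratch[of 20 "ys @ [w]" "R'(23 := 1)" A' "Suc (R' 20)"]
          scratch[of 23 "ys @ [w]" R' A' 1] h by simp
      then have "?J (R'(23 := 1, 20 := Suc (R' 20))) A' (T'' - 2)"
        using h J(1,4-6) zs t by (intro exI[of _ "ys @ [w]"] exI[of _ zs']) auto
      moreover have "Suc (R' 20) \<le> W" using h J zs Wb by simp
      moreover have "2 \<le> T''" using h t by linarith
      ultimately show "wp W (inc 20) ?J R' A' T''" using Wb by (simp add: wp_inc)
    qed
    then show "wp W (Seq (Load 22 1 20) (Seq body (inc 20))) ?J R A (T' - 1)"
      using w Wb t by (simp add: wp_simps)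
  next
    fix R A T' assume "?J R A T'" and "\<not> holds (Less 20 21) (R, A)"
    then obtain ys where J: "adj ! v = ys" "I ys R A" "memory A" "T \<le> T' + 4 + (c + 4) * length ys" "1 \<le> T'"
      by auto
    show "Q R A (T' - 1)" by (rule post) (use J in auto)
  qed
  have "length (concat adj) \<le> W" "Suc v \<le> W" "off \<le> W" "off + ?d \<le> W" using W_ge off v by auto
  moreover have "I [] (R(20 := off, 23 := 1, 21 := Suc v, 21 := off + ?d)) A"
    by (intro scratch init) auto
  moreover obtain T1 where "T = Suc (Suc (Suc (Suc T1)))"
    using T by (intro that[of "T - 4"]) simp
  ultimately show ?thesis
    using loop[of "R(20 := off, 23 := 1, 21 := Suc v, 21 := off + ?d)"] x v off'[OF mem]
      memory_offset(1)[OF mem v(2)]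
    by (simp add: for_edges_def wp_simps)
qed

end

section \<open>The programs\<close>

lemma map_upt_append: "map f [0..<k] = xs \<Longrightarrow> map (f(k := x)) [0..<Suc k] = xs @ [x]"
  by auto

locale ram_instance =
  fixes G :: "nat graph" and adj :: "nat list list" and W :: nat
  assumes G: "simple_graph G" and lists: "adj_lists G adj"
    and W_large: "length adj + length (concat adj) + 2 \<le> W"
begin

lemma verts_eq: "verts G = {..<length adj}"
  using lists by (simp add: adj_lists_def)

lemma adj_distinct: "v < length adj \<Longrightarrow> distinct (adj ! v)"
  and adj_set: "v < length adj \<Longrightarrow> set (adj ! v) = nbhd G v"
  using lists by (simp_all add: adj_lists_def)

end

sublocale ram_instance \<subseteq> ram_graph adj W
  by standard (use W_large adj_set verts_eq in \<open>auto simp: nbhd_def\<close>)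

context ram_instance
begin

lemma memory_upd [simp]: "2 \<le> a \<Longrightarrow> memory (A(a := f)) \<longleftrightarrow> memory A"
  by (rule memory_cong) auto

lemma sum_degrees: "(\<Sum>v\<in>verts G. length (adj ! v)) = length (concat adj)"
  by (simp add: length_concat sum_list_sum_nth verts_eq lessThan_atLeast0)

lemma card_verts: "card (verts G) = n" and finite_verts: "finite (verts G)"
  by (simp_all add: verts_eq)

lemma distinct_length_le: "distinct xs \<Longrightarrow> set xs \<subseteq> verts G \<Longrightarrow> length xs \<le> n"
  using card_mono[OF finite_verts, of "set xs"] by (simp add: distinct_card card_verts)

end

text \<open>Array 2 receives the search order, array 4 the level plus one (0 for undiscovered vertices),
  array 5 the number of neighbours in lower levels, arrays 8 and 11 the results of the two sorts, array
  3 the positions of the vertices handled so far, and arrays 12 to 14 the marks. Registers 20 to 23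
  are scratch registers of \<open>for_edges\<close> and \<open>inc\<close>.\<close>

definition discover :: prog where
  "discover = Seq (Load 7 4 22) (Seq (Const 8 0)
    (If (Eq 7 8) (Seq (Store 4 22 6) (Seq (Store 2 3 22) (inc 3))) Skip))"

definition bfs_body :: prog where
  "bfs_body = If (Less 2 3)
    (Seq (Load 5 2 2) (Seq (inc 2) (Seq (Load 6 4 5) (Seq (inc 6) (for_edges 5 discover)))))
    (Seq (Load 7 4 4) (Seq (Const 8 0)
      (If (Eq 7 8) (Seq (Const 7 1) (Seq (Store 4 4 7) (Seq (Store 2 3 4) (inc 3)))) (inc 4))))"

definition bfs_prog :: prog where
  "bfs_prog = Seq (Const 2 0) (Seq (Const 3 0) (Seq (Const 4 0) (While (Less 2 0) bfs_body)))"

context ram_instance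
begin

text \<open>11 is 7 for \<open>discover\<close> plus 4 for the loop of \<open>for_edges\<close>; 20
  covers the fixed work of a visit with some slack.\<close>

definition cost :: "nat set \<Rightarrow> nat" where
  "cost X = (\<Sum>v\<in>X. 20 + 11 * length (adj ! v))"

lemma cost_remove:
  "u \<in> verts G - set ds \<Longrightarrow>
    cost (verts G - set ds) = 20 + 11 * length (adj ! u) + cost (verts G - set (ds @ [u]))"
proof -
  assume "u \<in> verts G - set ds"
  moreover have "verts G - set (ds @ [u]) = verts G - set ds - {u}" by auto
  ultimately show ?thesis using sum.remove[of "verts G - set ds" u] finite_verts by (simp add: cost_def)
qed

text \<open>The time bound is a potential: \<open>cost\<close> for the unprocessed vertices, 10 for
  each remaining advance of the root pointer in register 4, 10 for each vertex still to be enqueued,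
  and 1 for the last loop test. The root pointer never moves back, as everything below it is
  discovered.\<close>

definition bfs_inv :: "(nat \<Rightarrow> nat \<Rightarrow> nat) \<Rightarrow> (nat \<Rightarrow> nat) \<Rightarrow> (nat \<Rightarrow> nat \<Rightarrow> nat) \<Rightarrow> nat \<Rightarrow> bool" where
  "bfs_inv A0 R A T \<longleftrightarrow> (\<exists>ds q rt. bfs_state G ds q (A 4) rt \<and> map (A 2) [0..<R 3] = ds @ q \<and>
    R 2 = length ds \<and> R 3 = length (ds @ q) \<and> R 0 = n \<and> R 4 \<le> n \<and> (\<forall>v<R 4. A 4 v \<noteq> 0) \<and>
    (\<forall>a. a \<notin> {2, 4} \<longrightarrow> A a = A0 a) \<and>
    1 + cost (verts G - set ds) + 10 * (n - R 4) + 10 * (n - R 3) \<le> T)"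

lemma bfs_invI:
  assumes "bfs_state G ds q (A 4) rt" "map (A 2) [0..<R 3] = ds @ q" "R 2 = length ds"
    "R 3 = length (ds @ q)" "R 0 = n" "R 4 \<le> n" "\<And>v. v < R 4 \<Longrightarrow> A 4 v \<noteq> 0"
    "\<And>a. a \<notin> {2, 4} \<Longrightarrow> A a = A0 a"
    "1 + cost (verts G - set ds) + 10 * (n - R 4) + 10 * (n - R 3) \<le> T"
  shows "bfs_inv A0 R A T"
  unfolding bfs_inv_def using assms by blast

lemma memory_of: "memory A0 \<Longrightarrow> \<forall>a. a \<notin> X \<longrightarrow> A a = A0 a \<Longrightarrow> 0 \<notin> X \<Longrightarrow> 1 \<notin> X \<Longrightarrow> memory A"
  using memory_cong[of A A0] by blast

lemma bfs_stateD:
  assumes "bfs_state G ds q L rt"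
  shows "distinct (ds @ q)" "set (ds @ q) \<subseteq> verts G" "L v = 0 \<longleftrightarrow> v \<notin> set (ds @ q)"
    "L v \<le> n" "length (ds @ q) \<le> n"
proof -
  note s = assms[unfolded bfs_state_def]
  show "distinct (ds @ q)" "set (ds @ q) \<subseteq> verts G" "L v = 0 \<longleftrightarrow> v \<notin> set (ds @ q)"
    using s by blast+
  then show len: "length (ds @ q) \<le> n" by (intro distinct_length_le)
  have "L v \<le> length (ds @ q)" using s by blast
  then show "L v \<le> n" using len by linarith
qed

lemma wp_visit:
  assumes A0: "memory A0" and st: "bfs_state G ds (u # q) L rt"
    and R: "R 0 = n" "R 2 = Suc (length ds)" "R 3 = length (ds @ u # q)" "R 4 \<le> n" "R 5 = u" "R 6 = Suc (L u)"
    and A: "A 4 = L" "map (A 2) [0..<R 3] = ds @ u # q" "\<forall>a. a \<notin> {2, 4} \<longrightarrow> A a = A0 a"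
    and disc: "\<forall>v<R 4. L v \<noteq> 0"
    and T: "6 + cost (verts G - set ds) + 10 * (n - R 4) + 10 * (n - R 3) \<le> T + 14"
  shows "wp W (for_edges 5 discover) (bfs_inv A0) R A T"
proof -
  note d = bfs_stateD[OF st]
  define D where "D = set (ds @ u # q)"
  define new where "new ys = filter (\<lambda>w. w \<notin> D) ys" for ys
  define J where "J ys R' A' \<longleftrightarrow> R' 0 = n \<and> R' 2 = Suc (length ds) \<and> R' 4 = R 4 \<and> R' 6 = Suc (L u) \<and>
    R' 3 = length (ds @ u # q @ new ys) \<and> map (A' 2) [0..<R' 3] = ds @ u # q @ new ys \<and>
    A' 4 = (\<lambda>w. if w \<in> set (new ys) then Suc (L u) else L w) \<and> (\<forall>a. a \<notin> {2, 4} \<longrightarrow> A' a = A0 a)"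
    for ys and R' :: "nat \<Rightarrow> nat" and A' :: "nat \<Rightarrow> nat \<Rightarrow> nat"
  have u: "u \<in> verts G" "u < n" using d(2) verts_eq by auto
  have un: "u \<in> verts G - set ds" using u d(1) by auto
  note split = cost_remove[OF un]
  have Wb: "n + 2 \<le> W" using W_large by simp
  have L: "L w \<le> n" "L w = 0 \<longleftrightarrow> w \<notin> D" for w using bfs_stateD(3,4)[OF st] by (simp_all add: D_def)
  have len: "length (ds @ u # q @ new ys) \<le> n" if "distinct ys" "set ys \<subseteq> verts G" for ys
    by (rule distinct_length_le) (use that d(1,2) in \<open>auto simp: new_def D_def\<close>)
  have adjV: "set (adj ! u) \<subseteq> verts G" "distinct (adj ! u)"
    using adj_set adj_distinct u by (auto simp: nbhd_def)
  show ?thesis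
  proof (rule wp_for_edges[where v = u and c = 7 and I = J])
    show "R 5 = u" "u < n" using R u by auto
    show "memory A" using memory_of[OF A0 A(3)] by simp
    show "(5::nat) \<notin> {20, 21, 22, 23}" by simp
    show "J [] R A" using R A by (simp add: J_def new_def)
    show "J ys (R'(k := y)) A'" if "k \<in> {20, 21, 22, 23}" "J ys R' A'" for ys R' A' k y
      using that by (auto simp: J_def)
    show "5 + (7 + 4) * length (adj ! u) \<le> T" using T split by simp
  next
    fix ys w zs R' A' and T' :: nat
    assume e: "adj ! u = ys @ w # zs" "w < n" and J: "J ys R' A'" and m: "memory A'" and w: "R' 22 = w"
      and "7 \<le> T'"
    then obtain T1 where T1: "T' = Suc (Suc (Suc (Suc (Suc (Suc (Suc T1))))))"
      by (intro that[of "T' - 7"]) simp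
    \<comment> \<open>Adjacency lists have no repetitions, so \<open>w\<close> was not discovered
      during this visit and array 4 still holds its old level.\<close>
    have wys: "w \<notin> set (new ys)" using adjV(2) e(1) by (auto simp: new_def)
    have A4: "A' 4 w = L w" using J wys by (simp add: J_def)
    have b: "length (ds @ u # q @ new (ys @ [w])) \<le> n" by (rule len) (use adjV e in auto)
    show "wp W discover (\<lambda>R'' A'' T''. J (ys @ [w]) R'' A'' \<and> memory A'' \<and> R'' 20 = R' 20 \<and>
        R'' 21 = R' 21 \<and> T' \<le> T'' + 7) R' A' T'"
    proof (cases "w \<in> D")
      case True
      then have nw: "new (ys @ [w]) = new ys" by (simp add: new_def)
      have "J (ys @ [w]) (R'(7 := L w, 8 := 0)) A'" using J unfolding J_def nw by (auto simp del: upt_Suc)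
      then show ?thesis
        unfolding discover_def using True L[of w] Wb T1 A4 w m by (simp add: wp_simps)
    next
      case False
      then have nw: "new (ys @ [w]) = new ys @ [w]" by (simp add: new_def)
      have r3: "R' 3 = length (ds @ u # q @ new ys)" "R' 6 = Suc (L u)" using J by (simp_all add: J_def del: upt_Suc)
      have "L w = 0" using False L by simp
      have "J (ys @ [w]) (R'(7 := 0, 8 := 0, 23 := Suc 0, 3 := Suc (R' 3)))
          (A'(4 := (A' 4)(w := Suc (L u)), 2 := (A' 2)(R' 3 := w)))"
        unfolding J_def nw
      proof (intro conjI)
        have "map ((A' 2)(R' 3 := w)) [0..<Suc (R' 3)] = (ds @ u # q @ new ys) @ [w]"
          by (rule map_upt_append) (use J in \<open>auto simp: J_def simp del: upt_Suc\<close>)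
        then show "map ((A'(4 := (A' 4)(w := Suc (L u)), 2 := (A' 2)(R' 3 := w))) 2)
            [0..<(R'(7 := 0, 8 := 0, 23 := Suc 0, 3 := Suc (R' 3))) 3] = ds @ u # q @ new ys @ [w]"
          by (simp del: upt_Suc)
      qed (use J in \<open>auto simp: J_def fun_eq_iff simp del: upt_Suc\<close>)
      moreover have "Suc (R' 3) \<le> W" using b r3 nw Wb by simp
      moreover have "Suc (L u) \<le> W" using L[of u] Wb by simp
      ultimately show ?thesis
        unfolding discover_def using \<open>L w = 0\<close> Wb T1 A4 w m r3(2) e(2) by (simp add: wp_simps wp_inc)
    qed
  next
    fix R' A' T'
    assume J: "J (adj ! u) R' A'" and m: "memory A'" and t: "T \<le> T' + (5 + (7 + 4) * length (adj ! u))"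
    define ws where "ws = new (adj ! u)"
    have ws: "distinct ws" "set ws = nbhd G u - (set ds \<union> set (u # q))"
      using adjV adj_set[OF u(2)] by (auto simp: ws_def new_def D_def)
    have "bfs_state G (ds @ [u]) (q @ ws) (A' 4) (\<lambda>w. if w \<in> set ws then rt u else rt w)"
      using bfs_state_visit[OF G st ws] J by (simp add: J_def ws_def)
    moreover have "1 + cost (verts G - set (ds @ [u])) + 10 * (n - R' 4) + 10 * (n - R' 3) \<le> T'"
    proof -
      have "n - R' 3 \<le> n - R 3" using J R by (simp add: J_def)
      moreover have "R' 4 = R 4" using J by (simp add: J_def)
      ultimately show ?thesis using t T split by simp
    qed
    moreover have "\<forall>v<R' 4. A' 4 v \<noteq> 0" using J disc by (auto simp: J_def)
    ultimately show "bfs_inv A0 R' A' T'"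
      by (intro bfs_invI[of "ds @ [u]" "q @ ws"]) (use J R in \<open>auto simp: J_def ws_def simp del: upt_Suc\<close>)
  qed
qed

lemma wp_bfs_body:
  assumes A0: "memory A0" and inv: "bfs_inv A0 R A T" and less: "R 2 < R 0"
  shows "wp W bfs_body (bfs_inv A0) R A (T - 1)"
proof -
  from inv obtain ds q rt where st: "bfs_state G ds q (A 4) rt" and A2: "map (A 2) [0..<R 3] = ds @ q"
    and R: "R 2 = length ds" "R 3 = length (ds @ q)" "R 0 = n" "R 4 \<le> n"
    and disc: "\<forall>v<R 4. A 4 v \<noteq> 0" and A: "\<forall>a. a \<notin> {2, 4} \<longrightarrow> A a = A0 a"
    and T: "1 + cost (verts G - set ds) + 10 * (n - R 4) + 10 * (n - R 3) \<le> T"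
    unfolding bfs_inv_def by blast
  note d = bfs_stateD[OF st]
  have Wb: "n + 2 \<le> W" using W_large by simp
  show ?thesis
  proof (cases q)
    case (Cons u q')
    then have less': "R 2 < R 3" using R by simp
    have "map (A 2) [0..<R 3] ! length ds = u" using A2 Cons by simp
    then have u: "A 2 (R 2) = u" using less' R by simp
    have uV: "u \<in> verts G" "u < n" using d(2) Cons verts_eq by auto
    have un: "u \<in> verts G - set ds" using uV d(1) Cons by auto
    have "20 \<le> cost (verts G - set ds)" using cost_remove[OF un] by simp
    then obtain T1 where T1: "T = Suc (Suc (Suc (Suc (Suc (Suc (Suc (Suc T1)))))))"
      using T by (intro that[of "T - 8"]) simp
    let ?R = "R(5 := u, 23 := Suc 0, 2 := Suc (length ds), 6 := Suc (A 4 u))"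
    have "wp W (for_edges 5 discover) (bfs_inv A0) ?R A T1"
      by (rule wp_visit[OF A0 st[unfolded Cons]]) (use R A A2 Cons disc T T1 in auto)
    moreover have "A 4 u \<le> n" "length ds \<le> n" using d by auto
    ultimately show ?thesis
      unfolding bfs_body_def using less' u uV Wb T1 R by (simp add: wp_simps wp_inc fun_upd_twist)
  next
    case Nil
    let ?r = "R 4"
    have R3: "R 3 = length ds" "R 3 < n" using R Nil less by auto
    \<comment> \<open>With the root pointer at the end every vertex is discovered, and as the queue
      is empty also processed, against the loop condition.\<close>
    have r: "?r < n"
    proof (rule ccontr)
      assume "\<not> ?r < n"
      then have "set ds = verts G"
        using disc d(2) R(4) st Nil bfs_stateD(3)[OF st] by (force simp: verts_eq)
      then show False using R3 R d(1) Nil distinct_card[of ds] card_verts by simp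
    qed
    then have "10 \<le> T" using T by simp
    then obtain T1 where T1: "T = Suc (Suc (Suc (Suc (Suc (Suc (Suc (Suc (Suc (Suc T1)))))))))"
      by (intro that[of "T - 10"]) simp
    have b: "A 4 ?r \<le> n" using d by blast
    show ?thesis
    proof (cases "A 4 ?r = 0")
      case True
      then have rv: "?r \<in> verts G - set ds" using bfs_stateD(3)[OF st, of ?r] r Nil verts_eq by auto
      have "bfs_state G ds [?r] ((A 4)(?r := 1)) (rt(?r := ?r))"
        by (rule bfs_state_root) (use st Nil rv in auto)
      then have "bfs_inv A0 (R(7 := Suc 0, 8 := 0, 23 := Suc 0, 3 := Suc (R 3)))
          (A(4 := (A 4)(?r := Suc 0), 2 := (A 2)(R 3 := ?r))) T1"
        by (intro bfs_invI[of ds "[?r]" _ "rt(?r := ?r)"])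
          (use R R3 A A2 Nil disc T T1 in auto)
      then show ?thesis
        unfolding bfs_body_def using True R R3 Wb T1 r by (simp add: wp_simps wp_inc fun_upd_twist)
    next
      case False
      then have "bfs_inv A0 (R(7 := A 4 ?r, 8 := 0, 23 := Suc 0, 4 := Suc ?r)) A (Suc (Suc (Suc T1)))"
        by (intro bfs_invI[of ds "[]" _ rt])
          (use R R3 A A2 Nil disc st T T1 r in \<open>auto simp: less_Suc_eq\<close>)
      then show ?thesis
        unfolding bfs_body_def using False R R3 Wb T1 r b by (simp add: wp_simps wp_inc fun_upd_twist)
    qed
  qed
qed

definition bfs_post :: "(nat \<Rightarrow> nat \<Rightarrow> nat) \<Rightarrow> (nat \<Rightarrow> nat) \<Rightarrow> (nat \<Rightarrow> nat \<Rightarrow> nat) \<Rightarrow> bool" where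
  "bfs_post A0 R A \<longleftrightarrow> R 0 = n \<and> (\<forall>a. a \<notin> {2, 4} \<longrightarrow> A a = A0 a) \<and>
    (\<exists>rt. bfs_state G (map (A 2) [0..<n]) [] (A 4) rt) \<and> set (map (A 2) [0..<n]) = verts G"

text \<open>The initial potential gives 40 = 20 + 10 + 10 per vertex; 4 is three initialisations and
  the last loop test.\<close>

lemma wp_bfs_prog:
  assumes A0: "memory A0" "A0 4 = (\<lambda>_. 0)" and R: "R 0 = n" and T: "T = 4 + 40 * n + 11 * length (concat adj)"
  shows "wp W bfs_prog (\<lambda>R A _. bfs_post A0 R A) R A0 T"
proof -
  obtain T1 where T1: "T = Suc (Suc (Suc T1))" using T by (intro that[of "T - 3"]) simp
  have "wp W (While (Less 2 0) bfs_body) (\<lambda>R A _. bfs_post A0 R A) (R(2 := 0, 3 := 0, 4 := 0)) A0 T1"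
  proof (rule wp_While[where I = "bfs_inv A0"])
    have "cost (verts G) = 20 * n + 11 * length (concat adj)"
      by (simp add: cost_def sum.distrib sum_distrib_left[symmetric] sum_degrees card_verts)
    then show "bfs_inv A0 (R(2 := 0, 3 := 0, 4 := 0)) A0 T1"
      using bfs_state_start[of G id] A0 R T T1 by (intro bfs_invI[of "[]" "[]" _ id]) simp_all
  next
    fix R A T assume "bfs_inv A0 R A T"
    then show "1 \<le> T" by (auto simp: bfs_inv_def)
  next
    fix R A T assume "bfs_inv A0 R A T" "holds (Less 2 0) (R, A)"
    then show "wp W bfs_body (bfs_inv A0) R A (T - 1)" using wp_bfs_body[OF A0(1)] by simp
  next
    fix R A T assume "bfs_inv A0 R A T" and nl: "\<not> holds (Less 2 0) (R, A)"
    then obtain ds q rt where st: "bfs_state G ds q (A 4) rt" and A2: "map (A 2) [0..<R 3] = ds @ q"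
      and R: "R 2 = length ds" "R 3 = length (ds @ q)" "R 0 = n"
      and A: "\<forall>a. a \<notin> {2, 4} \<longrightarrow> A a = A0 a"
      unfolding bfs_inv_def by blast
    note d = bfs_stateD[OF st]
    have "n \<le> length ds" using nl R by simp
    then have "length ds = n" "length q = 0" using d(5) unfolding length_append by linarith+
    then have len: "length ds = n" "q = []" by simp_all
    have "set ds = verts G"
      using d(1,2) len card_verts distinct_card[of ds] by (intro card_subset_eq finite_verts) auto
    moreover have "map (A 2) [0..<n] = ds" using A2 R len by simp
    ultimately show "bfs_post A0 R A" using st R A len by (auto simp: bfs_post_def)
  qed
  then show ?thesis unfolding bfs_prog_def using T1 by (simp add: wp_simps)
qed

end

section \<open>Counting lower neighbours and bucket sorting with linked lists\<close>

definition count_body :: prog where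
  "count_body = Seq (Const 3 0) (Seq (Load 6 4 2)
    (Seq (for_edges 2 (Seq (Load 7 4 22) (If (Less 7 6) (inc 3) Skip))) (Seq (Store 5 2 3) (inc 2))))"

definition count_prog :: prog where
  "count_prog = Seq (Const 2 0) (While (Less 2 0) count_body)"

definition fill_bucket :: "nat \<Rightarrow> nat \<Rightarrow> nat \<Rightarrow> nat \<Rightarrow> prog" where
  "fill_bucket src key bkt nx = Seq (Load 3 src 2) (Seq (Load 4 key 3) (Seq (Load 5 bkt 4)
    (Seq (Store nx 3 5) (Seq (Const 6 1) (Seq (Add 6 3 6) (Seq (Store bkt 4 6) (inc 2)))))))"

definition drain_bucket :: "nat \<Rightarrow> nat \<Rightarrow> nat \<Rightarrow> prog" where
  "drain_bucket bkt nx out = Seq (Const 7 0) (If (Eq 4 7) (Seq (inc 3) (Load 4 bkt 3))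
    (Seq (Const 6 1) (Seq (Sub 5 4 6) (Seq (Store out 2 5) (Seq (Load 4 nx 5) (inc 2))))))"

definition sort_prog :: "nat \<Rightarrow> nat \<Rightarrow> nat \<Rightarrow> nat \<Rightarrow> nat \<Rightarrow> prog" where
  "sort_prog src key bkt nx out = Seq (Const 2 0) (Seq (While (Less 2 0) (fill_bucket src key bkt nx))
    (Seq (Const 2 0) (Seq (Const 3 0) (Seq (Load 4 bkt 3) (While (Less 2 0) (drain_bucket bkt nx out))))))"

text \<open>Linked lists: a pointer is \<open>0\<close> at the end and the successor of the element otherwise.\<close>

primrec chain :: "(nat \<Rightarrow> nat) \<Rightarrow> nat \<Rightarrow> nat list \<Rightarrow> bool" where
  "chain nx p [] \<longleftrightarrow> p = 0"
| "chain nx p (v # vs) \<longleftrightarrow> p = Suc v \<and> chain nx (nx v) vs"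

lemma chain_upd: "v \<notin> set vs \<Longrightarrow> chain (nx(v := y)) p vs \<longleftrightarrow> chain nx p vs"
  by (induction vs arbitrary: p) auto

lemma chain_le: "chain nx p vs \<Longrightarrow> (\<And>v. v \<in> set vs \<Longrightarrow> v < m) \<Longrightarrow> p \<le> m"
  by (cases vs) (auto simp: Suc_le_eq)

lemma bucket_snoc: "bucket key (xs @ [v]) k = (if key v = k then v # bucket key xs k else bucket key xs k)"
  by (simp add: bucket_def)

context ram_instance
begin

definition lower_count :: "(nat \<Rightarrow> nat) \<Rightarrow> nat \<Rightarrow> nat" where
  "lower_count L v = length (filter (\<lambda>w. L w < L v) (adj ! v))"

lemma lower_count_le: "v < n \<Longrightarrow> lower_count L v \<le> n"
proof -
  assume v: "v < n"
  have "lower_count L v \<le> length (adj ! v)" by (simp add: lower_count_def)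
  also have "\<dots> \<le> n"
    using adj_distinct[OF v] adj_set[OF v] by (intro distinct_length_le) (auto simp: nbhd_def)
  finally show ?thesis .
qed

lemma wp_count_body:
  assumes mem: "memory A" and R: "R 0 = n" "R 2 = v" "v < n" and L: "A 4 = L" "\<And>w. L w \<le> n"
    and T: "10 + 8 * length (adj ! v) \<le> T"
    and Q: "\<And>R' T'. R' 0 = n \<Longrightarrow> R' 2 = Suc v \<Longrightarrow> T \<le> T' + (10 + 8 * length (adj ! v)) \<Longrightarrow>
      Q R' (A(5 := (A 5)(v := lower_count L v))) T'"
  shows "wp W count_body Q R A T"
proof -
  define J where "J ys R' A' \<longleftrightarrow> R' 0 = n \<and> R' 2 = v \<and> R' 6 = L v \<and>
    R' 3 = length (filter (\<lambda>w. L w < L v) ys) \<and> A' = A"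
    for ys and R' :: "nat \<Rightarrow> nat" and A' :: "nat \<Rightarrow> nat \<Rightarrow> nat"
  have Wb: "n + 2 \<le> W" using W_large by simp
  obtain T1 where T1: "T = Suc (Suc T1)" using T by (intro that[of "T - 2"]) simp
  have "wp W (for_edges 2 (Seq (Load 7 4 22) (If (Less 7 6) (inc 3) Skip)))
      (wp W (Seq (Store 5 2 3) (inc 2)) Q) (R(3 := 0, 6 := L v)) A T1"
  proof (rule wp_for_edges[where v = v and c = 4 and I = J])
    show "(R(3 := 0, 6 := L v)) 2 = v" "v < n" "memory A" "(2::nat) \<notin> {20, 21, 22, 23}"
      using R mem by simp_all
    show "J [] (R(3 := 0, 6 := L v)) A" using R by (simp add: J_def)
    show "J ys (R'(k := y)) A'" if "k \<in> {20, 21, 22, 23}" "J ys R' A'" for ys R' A' k y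
      using that by (auto simp: J_def)
    show "5 + (4 + 4) * length (adj ! v) \<le> T1" using T T1 by simp
  next
    fix ys w zs R' A' and T' :: nat
    assume e: "adj ! v = ys @ w # zs" and J: "J ys R' A'" and m: "memory A'" and w: "R' 22 = w"
      and "4 \<le> T'"
    then obtain T2 where T2: "T' = Suc (Suc (Suc (Suc T2)))"
      by (intro that[of "T' - 4"]) simp
    have r3: "R' 3 = length (filter (\<lambda>w. L w < L v) ys)" "R' 6 = L v" "A' = A" using J by (simp_all add: J_def)
    show "wp W (Seq (Load 7 4 22) (If (Less 7 6) (inc 3) Skip)) (\<lambda>R'' A'' T''. J (ys @ [w]) R'' A'' \<and>
        memory A'' \<and> R'' 20 = R' 20 \<and> R'' 21 = R' 21 \<and> T' \<le> T'' + 4) R' A' T'"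
    proof (cases "L w < L v")
      case True
      have "J (ys @ [w]) (R'(7 := L w, 23 := Suc 0, 3 := Suc (R' 3))) A'"
        using J True by (simp add: J_def)
      moreover have "Suc (R' 3) \<le> W"
        using lower_count_le[OF R(3), of L] Wb r3 e True by (simp add: lower_count_def)
      moreover have "L w \<le> W" using L(2)[of w] Wb by simp
      ultimately show ?thesis using True r3 L w T2 Wb m by (simp add: wp_simps wp_inc)
    next
      case False
      have "J (ys @ [w]) (R'(7 := L w)) A'" using J False by (simp add: J_def)
      moreover have "L w \<le> W" using L(2)[of w] Wb by simp
      ultimately show ?thesis using False r3 L w T2 Wb m by (simp add: wp_simps)
    qed
  next
    fix R' A' T'
    assume J: "J (adj ! v) R' A'" and t: "T1 \<le> T' + (5 + (4 + 4) * length (adj ! v))"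
    have r: "R' 0 = n" "R' 2 = v" "R' 3 = lower_count L v" "A' = A"
      using J by (simp_all add: J_def lower_count_def)
    obtain T2 where T2: "T' = Suc (Suc (Suc T2))" using t T T1 by (intro that[of "T' - 3"]) simp
    have "Q (R'(23 := Suc 0, 2 := Suc v)) (A(5 := (A 5)(v := lower_count L v))) T2"
      by (rule Q) (use r t T1 T2 in auto)
    moreover have "lower_count L v \<le> W" using lower_count_le[OF R(3), of L] Wb by simp
    ultimately show "wp W (Seq (Store 5 2 3) (inc 2)) Q R' A' T'"
      using r T2 Wb R(3) by (simp add: wp_simps wp_inc)
  qed
  moreover have "L v \<le> W" using L(2)[of v] Wb by simp
  ultimately show ?thesis unfolding count_body_def using R L T1 by (simp add: wp_simps)
qed

lemma wp_count_prog:
  assumes mem: "memory A0" and R: "R 0 = n" and L: "A0 4 = L" "\<And>w. L w \<le> n"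
    and T: "T = 2 + 11 * n + 8 * length (concat adj)"
  shows "wp W count_prog (\<lambda>R A _. R 0 = n \<and> (\<forall>a. a \<noteq> 5 \<longrightarrow> A a = A0 a) \<and>
    (\<forall>v<n. A 5 v = lower_count L v)) R A0 T"
proof -
  \<comment> \<open>11 is the fixed cost 10 of \<open>count_body\<close> plus the loop test; 8 per
    list entry is 4 for the body plus 4 for \<open>for_edges\<close>.\<close>
  define pot where "pot i = (\<Sum>v\<in>{i..<n}. 11 + 8 * length (adj ! v))" for i
  have pot_Suc: "pot i = 11 + 8 * length (adj ! i) + pot (Suc i)" if "i < n" for i
    using that by (simp add: pot_def sum.atLeast_Suc_lessThan)
  have pot0: "pot 0 = 11 * n + 8 * length (concat adj)"
    using sum_degrees verts_eq
    by (simp add: pot_def sum.distrib sum_distrib_left[symmetric] lessThan_atLeast0)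
  let ?I = "\<lambda>R A T. R 0 = n \<and> R 2 \<le> n \<and> (\<forall>a. a \<noteq> 5 \<longrightarrow> A a = A0 a) \<and>
    (\<forall>v<R 2. A 5 v = lower_count L v) \<and> 1 + pot (R 2) \<le> T"
  obtain T1 where T1: "T = Suc T1" using T by (intro that[of "T - 1"]) simp
  have Wb: "n + 2 \<le> W" using W_large by simp
  have "wp W (While (Less 2 0) count_body) (\<lambda>R A _. R 0 = n \<and> (\<forall>a. a \<noteq> 5 \<longrightarrow> A a = A0 a) \<and>
    (\<forall>v<n. A 5 v = lower_count L v)) (R(2 := 0)) A0 T1"
  proof (rule wp_While[where I = ?I])
    show "?I (R(2 := 0)) A0 T1" using R pot0 T T1 by simp
  next
    fix R A T assume I: "?I R A T" and l: "holds (Less 2 0) (R, A)"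
    let ?v = "R 2"
    have v: "?v < n" using I l by simp
    have time: "1 + pot ?v \<le> T" using I by blast
    show "wp W count_body ?I R A (T - 1)"
    proof (rule wp_count_body[where v = ?v and L = L])
      show "memory A" using memory_of[OF mem, of "{5}" A] I by simp
      show "10 + 8 * length (adj ! ?v) \<le> T - 1" using time pot_Suc[OF v] by simp
      show "?I R' (A(5 := (A 5)(?v := lower_count L ?v))) T'"
        if "R' 0 = n" "R' 2 = Suc ?v" "T - 1 \<le> T' + (10 + 8 * length (adj ! ?v))" for R' T'
        using that I v time pot_Suc[OF v] by (auto simp: less_Suc_eq)
    qed (use I v L in auto)
  qed auto
  then show ?thesis unfolding count_prog_def using T1 Wb by (simp add: wp_simps)
qed

text \<open>28 is 10 for filling one element, 9 for writing it out and 9 for passing on to another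
  bucket. The all-zero array \<open>bkt\<close> represents empty buckets.\<close>

lemma wp_sort_prog:
  assumes arrays: "distinct [src, key, bkt, nx, out]"
    and xs: "map (A0 src) [0..<n] = xs" "distinct xs" "set xs = {..<n}"
    and key: "A0 key = K" "\<And>v. v < n \<Longrightarrow> K v \<le> n" and bkt: "A0 bkt = (\<lambda>_. 0)"
    and R: "R 0 = n" and T: "T = 6 + 28 * n"
  shows "wp W (sort_prog src key bkt nx out) (\<lambda>R A _. R 0 = n \<and>
    (\<forall>a. a \<notin> {bkt, nx, out} \<longrightarrow> A a = A0 a) \<and> map (A out) [0..<n] = bucket_sort n K xs) R A0 T"
proof -
  note ne = arrays[simplified]
  have Wb: "n + 2 \<le> W" using W_large by simp
  have len: "length xs = n" using xs(1) by auto
  have xs_nth: "A0 src i = xs ! i" "xs ! i < n" if "i < n" for i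
  proof -
    show "A0 src i = xs ! i" unfolding xs(1)[symmetric] using that by simp
    show "xs ! i < n" using xs(3) nth_mem[of i xs] that len by auto
  qed
  let ?B = "bucket K xs"
  let ?frame = "\<lambda>A. \<forall>a. a \<notin> {bkt, nx, out} \<longrightarrow> A a = A0 a"
  let ?target = "bucket_sort n K xs"
  have target: "set ?target = {..<n}" "length ?target = n"
  proof -
    show s: "set ?target = {..<n}" using set_bucket_sort[of xs K n] xs(3) key(2) by auto
    have "distinct ?target" using xs(2) by (rule distinct_bucket_sort)
    then show "length ?target = n" using distinct_card[of ?target] s by simp
  qed
  let ?Q = "\<lambda>R A T. R 0 = n \<and> ?frame A \<and> map (A out) [0..<n] = ?target"
  have drain: "wp W (While (Less 2 0) (drain_bucket bkt nx out)) ?Q R A T"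
    if "R 0 = n" "R 2 = 0" "R 3 = 0" "R 4 = A bkt 0" "?frame A" "\<And>k. chain (A nx) (A bkt k) (?B k)"
      "1 + 18 * n \<le> T" for R A T
  proof -
    \<comment> \<open>\<open>rest\<close> is the unread part of the current bucket, so output
      written, \<open>rest\<close> and the later buckets always make up the sorted list.\<close>
    let ?I = "\<lambda>R A T. \<exists>rest. chain (A nx) (R 4) rest \<and>
      map (A out) [0..<R 2] @ rest @ concat (map ?B [Suc (R 3)..<Suc n]) = ?target \<and>
      R 3 \<le> n \<and> R 2 \<le> n \<and> R 0 = n \<and> ?frame A \<and> (\<forall>k. chain (A nx) (A bkt k) (?B k)) \<and>
      1 + 9 * (n - R 2) + 9 * (n - R 3) \<le> T"
    have hd_le: "A bkt k \<le> n" if "\<forall>k. chain (A nx) (A bkt k) (?B k)" for A k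
      by (rule chain_le[of "A nx" _ "?B k"]) (use that xs(3) in \<open>auto simp: set_bucket\<close>)
    show ?thesis
    proof (rule wp_While[where I = ?I])
      have "map (A out) [0..<0] @ ?B 0 @ concat (map ?B [Suc 0..<Suc n]) = ?target"
        by (simp add: bucket_sort_def upt_conv_Cons del: upt_Suc)
      then show "?I R A T" using that by (intro exI[of _ "?B 0"]) (simp del: upt_Suc)
    next
      fix R A T assume "?I R A T"
      then show "1 \<le> T" by auto
    next
      fix R A T assume "?I R A T" and l: "holds (Less 2 0) (R, A)"
      then obtain rest where ch: "chain (A nx) (R 4) rest"
        and eq: "map (A out) [0..<R 2] @ rest @ concat (map ?B [Suc (R 3)..<Suc n]) = ?target"
        and I: "R 3 \<le> n" "R 2 \<le> n" "R 0 = n" "?frame A" "\<forall>k. chain (A nx) (A bkt k) (?B k)"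
          "1 + 9 * (n - R 2) + 9 * (n - R 3) \<le> T" by blast
      have less: "R 2 < n" using l I by simp
      have rest: "v < n" if "v \<in> set rest" for v
      proof -
        have "v \<in> set ?target" unfolding eq[symmetric] using that by simp
        then show ?thesis using target by simp
      qed
      obtain T1 where T1: "T = Suc (Suc (Suc (Suc (Suc (Suc (Suc (Suc (Suc T1))))))))"
        using less I by (intro that[of "T - 9"]) simp
      show "wp W (drain_bucket bkt nx out) ?I R A (T - 1)"
      proof (cases rest)
        case Nil
        \<comment> \<open>An exhausted last bucket would mean complete output, but fewer than
          \<open>n\<close> entries have been written. So the scan never leaves the buckets
          \<open>0\<close> to \<open>n\<close>.\<close>
        have k: "R 3 < n"
        proof (rule ccontr)
          assume "\<not> R 3 < n"
          then have "map (A out) [0..<R 2] = ?target" using eq Nil by simp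
          then have "length (map (A out) [0..<R 2]) = n" using target by simp
          then show False using less by simp
        qed
        have "?I (R(7 := 0, 23 := Suc 0, 3 := Suc (R 3), 4 := A bkt (Suc (R 3)))) A
            (Suc (Suc (Suc T1)))"
          using I k less eq Nil T1
          by (intro exI[of _ "?B (Suc (R 3))"]) (simp add: upt_conv_Cons del: upt_Suc)
        moreover have "A bkt (Suc (R 3)) \<le> n" using hd_le I by blast
        ultimately show ?thesis
          unfolding drain_bucket_def using ch Nil T1 k Wb by (simp add: wp_simps wp_inc del: upt_Suc)
      next
        case (Cons v vs)
        have v: "R 4 = Suc v" "v < n" and vs: "chain (A nx) (A nx v) vs" using ch Cons rest by auto
        have "A nx v \<le> n" by (rule chain_le[OF vs]) (use rest Cons in auto)
        moreover have "?I (R(7 := 0, 6 := Suc 0, 5 := v, 4 := A nx v, 23 := Suc 0, 2 := Suc (R 2)))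
            (A(out := (A out)(R 2 := v))) T1"
          using I less eq Cons T1 ne vs by (intro exI[of _ vs]) simp
        ultimately show ?thesis
          unfolding drain_bucket_def using v T1 less Wb ne I(3)
          by (simp add: wp_simps wp_inc del: upt_Suc)
      qed
    next
      fix R A T assume "?I R A T" and l: "\<not> holds (Less 2 0) (R, A)"
      then obtain rest where
        eq: "map (A out) [0..<R 2] @ rest @ concat (map ?B [Suc (R 3)..<Suc n]) = ?target"
        and I: "R 2 \<le> n" "R 0 = n" "?frame A" by blast
      have "R 2 = n" using I l by simp
      then have "length (map (A out) [0..<R 2]) = length ?target" using target by simp
      then have "map (A out) [0..<R 2] = ?target" using eq by (metis append_eq_append_conv append_Nil2)
      then show "?Q R A (T - 1)" using I \<open>R 2 = n\<close> by simp
    qed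
  qed
  have fill: "wp W (While (Less 2 0) (fill_bucket src key bkt nx))
      (\<lambda>R A T. R 0 = n \<and> ?frame A \<and> (\<forall>k. chain (A nx) (A bkt k) (?B k)) \<and> 4 + 18 * n \<le> T) R A0 T"
    if "R 0 = n" "R 2 = 0" "5 + 28 * n \<le> T" for R T
  proof -
    let ?I = "\<lambda>R A T. R 0 = n \<and> R 2 \<le> n \<and> ?frame A \<and>
      (\<forall>k. chain (A nx) (A bkt k) (bucket K (take (R 2) xs) k)) \<and> 5 + 18 * n + 10 * (n - R 2) \<le> T"
    show ?thesis
    proof (rule wp_While[where I = ?I])
      show "?I R A0 T" using that bkt by (simp add: bucket_def)
    next
      fix R A T assume I: "?I R A T" and l: "holds (Less 2 0) (R, A)"
      let ?v = "xs ! R 2"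
      have time: "5 + 18 * n + 10 * (n - R 2) \<le> T" using I by blast
      have less: "R 2 < n" using l I by simp
      note v = xs_nth[OF less]
      have tk: "take (Suc (R 2)) xs = take (R 2) xs @ [?v]" using less len by (simp add: take_Suc_conv_app_nth)
      have vtk: "?v \<notin> set (take (R 2) xs)"
        using xs(2) less len by (auto simp: in_set_conv_nth nth_eq_iff_index_eq)
      have "set (take (R 2) xs) \<subseteq> {..<n}" using xs(3) set_take_subset by fastforce
      then have h: "A bkt k \<le> n" for k
        using I by (intro chain_le[of "A nx" _ "bucket K (take (R 2) xs) k"]) (auto simp: set_bucket)
      obtain T1 where T1: "T = Suc (Suc (Suc (Suc (Suc (Suc (Suc (Suc (Suc (Suc T1)))))))))"
        using less time by (intro that[of "T - 10"]) simp
      have "?I (R(3 := ?v, 4 := K ?v, 5 := A bkt (K ?v), 6 := Suc ?v, 23 := Suc 0, 2 := Suc (R 2)))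
          (A(nx := (A nx)(?v := A bkt (K ?v)), bkt := (A bkt)(K ?v := Suc ?v))) T1"
        using I less T1 ne vtk by (auto simp: tk bucket_snoc chain_upd set_bucket)
      moreover have "A src (R 2) = ?v" "A key ?v = K ?v" "K ?v \<le> n" using I ne v key by auto
      moreover have "A bkt (K ?v) \<le> n" by (rule h)
      ultimately show "wp W (fill_bucket src key bkt nx) ?I R A (T - 1)"
        unfolding fill_bucket_def using T1 v(2) less Wb ne I by (simp add: wp_simps wp_inc)
    next
      fix R A T assume "?I R A T" and "\<not> holds (Less 2 0) (R, A)"
      then show "R 0 = n \<and> ?frame A \<and> (\<forall>k. chain (A nx) (A bkt k) (?B k)) \<and> 4 + 18 * n \<le> T - 1"
        using len by auto
    qed auto
  qed
  obtain T1 where T1: "T = Suc T1" using T by (intro that[of "T - 1"]) simp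
  have "wp W (While (Less 2 0) (fill_bucket src key bkt nx))
      (wp W (Seq (Const 2 0) (Seq (Const 3 0) (Seq (Load 4 bkt 3) (While (Less 2 0) (drain_bucket bkt nx out))))) ?Q)
      (R(2 := 0)) A0 T1"
  proof (rule wp_mono[OF fill])
    fix R :: "nat \<Rightarrow> nat" and A :: "nat \<Rightarrow> nat \<Rightarrow> nat" and T :: nat
    assume h: "R 0 = n \<and> ?frame A \<and> (\<forall>k. chain (A nx) (A bkt k) (?B k)) \<and> 4 + 18 * n \<le> T"
    then have "4 + 18 * n \<le> T" by blast
    then obtain T2 where T2: "T = Suc (Suc (Suc T2))" by (intro that[of "T - 3"]) simp
    have "wp W (While (Less 2 0) (drain_bucket bkt nx out)) ?Q (R(2 := 0, 3 := 0, 4 := A bkt 0)) A T2"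
      by (rule drain) (use h T2 in auto)
    moreover have "A bkt 0 \<le> n"
      by (rule chain_le[of "A nx" _ "?B 0"]) (use h xs(3) in \<open>auto simp: set_bucket\<close>)
    ultimately show "wp W (Seq (Const 2 0) (Seq (Const 3 0) (Seq (Load 4 bkt 3)
        (While (Less 2 0) (drain_bucket bkt nx out))))) ?Q R A T"
      using T2 Wb by (simp add: wp_simps)
  qed (use R T T1 in auto)
  then show ?thesis unfolding sort_prog_def using T1 Wb by (simp add: wp_simps)
qed

end

section \<open>Running the check of an order\<close>

definition probe :: prog where
  "probe = Seq (Load 7 3 22) (Seq (Const 8 0) (If (Neq 7 8)
    (Seq (Load 9 12 22) (Seq (Load 10 13 22) (Seq
      (If (Eq 4 8) (Seq (Copy 5 9) (Copy 6 10))
        (Seq (If (Neq 9 5) (Const 1 0) Skip) (If (Neq 10 6) (Const 1 0) Skip)))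
      (inc 4)))) Skip))"

text \<open>Needs a second pass over the list, since the new name depends on the number of earlier
  neighbours, known only after the first.\<close>

definition update :: prog where
  "update = Seq (Load 7 3 22) (Seq (Const 8 0) (If (Neq 7 8) (Store 12 22 10) Skip))"

definition check_rest :: prog where
  "check_rest = Seq (Load 7 14 5) (Seq (Const 8 1) (Seq (Add 9 3 8)
    (Seq (If (Eq 7 4) (Copy 10 5) (Copy 10 9)) (Seq (for_edges 3 update)
    (Seq (Store 13 3 10) (Seq (Store 14 9 4) (Seq (inc 2) (Store 3 3 2))))))))"

definition check_body :: prog where
  "check_body = Seq (Load 3 11 2) (Seq (Const 4 0) (Seq (Const 5 0) (Seq (Const 6 0)
    (Seq (for_edges 3 probe) check_rest))))"

definition check_prog :: prog where
  "check_prog = Seq (Const 1 1) (Seq (Const 2 0) (While (Less 2 0) check_body))"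

context ram_instance
begin

abbreviation "nb \<equiv> \<lambda>v. adj ! v"

lemma degree_le: "v < n \<Longrightarrow> length (adj ! v) \<le> n"
  using adj_distinct adj_set by (intro distinct_length_le) (auto simp: nbhd_def)

lemma marking_le:
  "set xs \<subseteq> {..<n} \<Longrightarrow> tag (marking nb xs) w \<le> n \<and> rep (marking nb xs) w \<le> n \<and> siz (marking nb xs) w \<le> n"
proof (induction xs arbitrary: w)
  case (Cons v xs)
  have "v < n" using Cons.prems by simp
  moreover have "length (filter (\<lambda>w. w \<in> set xs) (adj ! v)) \<le> n"
    using degree_le[OF \<open>v < n\<close>] length_filter_le order_trans by blast
  ultimately show ?case
    using Cons.IH Cons.prems by (auto simp: mark_def Let_def)
qed simp

text \<open>Array 3 doubles as the membership test for \<open>S\<close>: positions start at 1, so 0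
  means not yet placed. Register 4 counts the earlier neighbours met, and 5 and 6 keep the marks of
  the first of them, with which later ones are compared.\<close>

lemma wp_probe:
  assumes e: "v < n" "adj ! v = ys @ w # zs" and m: "tag m w \<le> n" "rep m w \<le> n"
    and A: "A 12 = tag m" "A 13 = rep m" "\<And>u. A 3 u \<noteq> 0 \<longleftrightarrow> u \<in> S" "\<And>u. A 3 u \<le> n"
    and R: "R 22 = w" "ms = filter (\<lambda>w. w \<in> S) ys" "R 4 = length ms"
      "R 5 = (if ms = [] then 0 else tag m (hd ms))" "R 6 = (if ms = [] then 0 else rep m (hd ms))"
      "R 1 = of_bool (ok \<and> (\<forall>w\<in>set ms. tag m w = R 5 \<and> rep m w = R 6))"
    and T: "12 \<le> T"
    and Q: "\<And>R' T'. ms' = filter (\<lambda>w. w \<in> S) (ys @ [w]) \<Longrightarrow> R' 4 = length ms' \<Longrightarrow>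
      R' 5 = (if ms' = [] then 0 else tag m (hd ms')) \<Longrightarrow> R' 6 = (if ms' = [] then 0 else rep m (hd ms')) \<Longrightarrow>
      R' 1 = of_bool (ok \<and> (\<forall>w\<in>set ms'. tag m w = R' 5 \<and> rep m w = R' 6)) \<Longrightarrow>
      (\<And>k. k \<in> {0, 2, 3, 20, 21} \<Longrightarrow> R' k = R k) \<Longrightarrow> T \<le> T' + 12 \<Longrightarrow> Q R' A T'"
    and ms': "ms' = filter (\<lambda>w. w \<in> S) (ys @ [w])"
  shows "wp W probe Q R A T"
proof -
  have Wb: "n + 2 \<le> W" using W_large by simp
  have len: "length ms' \<le> n"
  proof -
    have "length ms' \<le> length (ys @ [w])" unfolding ms' by (rule length_filter_le)
    also have "\<dots> \<le> length (adj ! v)" using e by simp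
    finally show ?thesis using degree_le[OF e(1)] by simp
  qed
  obtain T1 where T1: "T = Suc (Suc (Suc (Suc (Suc (Suc (Suc (Suc (Suc (Suc (Suc (Suc T1)))))))))))"
    using T by (intro that[of "T - 12"]) simp
  show ?thesis
  proof (cases "w \<in> S")
    case False
    then have "ms' = ms" by (simp add: ms' R)
    moreover have "A 3 w = 0" using A(3) False by blast
    ultimately show ?thesis unfolding probe_def using R T1 Wb by (auto simp: wp_simps intro!: Q[OF ms'])
  next
    case True
    then have m': "ms' = ms @ [w]" by (simp add: ms' R)
    have pos: "0 < A 3 w" "A 3 w \<le> W" using A(3)[of w] A(4)[of w] True Wb by auto
    have b: "tag m w \<le> W" "rep m w \<le> W" "Suc (length ms) \<le> W" using m len m' Wb by simp_all
    show ?thesis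
    proof (cases "ms = []")
      case True
      then show ?thesis
        unfolding probe_def using R(1,3-6) A m' pos b T1 Wb
        by (auto simp: wp_simps wp_inc intro!: Q[OF ms'])
    next
      case False
      then show ?thesis
        unfolding probe_def using R(1,3-6) A m' pos b T1 Wb
        by (auto simp: wp_simps wp_inc intro!: Q[OF ms'])
    qed
  qed
qed

text \<open>24 per list entry is 12 + 4 for the pass with \<open>probe\<close> and 4 + 4 for the
  pass with \<open>update\<close>.\<close>

lemma wp_check_body:
  assumes mem: "memory A" and R: "R 0 = n" "R 2 = i" "i < n" "R 1 = of_bool (good m)"
    and A: "A 11 i = v" "v < n" "A 12 = tag m" "A 13 = rep m" "A 14 = siz m"
      "\<And>u. A 3 u \<noteq> 0 \<longleftrightarrow> u \<in> S" "\<And>u. A 3 u \<le> n"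
    and m: "\<And>w. tag m w \<le> n" "\<And>w. rep m w \<le> n" "\<And>w. siz m w \<le> n"
    and T: "24 + 24 * length (adj ! v) \<le> T"
    and m': "m' = mark nb S v m"
    and Q: "\<And>R' T'. R' 0 = n \<Longrightarrow> R' 2 = Suc i \<Longrightarrow> R' 1 = of_bool (good m') \<Longrightarrow>
      T \<le> T' + (24 + 24 * length (adj ! v)) \<Longrightarrow>
      Q R' (A(12 := tag m', 13 := rep m', 14 := siz m', 3 := (A 3)(v := Suc i))) T'"
  shows "wp W check_body Q R A T"
proof -
  have Wb: "n + 2 \<le> W" using W_large by simp
  define ms where "ms = filter (\<lambda>w. w \<in> S) (adj ! v)"
  define g where "g = (if ms = [] then 0 else tag m (hd ms))"
  define h where "h = (if ms = [] then 0 else rep m (hd ms))"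
  define r where "r = (if siz m g = length ms then g else Suc v)"
  have m'_eq: "tag m' = (\<lambda>w. if w \<in> set ms then r else tag m w)" "rep m' = (rep m)(v := r)"
    "siz m' = (siz m)(Suc v := length ms)"
    "good m' \<longleftrightarrow> good m \<and> (\<forall>w\<in>set ms. tag m w = g \<and> rep m w = h)"
    unfolding m' mark_def Let_def ms_def[symmetric] g_def[symmetric] h_def[symmetric] r_def[symmetric]
    by simp_all
  have len: "length ms \<le> n"
    unfolding ms_def using degree_le[OF A(2)] length_filter_le order_trans by blast
  have gn: "g \<le> n" "r \<le> n" using m A(2) by (auto simp: g_def r_def)
  define J where "J ys R' A' \<longleftrightarrow> R' 0 = n \<and> R' 2 = i \<and> R' 3 = v \<and>
    R' 4 = length (filter (\<lambda>w. w \<in> S) ys) \<and>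
    R' 5 = (if filter (\<lambda>w. w \<in> S) ys = [] then 0 else tag m (hd (filter (\<lambda>w. w \<in> S) ys))) \<and>
    R' 6 = (if filter (\<lambda>w. w \<in> S) ys = [] then 0 else rep m (hd (filter (\<lambda>w. w \<in> S) ys))) \<and>
    R' 1 = of_bool (good m \<and> (\<forall>w\<in>set (filter (\<lambda>w. w \<in> S) ys). tag m w = R' 5 \<and> rep m w = R' 6)) \<and>
    A' = A" for ys and R' :: "nat \<Rightarrow> nat" and A' :: "nat \<Rightarrow> nat \<Rightarrow> nat"
  define K where "K ys R' A' \<longleftrightarrow> R' 0 = n \<and> R' 2 = i \<and> R' 3 = v \<and> R' 4 = length ms \<and> R' 9 = Suc v \<and>
    R' 10 = r \<and> R' 1 = of_bool (good m') \<and>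
    A' = A(12 := \<lambda>w. if w \<in> S \<and> w \<in> set ys then r else tag m w)"
    for ys and R' :: "nat \<Rightarrow> nat" and A' :: "nat \<Rightarrow> nat \<Rightarrow> nat"
  have upd: "wp W (for_edges 3 update) (wp W (Seq (Store 13 3 10) (Seq (Store 14 9 4) (Seq (inc 2) (Store 3 3 2)))) Q)
      R1 A T1" if R1: "K [] R1 A" and T1: "T \<le> T1 + (14 + 16 * length (adj ! v))" for R1 T1
  proof (rule wp_for_edges[where v = v and c = 4 and I = K])
    show "R1 3 = v" "v < n" "memory A" "(3::nat) \<notin> {20, 21, 22, 23}" "K [] R1 A"
      using R1 A mem by (simp_all add: K_def)
    show "K ys (R'(k := y)) A'" if "k \<in> {20, 21, 22, 23}" "K ys R' A'" for ys R' A' k y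
      using that by (auto simp: K_def)
    show "5 + (4 + 4) * length (adj ! v) \<le> T1" using T T1 by simp
  next
    fix ys w zs R' A' and T' :: nat
    assume e: "adj ! v = ys @ w # zs" and J: "K ys R' A'" and mA: "memory A'" and w: "R' 22 = w"
      and "4 \<le> T'"
    then obtain T2 where T2: "T' = Suc (Suc (Suc (Suc T2)))"
      by (intro that[of "T' - 4"]) simp
    have A3: "A' 3 = A 3" "R' 10 = r" using J by (auto simp: K_def)
    have "A 3 w \<le> W" "r \<le> W" using A(7)[of w] gn Wb by auto
    show "wp W update (\<lambda>R'' A'' T''. K (ys @ [w]) R'' A'' \<and> memory A'' \<and> R'' 20 = R' 20 \<and>
        R'' 21 = R' 21 \<and> T' \<le> T'' + 4) R' A' T'"
    proof (cases "w \<in> S")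
      case True
      then have "0 < A 3 w" using A(6) by auto
      moreover have "K (ys @ [w]) (R'(7 := A 3 w, 8 := 0)) (A'(12 := (A' 12)(w := r)))"
        using J True by (auto simp: K_def fun_eq_iff)
      ultimately show ?thesis
        unfolding update_def using A3 w T2 mA \<open>A 3 w \<le> W\<close> \<open>r \<le> W\<close> by (simp add: wp_simps)
    next
      case False
      then have "A 3 w = 0" using A(6)[of w] by auto
      moreover have "K (ys @ [w]) (R'(7 := 0, 8 := 0)) A'"
        using J False by (auto simp: K_def fun_eq_iff)
      ultimately show ?thesis
        unfolding update_def using A3 w T2 mA by (simp add: wp_simps)
    qed
  next
    fix R' A' T'
    assume J: "K (adj ! v) R' A'" and t: "T1 \<le> T' + (5 + (4 + 4) * length (adj ! v))"
    have r': "R' 0 = n" "R' 2 = i" "R' 3 = v" "R' 4 = length ms" "R' 9 = Suc v" "R' 10 = r"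
      "R' 1 = of_bool (good m')" "A' = A(12 := tag m')"
      using J by (simp_all add: K_def m'_eq ms_def conj_commute)
    obtain T2 where T2: "T' = Suc (Suc (Suc (Suc (Suc T2))))"
      using t T T1 by (intro that[of "T' - 5"]) simp
    have "Q (R'(23 := Suc 0, 2 := Suc i))
        (A(12 := tag m', 13 := rep m', 14 := siz m', 3 := (A 3)(v := Suc i))) T2"
      by (rule Q) (use r' t T1 T2 in auto)
    then show "wp W (Seq (Store 13 3 10) (Seq (Store 14 9 4) (Seq (inc 2) (Store 3 3 2)))) Q R' A' T'"
      using r' T2 Wb R(3) gn len A(4,5) by (simp add: wp_simps wp_inc m'_eq)
  qed
  have rest: "wp W check_rest Q R1 A T1"
    if R1: "J (adj ! v) R1 A" and T1: "T \<le> T1 + (9 + 16 * length (adj ! v))" for R1 T1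
  proof -
    have r1: "R1 0 = n" "R1 2 = i" "R1 3 = v" "R1 4 = length ms" "R1 5 = g" "R1 1 = of_bool (good m')"
      using R1[unfolded J_def, folded ms_def, folded g_def h_def] by (auto simp: m'_eq)
    obtain T2 where T2: "T1 = Suc (Suc (Suc (Suc (Suc T2))))"
      using T1 T by (intro that[of "T1 - 5"]) simp
    have t2: "T \<le> T2 + (14 + 16 * length (adj ! v))" using T1 T2 by simp
    have A12: "A(12 := tag m) = A" using A(3) by (rule fun_upd_idem)
    have "siz m g \<le> W" using m(3)[of g] Wb by simp
    then show ?thesis
      unfolding check_rest_def using r1 T2 A(2,5) gn Wb m(3)[of g]
      by (auto simp: wp_simps K_def r_def A12 intro!: upd t2)
  qed
  obtain T1 where T1: "T = Suc (Suc (Suc (Suc T1)))" using T by (intro that[of "T - 4"]) simp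
  have "wp W (for_edges 3 probe) (wp W check_rest Q) (R(3 := v, 4 := 0, 5 := 0, 6 := 0)) A T1"
  proof (rule wp_for_edges[where v = v and c = 12 and I = J])
    show "(R(3 := v, 4 := 0, 5 := 0, 6 := 0)) 3 = v" "v < n" "memory A" "(3::nat) \<notin> {20, 21, 22, 23}"
      using A mem by simp_all
    show "J [] (R(3 := v, 4 := 0, 5 := 0, 6 := 0)) A" using R by (simp add: J_def)
    show "J ys (R'(k := y)) A'" if "k \<in> {20, 21, 22, 23}" "J ys R' A'" for ys R' A' k y
    proof -
      have ne: "0 \<noteq> k" "1 \<noteq> k" "2 \<noteq> k" "3 \<noteq> k" "4 \<noteq> k" "5 \<noteq> k" "6 \<noteq> k" using that(1) by auto
      show ?thesis using that(2) unfolding J_def by (simp only: fun_upd_apply ne if_False)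
    qed
    show "5 + (12 + 4) * length (adj ! v) \<le> T1" using T T1 by simp
  next
    fix ys w zs R' A' and T' :: nat
    assume e: "adj ! v = ys @ w # zs" and J: "J ys R' A'" and mA: "memory A'" and w: "R' 22 = w"
      and T': "12 \<le> T'"
    have A': "A' = A" and j: "R' 0 = n" "R' 2 = i" "R' 3 = v" using J unfolding J_def by blast+
    show "wp W probe (\<lambda>R'' A'' T''. J (ys @ [w]) R'' A'' \<and> memory A'' \<and> R'' 20 = R' 20 \<and>
        R'' 21 = R' 21 \<and> T' \<le> T'' + 12) R' A' T'"
      unfolding A'
    proof (rule wp_probe[where v = v and ys = ys and w = w and zs = zs and m = m and S = S and ok = "good m" and
          ms = "filter (\<lambda>w. w \<in> S) ys" and ms' = "filter (\<lambda>w. w \<in> S) (ys @ [w])"])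
      fix R'' T''
      assume "R'' 4 = length (filter (\<lambda>w. w \<in> S) (ys @ [w]))"
        "R'' 5 = (if filter (\<lambda>w. w \<in> S) (ys @ [w]) = [] then 0 else tag m (hd (filter (\<lambda>w. w \<in> S) (ys @ [w]))))"
        "R'' 6 = (if filter (\<lambda>w. w \<in> S) (ys @ [w]) = [] then 0 else rep m (hd (filter (\<lambda>w. w \<in> S) (ys @ [w]))))"
        "R'' 1 = of_bool (good m \<and> (\<forall>w\<in>set (filter (\<lambda>w. w \<in> S) (ys @ [w])). tag m w = R'' 5 \<and> rep m w = R'' 6))"
        and fr: "\<And>k. k \<in> {0, 2, 3, 20, 21} \<Longrightarrow> R'' k = R' k" and "T' \<le> T'' + 12"
      then show "J (ys @ [w]) R'' A \<and> memory A \<and> R'' 20 = R' 20 \<and> R'' 21 = R' 21 \<and> T' \<le> T'' + 12"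
        using j mem fr[of 0] fr[of 2] fr[of 3] fr[of 20] fr[of 21] unfolding J_def
        by (intro conjI refl; (assumption | simp only: insert_iff simp_thms))
    qed (rule A e m w T' refl | (use J in \<open>unfold J_def, blast\<close>))+
  next
    fix R' A' T'
    assume J: "J (adj ! v) R' A'" and t: "T1 \<le> T' + (5 + (12 + 4) * length (adj ! v))"
    have "A' = A" using J unfolding J_def by blast
    then show "wp W check_rest Q R' A' T'" using rest[of R' T'] J t T1 by simp
  qed
  then show ?thesis unfolding check_body_def using R A T1 Wb by (simp add: wp_simps)
qed

lemma wp_check_prog:
  assumes mem: "memory A0" and R: "R 0 = n" and xs: "map (A0 11) [0..<n] = xs" "distinct xs" "set xs = {..<n}"
    and zero: "A0 3 = (\<lambda>_. 0)" "A0 12 = (\<lambda>_. 0)" "A0 13 = (\<lambda>_. 0)" "A0 14 = (\<lambda>_. 0)"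
    and T: "T = 3 + 25 * n + 24 * length (concat adj)"
  shows "wp W check_prog (\<lambda>R A _. R 1 = of_bool (good (marking nb (rev xs))) \<and>
    (\<forall>i<n. A 3 (xs ! i) = Suc i)) R A0 T"
proof -
  define pot where "pot i = (\<Sum>v\<leftarrow>drop i xs. 25 + 24 * length (adj ! v))" for i
  have len: "length xs = n" using xs(1) by auto
  have pot_Suc: "pot i = 25 + 24 * length (adj ! (xs ! i)) + pot (Suc i)" if "i < n" for i
    using that len Cons_nth_drop_Suc[of i xs] by (simp add: pot_def flip: Cons_nth_drop_Suc)
  have pot0: "pot 0 = 25 * n + 24 * length (concat adj)"
  proof -
    have "pot 0 = (\<Sum>v\<in>verts G. 25 + 24 * length (adj ! v))"
      using sum.distinct_set_conv_list[OF xs(2), of "\<lambda>v. 25 + 24 * length (adj ! v)"] xs(3) verts_eq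
      by (simp add: pot_def)
    then show ?thesis by (simp add: sum.distrib sum_distrib_left[symmetric] sum_degrees card_verts)
  qed
  have Wb: "n + 2 \<le> W" using W_large by simp
  let ?m = "\<lambda>i. marking nb (rev (take i xs))"
  let ?I = "\<lambda>R A T. R 0 = n \<and> R 2 \<le> n \<and> R 1 = of_bool (good (?m (R 2))) \<and> A 12 = tag (?m (R 2)) \<and>
    A 13 = rep (?m (R 2)) \<and> A 14 = siz (?m (R 2)) \<and> (\<forall>a. a \<notin> {3, 12, 13, 14} \<longrightarrow> A a = A0 a) \<and>
    (\<forall>i<R 2. A 3 (xs ! i) = Suc i) \<and> (\<forall>u. u \<notin> set (take (R 2) xs) \<longrightarrow> A 3 u = 0) \<and> 1 + pot (R 2) \<le> T"
  obtain T1 where T1: "T = Suc (Suc T1)" using T by (intro that[of "T - 2"]) simp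
  have "wp W (While (Less 2 0) check_body) (\<lambda>R A _. R 1 = of_bool (good (marking nb (rev xs))) \<and>
    (\<forall>i<n. A 3 (xs ! i) = Suc i)) (R(1 := 1, 2 := 0)) A0 T1"
  proof (rule wp_While[where I = ?I])
    show "?I (R(1 := 1, 2 := 0)) A0 T1" using R zero pot0 T T1 by simp
  next
    fix R A T assume I: "?I R A T" and l: "holds (Less 2 0) (R, A)"
    define i where "i = R 2"
    let ?v = "xs ! i"
    note I' = I[folded i_def]
    have i: "i < n" using I' l by (simp add: i_def)
    have time: "1 + pot i \<le> T" using I' by blast
    have v: "?v < n" using xs(3) i len nth_mem[of i xs] by auto
    have tk: "take (Suc i) xs = take i xs @ [?v]" using i len by (simp add: take_Suc_conv_app_nth)
    have sub: "set (rev (take i xs)) \<subseteq> {..<n}" using xs(3) set_take_subset by fastforce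
    have mSuc: "?m (Suc i) = mark nb (set (take i xs)) ?v (?m i)" by (simp add: tk)
    have pos: "A 3 u \<noteq> 0 \<longleftrightarrow> u \<in> set (take i xs)" "A 3 u \<le> n" for u
    proof -
      have "A 3 u \<noteq> 0 \<and> A 3 u \<le> n" if u: "u \<in> set (take i xs)"
      proof -
        obtain j where j: "j < i" "u = xs ! j" using u i len by (auto simp: in_set_conv_nth)
        then have "A 3 u = Suc j" using I' by blast
        then show ?thesis using j i by simp
      qed
      moreover have "A 3 u = 0" if "u \<notin> set (take i xs)" using I' that by blast
      ultimately show "A 3 u \<noteq> 0 \<longleftrightarrow> u \<in> set (take i xs)" "A 3 u \<le> n" by (metis, metis le0)
    qed
    show "wp W check_body ?I R A (T - 1)"
    proof (rule wp_check_body[where v = ?v and i = i and m = "?m i" and S = "set (take i xs)" and m' = "?m (Suc i)"])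
      show "memory A" using memory_of[OF mem, of "{3, 12, 13, 14}" A] I by simp
      have "A 11 = A0 11" using I by simp
      then show "A 11 i = ?v" unfolding xs(1)[symmetric] using i by simp
      show "24 + 24 * length (adj ! ?v) \<le> T - 1" using time pot_Suc[OF i] by simp
      show "tag (?m i) w \<le> n" "rep (?m i) w \<le> n" "siz (?m i) w \<le> n" for w
        using marking_le[OF sub] by blast+
      show "?I R' (A(12 := tag (?m (Suc i)), 13 := rep (?m (Suc i)), 14 := siz (?m (Suc i)),
          3 := (A 3)(?v := Suc i))) T'"
        if "R' 0 = n" "R' 2 = Suc i" "R' 1 = of_bool (good (?m (Suc i)))"
          "T - 1 \<le> T' + (24 + 24 * length (adj ! ?v))" for R' T'
      proof -
        have "((A 3)(?v := Suc i)) (xs ! j) = Suc j" if "j < Suc i" for j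
          using that I' i len xs(2) by (auto simp: less_Suc_eq nth_eq_iff_index_eq)
        moreover have "((A 3)(?v := Suc i)) u = 0" if "u \<notin> set (take (Suc i) xs)" for u
          using that I' by (simp add: tk)
        ultimately show ?thesis
          using that I' i time pot_Suc[OF i] by auto
      qed
    qed (use I' i i_def v pos mSuc in auto)
  next
    fix R A T assume I: "?I R A T" and "\<not> holds (Less 2 0) (R, A)"
    then have "R 2 = n" by simp
    then show "R 1 = of_bool (good (marking nb (rev xs))) \<and> (\<forall>i<n. A 3 (xs ! i) = Suc i)"
      using I len by simp
  qed auto
  then show ?thesis unfolding check_prog_def using T1 Wb by (simp add: wp_simps)
qed

end

section \<open>Composition of the programs, correctness and total running time\<close>

lemma wp_trans:
  assumes "wp W p (\<lambda>R A _. P R A) R A T1"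
    and "\<And>R A. P R A \<Longrightarrow> wp W q (\<lambda>R A _. Q R A) R A T2"
  shows "wp W (Seq p q) (\<lambda>R A _. Q R A) R A (T1 + T2)"
proof -
  obtain t R1 A1 where 1: "exec W p (R, A) t (R1, A1)" "t \<le> T1" "P R1 A1"
    using assms(1) by (rule wpE)
  obtain t' R2 A2 where 2: "exec W q (R1, A1) t' (R2, A2)" "t' \<le> T2" "Q R2 A2"
    using assms(2)[OF 1(3)] by (rule wpE)
  show ?thesis by (rule wpI[OF exec.Seq[OF 1(1) 2(1)]]) (use 1 2 in auto)
qed

text \<open>As in radix sort, the less significant key, the count in array 5, is sorted first and
  the level in array 4 second. Each sort works on arrays that are still zero.\<close>

definition rest_prog :: prog where
  "rest_prog = Seq count_prog (Seq (sort_prog 2 5 6 7 8) (Seq (sort_prog 8 4 9 10 11) check_prog))"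

context ram_instance
begin

lemma adj_adjacent: "v \<in> verts G \<Longrightarrow> distinct (adj ! v) \<and> set (adj ! v) = {w \<in> verts G. adjacent G v w}"
  using adj_distinct[of v] adj_set[of v] nbhd_adjacent[of G v] verts_eq by simp

text \<open>Handshake count: list entries are ordered adjacent pairs, and at most two of them belong
  to one edge.\<close>

lemma length_concat_le: "length (concat adj) \<le> 2 * card (edges G)"
proof -
  have fin: "finite (edges G)"
  proof (rule finite_subset)
    show "edges G \<subseteq> Pow (verts G)" using G by (auto simp: simple_graph_def)
  qed (simp add: finite_verts)
  let ?P = "\<lambda>e. {(a, b). {a, b} = (e :: nat set)}"
  have P: "finite (?P e) \<and> card (?P e) \<le> 2" if "e \<in> edges G" for e
  proof -
    have "card e = 2" using that G by (simp add: simple_graph_def)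
    then obtain a b where "e = {a, b}" by (meson card_2_iff)
    then have sub: "?P e \<subseteq> {(a, b), (b, a)}" by (auto simp: doubleton_eq_iff)
    then have "finite (?P e)" by (rule finite_subset) simp
    moreover have "card (?P e) \<le> card {(a, b), (b, a)}" using sub by (rule card_mono[rotated]) simp
    moreover have "card {(a, b), (b, a)} \<le> 2" using card_insert_le_m1[of 2 "{(b, a)}" "(a, b)"] by simp
    ultimately show ?thesis by linarith
  qed
  have "length (concat adj) = (\<Sum>v\<in>verts G. card (nbhd G v))"
    unfolding sum_degrees[symmetric]
  proof (intro sum.cong refl)
    fix v assume "v \<in> verts G"
    then show "length (adj ! v) = card (nbhd G v)"
      using distinct_card[OF adj_distinct, of v] adj_set[of v] verts_eq by simp
  qed
  also have "\<dots> = card (SIGMA v:verts G. nbhd G v)"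
    by (rule card_SigmaI[symmetric]) (use finite_verts in \<open>auto simp: nbhd_def\<close>)
  also have "\<dots> \<le> card (\<Union>e\<in>edges G. ?P e)"
    by (rule card_mono) (use fin P in \<open>auto simp: nbhd_def\<close>)
  also have "\<dots> \<le> (\<Sum>e\<in>edges G. card (?P e))" using fin by (rule card_UN_le)
  also have "\<dots> \<le> 2 * card (edges G)" using sum_bounded_above[of "edges G" "\<lambda>e. card (?P e)" 2] P by simp
  finally show ?thesis .
qed

text \<open>A passed check certifies this very order. Conversely, the levels acquire their structure
  only from the assumption that some sequence exists, so \<open>levelled\<close> is available just
  in that direction.\<close>

lemma good_iff_composed:
  assumes st: "bfs_state G ds [] L rt" "set ds = verts G"
    and K: "\<And>v. v < n \<Longrightarrow> K v = lower_count L v" and xs: "xs = bucket_sort n L (bucket_sort n K ds)"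
    and \<phi>: "\<And>i. i < n \<Longrightarrow> \<phi> (xs ! i) = Suc i"
  shows "good (marking nb (rev xs)) \<longleftrightarrow> indep_module_composed G"
    and "indep_module_composed G \<Longrightarrow> indep_module_seq G \<phi>"
proof -
  note d = bfs_stateD[OF st(1)]
  let ?ys = "bucket_sort n K ds"
  have ys: "set ?ys = verts G" "distinct ?ys"
    using set_bucket_sort[of ds K n] distinct_bucket_sort[of ds n K] d(1) st(2) K lower_count_le verts_eq by auto
  have xs': "set xs = verts G" "distinct xs"
    using set_bucket_sort[of ?ys L n] distinct_bucket_sort[of ?ys n L] d(4) ys xs by auto
  have len: "length xs = n" using distinct_card[OF xs'(2)] xs'(1) card_verts by simp
  have seq: "indep_module_seq G \<phi> \<longleftrightarrow> built (adjacent G) (rev xs)"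
    using indep_module_seq_iff_built[OF G xs'(2,1)] \<phi> len by simp
  have sound: "indep_module_seq G \<phi>" if "good (marking nb (rev xs))"
    unfolding seq
    using good_marking_imp_built[OF sgraph_adjacent[OF G], of "rev xs" "verts G" nb] xs' adj_adjacent that
    by simp
  have complete: "good (marking nb (rev xs))" if imc: "indep_module_composed G"
  proof -
    have lev: "levelled (adjacent G) (verts G) L rt"
      by (rule bfs_state_levelled[OF G indep_module_composed_imp_composed[OF G imc] st])
    interpret levelled "adjacent G" "verts G" L rt by (rule lev)
    have low: "K v = card (lower v)" if "v \<in> verts G" for v
    proof -
      have "lower v = set (filter (\<lambda>w. L w < L v) (adj ! v))"
        using adj_adjacent[OF that] by (auto simp: lower_def)
      then show ?thesis
        using K[of v] that adj_adjacent[OF that] verts_eq distinct_card[of "filter (\<lambda>w. L w < L v) (adj ! v)"]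
        by (simp add: lower_count_def)
    qed
    \<comment> \<open>The trivial relation on the search order leaves a lexicographic comparison of
      level and count alone after the two sorts, which is what \<open>newer\<close>
      compares.\<close>
    have "sorted_wrt (\<lambda>_ _. True) ds" by (induction ds) auto
    then have "sorted_wrt (\<lambda>a b. L a < L b \<or> L a = L b \<and> (K b < K a \<or> K b = K a \<and> True)) xs"
      unfolding xs by (intro sorted_wrt_bucket_sort)
    then have "sorted_wrt (\<lambda>a b. newer b a) xs"
      by (rule sorted_wrt_mono_rel[rotated]) (use xs'(1) low in \<open>auto simp: newer_def\<close>)
    then have "sorted_wrt newer (rev xs)" by (simp add: sorted_wrt_rev)
    then show ?thesis
      using sorted_imp_good_marking[OF lev, of "rev xs" nb] xs' adj_adjacent by simp
  qed
  show "good (marking nb (rev xs)) \<longleftrightarrow> indep_module_composed G"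
    using sound complete by (auto simp: indep_module_composed_def)
  show "indep_module_composed G \<Longrightarrow> indep_module_seq G \<phi>"
    using sound complete by blast
qed

lemma wp_rest_prog:
  assumes A0: "memory A0" "\<And>a. 2 \<le> a \<Longrightarrow> A0 a = (\<lambda>_. 0)" and post: "bfs_post A0 R A"
  shows "wp W rest_prog (\<lambda>R A _. correct_output G (R, A)) R A (17 + 92 * n + 32 * length (concat adj))"
proof -
  define L where "L = A 4"
  define ds where "ds = map (A 2) [0..<n]"
  obtain rt where R: "R 0 = n" and A: "\<And>a. a \<notin> {2, 4} \<Longrightarrow> A a = A0 a"
    and st: "bfs_state G ds [] L rt" and ds: "set ds = verts G"
    using post unfolding bfs_post_def ds_def L_def by blast
  note d = bfs_stateD[OF st]
  have mem: "memory A" using memory_of[OF A0(1), of "{2, 4}" A] A by simp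
  have dist: "distinct ds" using d(1) by simp
  have "wp W rest_prog (\<lambda>R A _. correct_output G (R, A)) R A
    ((2 + 11 * n + 8 * length (concat adj)) + ((6 + 28 * n) + ((6 + 28 * n) + (3 + 25 * n + 24 * length (concat adj)))))"
    unfolding rest_prog_def
  proof (rule wp_trans[OF wp_count_prog[where L = L]])
    fix R1 :: "nat \<Rightarrow> nat" and A1 :: "nat \<Rightarrow> nat \<Rightarrow> nat"
    assume 1: "R1 0 = n \<and> (\<forall>a. a \<noteq> 5 \<longrightarrow> A1 a = A a) \<and> (\<forall>v<n. A1 5 v = lower_count L v)"
    define K where "K = A1 5"
    have K: "K v = lower_count L v" "K v \<le> n" if "v < n" for v
      using 1 that lower_count_le[OF that, of L] by (simp_all add: K_def)
    have A1: "A1 a = A a" if "a \<noteq> 5" for a using 1 that by blast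
    have R1: "R1 0 = n" using 1 by blast
    let ?ys = "bucket_sort n K ds"
    have ys: "set ?ys = {..<n}" "distinct ?ys"
      using set_bucket_sort[of ds K n] distinct_bucket_sort[OF dist, of n K] ds K(2) verts_eq by auto
    have xs: "set (bucket_sort n L ?ys) = {..<n}" "distinct (bucket_sort n L ?ys)"
      using set_bucket_sort[of ?ys L n] distinct_bucket_sort[OF ys(2), of n L] ys d(4) by auto
    show "wp W (Seq (sort_prog 2 5 6 7 8) (Seq (sort_prog 8 4 9 10 11) check_prog))
      (\<lambda>R A _. correct_output G (R, A)) R1 A1 ((6 + 28 * n) + ((6 + 28 * n) + (3 + 25 * n + 24 * length (concat adj))))"
    proof (rule wp_trans[OF wp_sort_prog[where K = K and xs = ds]])
      show "map (A1 2) [0..<n] = ds" using A1[of 2] by (simp add: ds_def)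
      show "A1 6 = (\<lambda>_. 0)" using A1[of 6] A[of 6] A0(2)[of 6] by simp
    next
      fix R2 :: "nat \<Rightarrow> nat" and A2 :: "nat \<Rightarrow> nat \<Rightarrow> nat"
      assume 2: "R2 0 = n \<and> (\<forall>a. a \<notin> {6, 7, 8} \<longrightarrow> A2 a = A1 a) \<and> map (A2 8) [0..<n] = ?ys"
      have R2: "R2 0 = n" using 2 by blast
      have A2: "A2 a = A1 a" if "a \<notin> {6, 7, 8}" for a using 2 that by blast
      show "wp W (Seq (sort_prog 8 4 9 10 11) check_prog)
        (\<lambda>R A _. correct_output G (R, A)) R2 A2 ((6 + 28 * n) + (3 + 25 * n + 24 * length (concat adj)))"
      proof (rule wp_trans[OF wp_sort_prog[where K = L and xs = ?ys]])
        show "map (A2 8) [0..<n] = ?ys" using 2 by blast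
        show "A2 4 = L" using A2[of 4] A1[of 4] by (simp add: L_def)
        show "A2 9 = (\<lambda>_. 0)" using A2[of 9] A1[of 9] A[of 9] A0(2)[of 9] by simp
      next
        fix R3 :: "nat \<Rightarrow> nat" and A3 :: "nat \<Rightarrow> nat \<Rightarrow> nat"
        assume 3: "R3 0 = n \<and> (\<forall>a. a \<notin> {9, 10, 11} \<longrightarrow> A3 a = A2 a) \<and>
          map (A3 11) [0..<n] = bucket_sort n L ?ys"
        have R3: "R3 0 = n" "map (A3 11) [0..<n] = bucket_sort n L ?ys" using 3 by blast+
        have A3: "A3 a = A2 a" if "a \<notin> {9, 10, 11}" for a using 3 that by blast
        have A3A0: "A3 a = A0 a" if "a \<notin> {2, 4, 5, 6, 7, 8, 9, 10, 11}" for a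
          using that A3[of a] A2[of a] A1[of a] A[of a] by simp
        show "wp W check_prog (\<lambda>R A _. correct_output G (R, A)) R3 A3 (3 + 25 * n + 24 * length (concat adj))"
        proof (rule wp_mono[OF wp_check_prog[where xs = "bucket_sort n L ?ys"]])
          show "memory A3" using memory_of[OF A0(1), of "{2, 4, 5, 6, 7, 8, 9, 10, 11}" A3] A3A0 by simp
          show "A3 3 = (\<lambda>_. 0)" "A3 12 = (\<lambda>_. 0)" "A3 13 = (\<lambda>_. 0)" "A3 14 = (\<lambda>_. 0)"
            using A3A0[of 3] A3A0[of 12] A3A0[of 13] A3A0[of 14]
              A0(2)[of 3] A0(2)[of 12] A0(2)[of 13] A0(2)[of 14] by simp_all
        next
          fix R4 :: "nat \<Rightarrow> nat" and A4 :: "nat \<Rightarrow> nat \<Rightarrow> nat"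
          assume "R4 1 = of_bool (good (marking nb (rev (bucket_sort n L ?ys)))) \<and>
            (\<forall>i<n. A4 3 (bucket_sort n L ?ys ! i) = Suc i)"
          then show "correct_output G (R4, A4)"
            using good_iff_composed[OF st ds K(1) refl, of "A4 3"] by (simp add: correct_output_def)
        qed (use R3 xs in auto)
      qed (use R2 ys d(4) in auto)
    qed (use R1 K dist ds verts_eq in \<open>auto simp: K_def\<close>)
  qed (use mem R d(4) in \<open>auto simp: L_def\<close>)
  then show ?thesis by (simp add: algebra_simps)
qed

end

theorem theorem6:
  "\<exists>search rest c. \<forall>(G :: nat graph) adj.
     simple_graph G \<and> adj_lists G adj \<longrightarrow>
     (let bound = c * (card (verts G) + card (edges G) + 1) in
      \<exists>t1 s1 t s.
        exec bound search (input_state adj) t1 s1 \<and>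
        bfs_order G (map (snd s1 2) [0..<card (verts G)]) \<and>
        exec bound (Seq search rest) (input_state adj) t s \<and>
        t \<le> bound \<and>
        correct_output G s)"
proof (intro exI allI impI)
  fix G :: "nat graph" and adj :: "nat list list"
  assume "simple_graph G \<and> adj_lists G adj"
  then have G: "simple_graph G" and lists: "adj_lists G adj" by blast+
  \<comment> \<open>The running times add up to 21 + 132 \<open>n\<close> + 43 times the total list
    length, and that length is at most twice the number of edges. The same number serves as word
    bound.\<close>
  define W where "W = 132 * (card (verts G) + card (edges G) + 1)"
  \<comment> \<open>The least admissible word bound comes first: it makes
    \<open>length_concat_le\<close> available, by which \<open>W\<close> is seen to be large enough
    for the second interpretation.\<close>
  interpret small: ram_instance G adj "length adj + length (concat adj) + 2"
    by standard (use G lists in auto)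
  have W: "W = 132 * length adj + 132 * card (edges G) + 132" by (simp add: W_def small.card_verts)
  interpret ram_instance G adj W
    by standard (use G lists W small.length_concat_le in auto)
  obtain R0 A0 where s: "input_state adj = (R0, A0)" by (cases "input_state adj")
  have A0: "memory A0" "\<And>a. 2 \<le> a \<Longrightarrow> A0 a = (\<lambda>_. 0)" and R0: "R0 0 = n"
    using memory_input_state s by (auto simp: input_state_def)
  obtain t1 R1 A1 where 1: "exec W bfs_prog (R0, A0) t1 (R1, A1)" "t1 \<le> 4 + 40 * n + 11 * length (concat adj)"
      "bfs_post A0 R1 A1"
  proof -
    have "wp W bfs_prog (\<lambda>R A _. bfs_post A0 R A) R0 A0 (4 + 40 * n + 11 * length (concat adj))"
      by (rule wp_bfs_prog) (use A0 R0 in auto)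
    then show thesis using that by (elim wpE)
  qed
  obtain t2 R2 A2 where 2: "exec W rest_prog (R1, A1) t2 (R2, A2)"
      "t2 \<le> 17 + 92 * n + 32 * length (concat adj)" "correct_output G (R2, A2)"
  proof -
    have "wp W rest_prog (\<lambda>R A _. correct_output G (R, A)) R1 A1 (17 + 92 * n + 32 * length (concat adj))"
      by (rule wp_rest_prog) (use A0 1(3) in auto)
    then show thesis using that by (elim wpE)
  qed
  have "bfs_order G (map (A1 2) [0..<card (verts G)])"
    using 1(3) by (auto simp: bfs_post_def bfs_order_def bfs_state_def card_verts)
  moreover have "exec W (Seq bfs_prog rest_prog) (R0, A0) (t1 + t2) (R2, A2)"
    using 1(1) 2(1) by (rule exec.Seq)
  moreover have "t1 + t2 \<le> W" using 1(2) 2(2) W length_concat_le by linarith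
  ultimately show "let bound = 132 * (card (verts G) + card (edges G) + 1) in
      \<exists>t1 s1 t s.
        exec bound bfs_prog (input_state adj) t1 s1 \<and>
        bfs_order G (map (snd s1 2) [0..<card (verts G)]) \<and>
        exec bound (Seq bfs_prog rest_prog) (input_state adj) t s \<and>
        t \<le> bound \<and>
        correct_output G s"
    using 1(1) 2(3) unfolding Let_def W_def[symmetric] s
    by (intro exI[of _ t1] exI[of _ "(R1, A1)"] exI[of _ "t1 + t2"] exI[of _ "(R2, A2)"]) simp
qed

end
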